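(* Consider the planar system $$\frac{dx}{dt}=-2y^3+a_{22}x^2y^2+a_{50}x^5,\qquad \frac{dy}{dt}=3x^5+b_{13}xy^3+b_{41}x^4y$$ with coefficients depending on two real parameters $\varepsilon_1,\varepsilon_2$ as $$b_{41}=1,\quad a_{50}=-\tfrac15(1-\varepsilon_1),\quad a_{22}=\tfrac1{35}(5+7\varepsilon_2),\quad b_{13}=\tfrac5{21}.$$ When $\varepsilon_1=\varepsilon_2=0$ the origin is an unstable weak focus of order $3$. When $0<\varepsilon_1\ll\varepsilon_2\ll1$, there exist two limit cycles of the system in a neighborhood of the origin.
   Context: Put $x=r^2\cos\theta$, $y=r^3\sin\theta$; the system becomes an equation $$\frac{dr}{d\theta}=r\,\frac{R_0(\theta)+R_1(\theta)r}{Q_0(\theta)+Q_1(\theta)r}$$ with $R_0=\cos\theta\sin\theta(3\cos^4\theta-2\sin^2\theta)$, $Q_0=6(\cos^6\theta+\sin^4\theta)$, $R_1=\cos\theta[\cos^3\theta(a_{50}\cos^2\theta+b_{41}\sin^2\theta)+\sin^2\theta(a_{22}\cos^2\theta+b_{13}\sin^2\theta)]$, $Q_1=-\cos^2\theta\sin\theta[(3a_{50}-2b_{41})\cos^3\theta+(3a_{22}-2b_{13})\sin^2\theta]$. Its solution with $r|_{\theta=0}=h$ ($|h|$ small) is $\tilde r(\theta,h)=\sum_{k\ge1}\nu_k(\theta)h^k$, with $\nu_1(2\pi)=1$. The origin is a weak focus of order $m$ if the first nonzero term among $\nu_k(2\pi)$, $k\ge2$, is $\nu_{2m}(2\pi)$;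 it is unstable if this first nonzero value is positive (nearby orbits spiral away from the origin). A limit cycle is an isolated periodic orbit. The notation $0<\varepsilon_1\ll\varepsilon_2\ll1$ means: $\varepsilon_2>0$ is sufficiently small, and then $\varepsilon_1>0$ is sufficiently small depending on $\varepsilon_2$; the limit cycles lie in any prescribed neighborhood of the origin once the parameters are chosen small enough in this sense. *)

theory Defs
  imports "HOL-Analysis.Analysis"
begin

section \<open>The planar system, its periodic orbits and limit cycles\<close>

definition vfield :: "real \<Rightarrow> real \<Rightarrow> real \<Rightarrow> real \<Rightarrow> real \<times> real \<Rightarrow> real \<times> real" where
  "vfield a22 a50 b13 b41 = (\<lambda>(x, y).
     (- 2 * y^3 + a22 * x^2 * y^2 + a50 * x^5,
      3 * x^5 + b13 * x * y^3 + b41 * x^4 * y))"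

definition periodic_orbit :: "(real \<times> real \<Rightarrow> real \<times> real) \<Rightarrow> (real \<times> real) set \<Rightarrow> bool" where
  "periodic_orbit F C \<longleftrightarrow>
     (\<exists>\<phi> T. (\<forall>t. (\<phi> has_vector_derivative F (\<phi> t)) (at t)) \<and>
            T > 0 \<and> (\<forall>t. \<phi> (t + T) = \<phi> t) \<and>
            (\<exists>t. \<phi> t \<noteq> \<phi> 0) \<and> C = range \<phi>)"

text \<open>A limit cycle is an isolated periodic orbit: some open neighbourhood of it meets no
  other periodic orbit.\<close>

definition limit_cycle :: "(real \<times> real \<Rightarrow> real \<times> real) \<Rightarrow> (real \<times> real) set \<Rightarrow> bool" where
  "limit_cycle F C \<longleftrightarrow>
     periodic_orbit F C \<and>
     (\<exists>W. open W \<and> C \<subseteq> W \<and> (\<forall>C'. periodic_orbit F C' \<and> C' \<inter> W \<noteq> {} \<longrightarrow> C' = C))"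

section \<open>Generalized polar coordinates and weak foci\<close>

text \<open>The substitution \<open>x = r\<^sup>2 cos \<theta>\<close>, \<open>y = r\<^sup>3 sin \<theta>\<close> turns the system into
  \<open>dr/d\<theta> = r (R0 + R1 r) / (Q0 + Q1 r)\<close>; see the lemma \<open>polar_reduction\<close> below.\<close>

definition R0 :: "real \<Rightarrow> real" where
  "R0 \<theta> = cos \<theta> * sin \<theta> * (3 * cos \<theta> ^ 4 - 2 * sin \<theta> ^ 2)"

definition Q0 :: "real \<Rightarrow> real" where
  "Q0 \<theta> = 6 * (cos \<theta> ^ 6 + sin \<theta> ^ 4)"

definition R1 :: "real \<Rightarrow> real \<Rightarrow> real \<Rightarrow> real \<Rightarrow> real \<Rightarrow> real" where
  "R1 a22 a50 b13 b41 \<theta> =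
     cos \<theta> * (cos \<theta> ^ 3 * (a50 * cos \<theta> ^ 2 + b41 * sin \<theta> ^ 2)
            + sin \<theta> ^ 2 * (a22 * cos \<theta> ^ 2 + b13 * sin \<theta> ^ 2))"

definition Q1 :: "real \<Rightarrow> real \<Rightarrow> real \<Rightarrow> real \<Rightarrow> real \<Rightarrow> real" where
  "Q1 a22 a50 b13 b41 \<theta> =
     - (cos \<theta> ^ 2 * sin \<theta> *
        ((3 * a50 - 2 * b41) * cos \<theta> ^ 3 + (3 * a22 - 2 * b13) * sin \<theta> ^ 2))"

lemma polar_reduction:
  fixes r r' \<theta> \<theta>' :: real
  assumes "r \<noteq> 0"
    and "(2 * r * cos \<theta> * r' - r^2 * sin \<theta> * \<theta>', 3 * r^2 * sin \<theta> * r' + r^3 * cos \<theta> * \<theta>')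
         = vfield a22 a50 b13 b41 (r^2 * cos \<theta>, r^3 * sin \<theta>)"
  shows "r' * (Q0 \<theta> + Q1 a22 a50 b13 b41 \<theta> * r) = \<theta>' * (r * (R0 \<theta> + R1 a22 a50 b13 b41 \<theta> * r))"
proof -
  define c s where "c = cos \<theta>" and "s = sin \<theta>"
  define A where "A = R0 \<theta> + R1 a22 a50 b13 b41 \<theta> * r"
  define B where "B = Q0 \<theta> + Q1 a22 a50 b13 b41 \<theta> * r"
  define D where "D = 2 * c^2 + 3 * s^2"
  define X where "X = 2 * r * c * r' - r^2 * s * \<theta>'"
  define Y where "Y = 3 * r^2 * s * r' + r^3 * c * \<theta>'"
  have X: "X = - 2 * (r^3 * s)^3 + a22 * (r^2 * c)^2 * (r^3 * s)^2 + a50 * (r^2 * c)^5"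
    and Y: "Y = 3 * (r^2 * c)^5 + b13 * (r^2 * c) * (r^3 * s)^3 + b41 * (r^2 * c)^4 * (r^3 * s)"
    using assms(2) by (simp_all add: vfield_def X_def Y_def c_def s_def)
  have "r' * (r^4 * D) = r^3 * c * X + r^2 * s * Y"
    unfolding X_def Y_def D_def by algebra
  also have "\<dots> = r^12 * A"
    unfolding X Y A_def R0_def R1_def c_def[symmetric] s_def[symmetric] by algebra
  finally have r': "r' * (r^4 * D) = r^12 * A" .
  have "\<theta>' * (r^4 * D) = 2 * r * c * Y - 3 * r^2 * s * X"
    unfolding X_def Y_def D_def by algebra
  also have "\<dots> = r^11 * B"
    unfolding X Y B_def Q0_def Q1_def c_def[symmetric] s_def[symmetric] by algebra
  finally have t': "\<theta>' * (r^4 * D) = r^11 * B" .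
  have "D = 2 + s^2"
    unfolding D_def c_def s_def by (simp add: cos_squared_eq)
  then have "r^4 * D \<noteq> 0"
    using assms(1) by (simp add: add_nonneg_eq_0_iff)
  moreover have "(r' * B) * (r^4 * D) = (\<theta>' * (r * A)) * (r^4 * D)"
    using r' t' by algebra
  ultimately show ?thesis
    unfolding A_def B_def by simp
qed

definition polar_solution ::
    "real \<Rightarrow> real \<Rightarrow> real \<Rightarrow> real \<Rightarrow> real \<Rightarrow> (real \<Rightarrow> real) \<Rightarrow> bool" where
  "polar_solution a22 a50 b13 b41 h r \<longleftrightarrow>
     r 0 = h \<and>
     (\<forall>\<theta>\<in>{0..2*pi}.
        Q0 \<theta> + Q1 a22 a50 b13 b41 \<theta> * r \<theta> \<noteq> 0 \<and>
        (r has_real_derivative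
           r \<theta> * ((R0 \<theta> + R1 a22 a50 b13 b41 \<theta> * r \<theta>) / (Q0 \<theta> + Q1 a22 a50 b13 b41 \<theta> * r \<theta>)))
          (at \<theta> within {0..2*pi}))"

text \<open>\<open>\<nu> k \<theta>\<close> is the coefficient of \<open>h ^ k\<close>, for \<open>k \<ge> 1\<close>, in the expansion of the solution with
  initial value \<open>h\<close>. On \<open>[0, 2\<pi>]\<close> these coefficients are uniquely determined.\<close>

definition solution_coeffs ::
    "real \<Rightarrow> real \<Rightarrow> real \<Rightarrow> real \<Rightarrow> (nat \<Rightarrow> real \<Rightarrow> real) \<Rightarrow> bool" where
  "solution_coeffs a22 a50 b13 b41 \<nu> \<longleftrightarrow>
     (\<exists>\<delta>>0. \<forall>h. \<bar>h\<bar> < \<delta> \<longrightarrow>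
        (\<exists>r. polar_solution a22 a50 b13 b41 h r \<and>
             (\<forall>\<theta>\<in>{0..2*pi}. (\<lambda>k. \<nu> (Suc k) \<theta> * h ^ Suc k) sums r \<theta>)))"

definition first_nonzero_coeff :: "(nat \<Rightarrow> real \<Rightarrow> real) \<Rightarrow> nat \<Rightarrow> bool" where
  "first_nonzero_coeff \<nu> n \<longleftrightarrow>
     2 \<le> n \<and> \<nu> n (2*pi) \<noteq> 0 \<and> (\<forall>k. 2 \<le> k \<and> k < n \<longrightarrow> \<nu> k (2*pi) = 0)"

definition weak_focus_of_order :: "real \<Rightarrow> real \<Rightarrow> real \<Rightarrow> real \<Rightarrow> nat \<Rightarrow> bool" where
  "weak_focus_of_order a22 a50 b13 b41 m \<longleftrightarrow>
     (\<exists>\<nu>. solution_coeffs a22 a50 b13 b41 \<nu> \<and> \<nu> 1 (2*pi) = 1 \<and> first_nonzero_coeff \<nu> (2*m))"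

definition unstable_weak_focus_of_order :: "real \<Rightarrow> real \<Rightarrow> real \<Rightarrow> real \<Rightarrow> nat \<Rightarrow> bool" where
  "unstable_weak_focus_of_order a22 a50 b13 b41 m \<longleftrightarrow>
     weak_focus_of_order a22 a50 b13 b41 m \<and>
     (\<exists>\<nu>. solution_coeffs a22 a50 b13 b41 \<nu> \<and>
          first_nonzero_coeff \<nu> (2*m) \<and> \<nu> (2*m) (2*pi) > 0)"

end

theory Submission
  imports Defs "HOL-Complex_Analysis.Complex_Analysis"
begin

text \<open>
Write \<open>C = \<nu>\<^sup>2 cos \<theta>\<close> and \<open>S = \<nu>\<^sup>3 sin \<theta>\<close> with \<open>\<nu> = (cos\<^sup>6 \<theta> + sin\<^sup>4 \<theta>) powr (-1/12)\<close>, so that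
\<open>C\<^sup>6 + S\<^sup>4 = 1\<close>. In terms of \<open>z = r / \<nu>\<close> the polar equation becomes \<open>z' = z\<^sup>2 G / (1 + z B)\<close>, where
\<open>G\<close> and \<open>B\<close> are polynomials in \<open>C\<close> and \<open>S\<close> up to a common time change. Its solutions are holomorphic in
the initial value, and a formal logarithmic first integral \<open>ln z + \<Sum> z\<^sup>k g k\<close> gives the first
nonzero coefficient of the return map as a single integral.

With \<open>T' = C S\<^sup>2\<close>, \<open>K = C\<^sup>5 S\<close>, \<open>L = C\<^sup>2 S\<^sup>3\<close> and \<open>a\<close> a primitive of \<open>G\<close>, the coefficients at
\<open>\<epsilon>\<^sub>1 = 0\<close> satisfy \<open>B = (1 + 2\<epsilon>\<^sub>2/5) T - 13 a\<close>. Integration by parts and the reflection \<open>x \<mapsto> -x\<close> then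
reduce the second focal value to a negative multiple of \<open>\<epsilon>\<^sub>2\<close> and, at \<open>\<epsilon>\<^sub>2 = 0\<close>, the third one to an
integral that is cubic in \<open>K\<close> and positive because \<open>C\<^sup>4 S T \<le> S\<^sup>4 / 9\<close>. The first focal value is a
positive multiple of \<open>\<epsilon>\<^sub>1\<close>.

The three alternating signs produce two zeros of the displacement function, which are isolated by
analyticity. A periodic orbit near the corresponding closed curve meets the section \<open>\<theta> = 0\<close> in a compact
set invariant under the monotone return map and its inverse; the point of that set closest to the
fixed point must be the fixed point itself.
\<close>

section \<open>An Abel type equation with a small initial value\<close>

text \<open>The obstacle is that \<open>T\<close> is available only as an integral, so the third
  focal value cannot be evaluated as a sum of moments of monomials in \<open>C\<close> and
  \<open>S\<close>. Its integrand is reduced to a part from which most occurrences of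
  \<open>T\<close> have gone, and the last one is replaced by a bound. The number 13 is what removes
  \<open>K\<close> and \<open>L\<close> from \<open>B + 13 a\<close>: at
  \<open>\<epsilon>\<^sub>1 = 0\<close> the coefficient of \<open>K\<close> is 13/30 in
  \<open>B\<close> and -1/30 in \<open>a\<close>, and those of \<open>L\<close> have the same ratio.
  The second focal value is then quadratic in \<open>a\<close>, and
  \<open>\<eta> = T - 27/2 a\<close> completes the square: at \<open>\<epsilon>\<^sub>2 = 0\<close>
  it is 2/27 times the integral of \<open>\<eta>^2 dT\<close>. Each sign is tested at a single
  initial value. It is an open condition, and it survives a later small change of the parameters
  because the return map is Lipschitz in them. No expansion uniform in the parameters enters; only
  the disc of initial values must be common, and for this reason its radius depends on the bounds
  \<open>M\<close> and \<open>L\<close> alone.\<close>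

definition rhs :: "(real \<Rightarrow> real) \<Rightarrow> (real \<Rightarrow> real) \<Rightarrow> real \<Rightarrow> 'a::real_normed_field \<Rightarrow> 'a" where
  "rhs G B t z = of_real (G t) * z^2 / (1 + of_real (B t) * z)"

text \<open>For solutions bounded by this radius the integral operator is a contraction with constant 1/4.\<close>

definition small_radius :: "real \<Rightarrow> real \<Rightarrow> real" where
  "small_radius M L = 1 / (40 * (M + 1) * (L + 1))"

lemma small_radius_pos: "M \<ge> 0 \<Longrightarrow> L \<ge> 0 \<Longrightarrow> small_radius M L > 0"
  by (simp add: small_radius_def)

lemma small_radius_mult:
  assumes "M \<ge> 0" "L \<ge> 0"
  shows "M * small_radius M L \<le> 1/40" "10 * M * small_radius M L * L \<le> 1/4"
proof -
  have "M * 1 \<le> (M + 1) * (L + 1)" using assms by (intro mult_mono) auto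
  then show "M * small_radius M L \<le> 1/40"
    using assms by (simp add: small_radius_def divide_simps) (simp add: algebra_simps)
  have "M * L \<le> (M + 1) * (L + 1)" using assms by (intro mult_mono) auto
  then show "10 * M * small_radius M L * L \<le> 1/4"
    using assms by (simp add: small_radius_def divide_simps) (simp add: algebra_simps)
qed

lemma denominator_bound:
  fixes z :: "'a::real_normed_field"
  assumes M: "\<bar>b\<bar> \<le> M" "M \<ge> 0" and L: "L \<ge> 0" and z: "norm z \<le> small_radius M L"
  shows "norm (1 + of_real b * z) \<ge> 1/2" "1 + of_real b * z \<noteq> 0"
proof -
  have "norm (of_real b * z) \<le> M * small_radius M L"
    using assms by (simp add: norm_mult mult_mono)
  also have "\<dots> \<le> 1/40" using small_radius_mult assms by blast
  finally have "norm (of_real b * z) \<le> 1/40" .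
  moreover have "norm (1 + of_real b * z) \<ge> norm (1::'a) - norm (of_real b * z)"
    by (metis norm_diff_ineq)
  ultimately show "norm (1 + of_real b * z) \<ge> 1/2" by simp
  then show "1 + of_real b * z \<noteq> 0" by auto
qed

text \<open>The difference factors as \<open>g (z - w) (z + w + z w b)\<close> over the two
  denominators. The last factor is at most 5/2 of the radius and each denominator at least 1/2 in
  norm, which gives 10 = 4 * 5/2.\<close>

lemma rhs_lipschitz:
  fixes z w :: "'a::real_normed_field"
  assumes M: "\<bar>G t\<bar> \<le> M" "\<bar>B t\<bar> \<le> M" "M \<ge> 0" and L: "L \<ge> 0"
    and z: "norm z \<le> small_radius M L" and w: "norm w \<le> small_radius M L"
  shows "norm (rhs G B t z - rhs G B t w) \<le> 10 * M * small_radius M L * norm (z - w)"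
proof -
  define g b where "g = (of_real (G t) :: 'a)" and "b = (of_real (B t) :: 'a)"
  define e where "e = small_radius M L"
  have e: "e > 0" "M * e \<le> 1/40" using small_radius_pos small_radius_mult L M by (auto simp: e_def)
  have d: "1 + b * z \<noteq> 0" "1 + b * w \<noteq> 0" "norm (1 + b * z) \<ge> 1/2" "norm (1 + b * w) \<ge> 1/2"
    using denominator_bound[OF M(2,3) L z] denominator_bound[OF M(2,3) L w] by (auto simp: b_def)
  have eq: "rhs G B t z - rhs G B t w
      = g * (z - w) * (z + w + z * w * b) / ((1 + b * z) * (1 + b * w))"
    using d(1,2) unfolding rhs_def g_def[symmetric] b_def[symmetric]
    by (simp add: divide_simps) algebra
  have nb: "norm b \<le> M" "norm g \<le> M" using M by (auto simp: b_def g_def)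
  have zw: "norm z \<le> e" "norm w \<le> e" using z w by (auto simp: e_def)
  have "norm (z + w + z * w * b) \<le> norm z + norm w + norm z * norm w * norm b"
    by (metis (no_types) norm_mult norm_triangle_mono norm_triangle_ineq order_refl)
  also have "\<dots> \<le> e + e + e * e * M"
    using zw nb e by (intro add_mono mult_mono) auto
  also have "e * e * M = e * (M * e)" by simp
  also have "e + e + e * (M * e) \<le> e + e + e * (1/40)"
    using e by (intro add_mono mult_left_mono) auto
  also have "\<dots> \<le> 5/2 * e" using e by simp
  finally have n: "norm (z + w + z * w * b) \<le> 5/2 * e" .
  have num: "norm (g * (z - w) * (z + w + z * w * b)) \<le> M * norm (z - w) * (5/2 * e)"
    unfolding norm_mult using n nb M by (intro mult_mono) auto
  have den: "norm ((1 + b * z) * (1 + b * w)) \<ge> 1/4"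
    using mult_mono[OF d(3,4)] by (simp add: norm_mult)
  have "norm (rhs G B t z - rhs G B t w) \<le> (M * norm (z - w) * (5/2 * e)) / (1/4)"
    unfolding eq norm_divide using num den M e by (intro frac_le) auto
  then show ?thesis by (simp add: e_def mult_ac)
qed

lemma rhs_bound:
  fixes z :: "'a::real_normed_field"
  assumes M: "\<bar>G t\<bar> \<le> M" "\<bar>B t\<bar> \<le> M" "M \<ge> 0" and L: "L \<ge> 0" and z: "norm z \<le> small_radius M L"
  shows "norm (rhs G B t z) \<le> 2 * M * (norm z)^2"
proof -
  have d: "norm (1 + of_real (B t) * z) \<ge> 1/2" using denominator_bound[OF M(2,3) L z] by auto
  have "norm (rhs G B t z) \<le> (M * (norm z)^2) / (1/2)"
    unfolding rhs_def norm_divide using d M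
    by (intro frac_le) (auto simp: norm_mult norm_power mult_right_mono)
  then show ?thesis by simp
qed

text \<open>The integral form is the one the contraction estimates act on. The field stays generic
  so that the same estimates serve the complex flow, needed for analyticity in the initial value,
  and the real flow.\<close>

definition flow_solution ::
  "(real \<Rightarrow> real) \<Rightarrow> (real \<Rightarrow> real) \<Rightarrow> real \<Rightarrow> 'a::{real_normed_field,euclidean_space} \<Rightarrow> (real \<Rightarrow> 'a) \<Rightarrow> bool" where
  "flow_solution G B L h z \<longleftrightarrow> continuous_on {0..L} z \<and>
     (\<forall>t\<in>{0..L}. z t = h + integral {0..t} (\<lambda>s. rhs G B s (z s)))"

section \<open>Comparison of solutions and Picard iteration\<close>

lemma continuous_on_rhs:
  fixes z :: "real \<Rightarrow> 'a::real_normed_field"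
  assumes "continuous_on {0..L} G" "continuous_on {0..L} B" "continuous_on {0..L} z"
    and M: "\<And>t. t \<in> {0..L} \<Longrightarrow> \<bar>B t\<bar> \<le> M" "M \<ge> 0" and L: "L \<ge> 0"
    and z: "\<And>t. t \<in> {0..L} \<Longrightarrow> norm (z t) \<le> small_radius M L"
  shows "continuous_on {0..L} (\<lambda>s. rhs G B s (z s))"
  unfolding rhs_def
  using denominator_bound(2)[OF M L z]
  by (intro continuous_intros assms) auto

lemma integral_norm_bound_sup:
  fixes f :: "real \<Rightarrow> 'a::euclidean_space"
  assumes "continuous_on {0..L} f" "\<And>t. t \<in> {0..L} \<Longrightarrow> norm (f t) \<le> m" "t \<in> {0..L}" "m \<ge> 0"
  shows "norm (integral {0..t} f) \<le> m * L"
proof -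
  have "continuous_on {0..t} f" by (rule continuous_on_subset[OF assms(1)]) (use assms(3) in auto)
  then have "norm (integral {0..t} f) \<le> m * (t - 0)"
    by (intro integral_bound) (use assms in auto)
  also have "\<dots> \<le> m * L" using assms by (intro mult_left_mono) auto
  finally show ?thesis .
qed

text \<open>Where \<open>norm (z - w)\<close> attains its maximum \<open>m\<close>, the Lipschitz
  part of the integral contributes at most \<open>m / 4\<close> and can be absorbed. The first bound
  yields uniqueness and Lipschitz dependence on the initial value and on the data. For
  \<open>e = 0\<close> the second says that the solution map differs from a translation by at most a
  third of the displacement.\<close>

lemma solution_difference:
  fixes z w :: "real \<Rightarrow> 'a::{real_normed_field,euclidean_space}"
  assumes cont: "continuous_on {0..L} G" "continuous_on {0..L} B"
      "continuous_on {0..L} G'" "continuous_on {0..L} B'"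
    and M: "\<And>t. t \<in> {0..L} \<Longrightarrow> \<bar>G t\<bar> \<le> M" "\<And>t. t \<in> {0..L} \<Longrightarrow> \<bar>B t\<bar> \<le> M"
      "\<And>t. t \<in> {0..L} \<Longrightarrow> \<bar>B' t\<bar> \<le> M"
    and M0: "M \<ge> 0" and L: "L \<ge> 0"
    and z: "flow_solution G B L h z" "\<And>t. t \<in> {0..L} \<Longrightarrow> norm (z t) \<le> small_radius M L"
    and w: "flow_solution G' B' L k w" "\<And>t. t \<in> {0..L} \<Longrightarrow> norm (w t) \<le> small_radius M L"
    and e: "\<And>t. t \<in> {0..L} \<Longrightarrow> norm (rhs G B t (w t) - rhs G' B' t (w t)) \<le> e" "e \<ge> 0"
    and t: "t \<in> {0..L}"
  shows "norm (z t - w t) \<le> 4/3 * (norm (h - k) + e * L)"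
    "norm (z t - w t - (h - k)) \<le> 1/3 * norm (h - k) + 4/3 * e * L"
proof -
  let ?f = "\<lambda>s. rhs G B s (z s)" and ?g = "\<lambda>s. rhs G' B' s (w s)"
  have cz: "continuous_on {0..L} z" and cw: "continuous_on {0..L} w"
    using z(1) w(1) by (auto simp: flow_solution_def)
  have cf: "continuous_on {0..L} ?f"
    by (rule continuous_on_rhs[where M = M and B = B]) (fact cont cz M M0 L z(2))+
  have cg: "continuous_on {0..L} ?g"
    by (rule continuous_on_rhs[where M = M and B = B']) (fact cont cw M M0 L w(2))+
  have "continuous_on {0..L} (\<lambda>s. norm (z s - w s))" by (intro continuous_intros cz cw)
  moreover have "{0..L} \<noteq> {}" using L by simp
  ultimately obtain s0 where s0: "s0 \<in> {0..L}" "\<And>s. s \<in> {0..L} \<Longrightarrow> norm (z s - w s) \<le> norm (z s0 - w s0)"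
    using continuous_attains_sup[of "{0..L}" "\<lambda>s. norm (z s - w s)"] compact_Icc by blast
  define m where "m = norm (z s0 - w s0)"
  define q where "q = 10 * M * small_radius M L"
  have q: "q * L \<le> 1/4" "q \<ge> 0"
    using small_radius_mult(2)[OF M0 L] small_radius_pos[OF M0 L] M0 by (auto simp: q_def)
  have dev: "norm (z s - w s - (h - k)) \<le> (q * m + e) * L" if s: "s \<in> {0..L}" for s
  proof -
    have sub: "{0..s} \<subseteq> {0..L}" using s by auto
    have "z s - w s - (h - k) = integral {0..s} ?f - integral {0..s} ?g"
      using z(1) w(1) s by (simp add: flow_solution_def)
    also have "\<dots> = integral {0..s} (\<lambda>x. ?f x - ?g x)"
      by (intro integral_diff[symmetric] integrable_continuous_real continuous_on_subset[OF _ sub] cf cg)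
    also have "norm \<dots> \<le> (q * m + e) * L"
    proof (rule integral_norm_bound_sup[OF _ _ s])
      show "continuous_on {0..L} (\<lambda>x. ?f x - ?g x)" by (intro continuous_intros cf cg)
      fix x assume x: "x \<in> {0..L}"
      have "norm (?f x - ?g x) \<le> norm (?f x - rhs G B x (w x)) + norm (rhs G B x (w x) - ?g x)"
        using norm_triangle_ineq[of "?f x - rhs G B x (w x)" "rhs G B x (w x) - ?g x"] by simp
      also have "\<dots> \<le> q * norm (z x - w x) + e"
        unfolding q_def by (intro add_mono rhs_lipschitz e(1) M(1,2) M0 L z(2) w(2) x)
      also have "\<dots> \<le> q * m + e" using s0(2)[OF x] q by (simp add: m_def mult_left_mono)
      finally show "norm (?f x - ?g x) \<le> q * m + e" .
    qed (use q e m_def in auto)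
    finally show ?thesis .
  qed
  have m0: "m \<ge> 0" by (simp add: m_def)
  have qm: "(q * m + e) * L \<le> 1/4 * m + e * L"
    using mult_right_mono[OF q(1) m0] by (simp add: algebra_simps)
  have "m \<le> norm (z s0 - w s0 - (h - k)) + norm (h - k)"
    unfolding m_def by (metis diff_add_cancel norm_triangle_ineq)
  also have "\<dots> \<le> 1/4 * m + e * L + norm (h - k)" using dev[OF s0(1)] qm by linarith
  finally have m: "m \<le> 4/3 * (norm (h - k) + e * L)" by simp
  then show "norm (z t - w t) \<le> 4/3 * (norm (h - k) + e * L)" using s0(2)[OF t] m_def by linarith
  show "norm (z t - w t - (h - k)) \<le> 1/3 * norm (h - k) + 4/3 * e * L"
    using dev[OF t] qm m by (simp add: algebra_simps)
qed

text \<open>The absorption argument of \<open>solution_difference\<close> in isolation, for the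
  error term of the difference quotient in \<open>flow_holomorphic\<close>.\<close>

lemma sup_contraction:
  fixes u :: "real \<Rightarrow> 'a::real_normed_vector"
  assumes "continuous_on {0..L} u" "L \<ge> 0"
    and "\<And>m. (\<And>s. s \<in> {0..L} \<Longrightarrow> norm (u s) \<le> m) \<Longrightarrow> (\<And>s. s \<in> {0..L} \<Longrightarrow> norm (u s) \<le> 1/4 * m + c)"
    and "t \<in> {0..L}"
  shows "norm (u t) \<le> 4/3 * c"
proof -
  have "continuous_on {0..L} (\<lambda>s. norm (u s))" by (intro continuous_intros assms)
  moreover have "{0..L} \<noteq> {}" using assms by simp
  ultimately obtain s0 where s0: "s0 \<in> {0..L}" "\<And>s. s \<in> {0..L} \<Longrightarrow> norm (u s) \<le> norm (u s0)"
    using continuous_attains_sup[of "{0..L}" "\<lambda>s. norm (u s)"] compact_Icc by blast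
  have "norm (u s0) \<le> 1/4 * norm (u s0) + c" by (rule assms(3)[OF s0(2) s0(1)])
  then show ?thesis using s0(2)[OF assms(4)] by linarith
qed

section \<open>Linearization and holomorphic dependence on the initial value\<close>

definition rhs_deriv :: "(real \<Rightarrow> real) \<Rightarrow> (real \<Rightarrow> real) \<Rightarrow> real \<Rightarrow> complex \<Rightarrow> complex" where
  "rhs_deriv G B t z = of_real (G t) * (2 * z + of_real (B t) * z^2) / (1 + of_real (B t) * z)^2"

lemma rhs_second_order:
  assumes "1 + of_real (B t) * z \<noteq> 0" "1 + of_real (B t) * w \<noteq> (0::complex)"
  shows "rhs G B t w - rhs G B t z - rhs_deriv G B t z * (w - z)
    = of_real (G t) * (w - z)^2 / ((1 + of_real (B t) * w) * (1 + of_real (B t) * z)^2)"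
  using assms unfolding rhs_def rhs_deriv_def
  by (simp add: divide_simps) algebra

lemma rhs_deriv_bound:
  assumes M: "\<bar>G t\<bar> \<le> M" "\<bar>B t\<bar> \<le> M" "M \<ge> 0" and L: "L \<ge> 0" and z: "norm z \<le> small_radius M L"
  shows "norm (rhs_deriv G B t z) \<le> 10 * M * small_radius M L"
proof -
  define e where "e = small_radius M L"
  have e: "e > 0" "M * e \<le> 1/40" using small_radius_pos small_radius_mult L M by (auto simp: e_def)
  have d: "norm (1 + of_real (B t) * z) \<ge> 1/2" using denominator_bound[OF M(2,3) L z] by auto
  have "norm (2 * z + of_real (B t) * z^2) \<le> 2 * norm z + \<bar>B t\<bar> * (norm z)^2"
    using norm_triangle_ineq[of "2 * z" "of_real (B t) * z^2"] by (simp add: norm_mult norm_power)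
  also have "\<dots> \<le> 2 * e + M * e^2"
    using z M e by (intro add_mono mult_mono power_mono) (auto simp: e_def)
  also have "M * e^2 = (M * e) * e" by (simp add: power2_eq_square)
  also have "2 * e + (M * e) * e \<le> 2 * e + 1/40 * e" using e by (intro add_mono mult_right_mono) auto
  also have "\<dots> \<le> 5/2 * e" using e by simp
  finally have n: "norm (2 * z + of_real (B t) * z^2) \<le> 5/2 * e" .
  have "norm (rhs_deriv G B t z) \<le> (M * (5/2 * e)) / ((1/2)^2)"
    unfolding rhs_deriv_def norm_divide norm_power norm_mult
    using n M e d by (intro frac_le mult_mono power_mono) auto
  then show ?thesis by (simp add: e_def power2_eq_square mult_ac)
qed

locale flow_data =
  fixes G B :: "real \<Rightarrow> real" and M L :: real
  assumes contG: "continuous_on {0..L} G" and contB: "continuous_on {0..L} B"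
    and boundG: "\<And>t. t \<in> {0..L} \<Longrightarrow> \<bar>G t\<bar> \<le> M" and boundB: "\<And>t. t \<in> {0..L} \<Longrightarrow> \<bar>B t\<bar> \<le> M"
    and M0: "M \<ge> 0" and L0: "L \<ge> 0"
begin

lemmas cont = contG contB and M = boundG boundB and L = L0

text \<open>Picard iteration. On the ball of radius \<open>2 * norm h\<close> the integral term is
  at most \<open>8 M L (norm h)^2 \<le> norm h\<close>, so the iterates stay in it. Successive
  iterates differ by at most \<open>4 * norm h * (1/4)^n\<close>, so they converge
  uniformly.\<close>

lemma flow_solution_exists:
  fixes h :: complex
  assumes h: "2 * norm h \<le> small_radius M L"
  shows "\<exists>z. flow_solution G B L h z \<and> (\<forall>t\<in>{0..L}. norm (z t) \<le> 2 * norm h)"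
proof -
  define \<Phi> where "\<Phi> z t = h + integral {0..t} (\<lambda>s. rhs G B s (z s))" for z t
  define Z where "Z n = (\<Phi> ^^ n) (\<lambda>_. h)" for n
  have Z0: "Z 0 = (\<lambda>_. h)" and ZS: "Z (Suc n) = \<Phi> (Z n)" for n by (auto simp: Z_def)
  have inv: "continuous_on {0..L} (Z n) \<and> (\<forall>t\<in>{0..L}. norm (Z n t) \<le> 2 * norm h)" for n
  proof (induction n)
    case 0 then show ?case by (auto simp: Z0)
  next
    case (Suc n)
    let ?f = "\<lambda>s. rhs G B s (Z n s)"
    have zs: "norm (Z n t) \<le> small_radius M L" if "t \<in> {0..L}" for t
      using Suc that h by force
    have cf: "continuous_on {0..L} ?f"
      by (rule continuous_on_rhs[OF cont _ M(2) M0 L zs]) (use Suc in auto)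
    have "continuous_on {0..L} (\<lambda>t. integral {0..t} ?f)"
      by (intro indefinite_integral_continuous_1 integrable_continuous_real cf)
    then have c: "continuous_on {0..L} (Z (Suc n))" unfolding ZS \<Phi>_def by (intro continuous_intros)
    have "norm (Z (Suc n) t) \<le> 2 * norm h" if t: "t \<in> {0..L}" for t
    proof -
      have "norm (integral {0..t} ?f) \<le> 8 * M * (norm h)^2 * L"
      proof (rule integral_norm_bound_sup[OF cf _ t])
        fix s assume s: "s \<in> {0..L}"
        have "norm (?f s) \<le> 2 * M * (norm (Z n s))^2"
          by (rule rhs_bound[of G s M B, OF M(1)[OF s] M(2)[OF s] M0 L zs[OF s]])
        also have "\<dots> \<le> 2 * M * (2 * norm h)^2"
          using Suc s M0 by (intro mult_left_mono power_mono) auto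
        finally show "norm (?f s) \<le> 8 * M * (norm h)^2" by (simp add: power2_eq_square)
      qed (use M0 in auto)
      also have "\<dots> = (4 * (2 * norm h) * M * L) * norm h" by (simp add: power2_eq_square)
      also have "\<dots> \<le> (4 * small_radius M L * M * L) * norm h"
        using h M0 L by (intro mult_right_mono mult_left_mono) auto
      also have "\<dots> \<le> 1 * norm h"
        using small_radius_mult(2)[OF M0 L] by (intro mult_right_mono) (auto simp: mult_ac)
      finally show ?thesis
        unfolding ZS \<Phi>_def using norm_triangle_ineq[of h "integral {0..t} ?f"] by simp
    qed
    with c show ?case by blast
  qed
  have zs: "norm (Z n t) \<le> small_radius M L" if "t \<in> {0..L}" for n t
    using inv[of n] that h by force
  have cf: "continuous_on {0..L} (\<lambda>s. rhs G B s (Z n s))" for n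
    by (rule continuous_on_rhs[OF cont _ M(2) M0 L zs]) (use inv in auto)
  define q where "q = 10 * M * small_radius M L"
  have q: "q * L \<le> 1/4" "q \<ge> 0"
    using small_radius_mult(2)[OF M0 L] small_radius_pos[OF M0 L] M0 by (auto simp: q_def)
  have step: "norm (Z (Suc n) t - Z n t) \<le> 4 * norm h * (1/4)^n" if t: "t \<in> {0..L}" for n t
    using t
  proof (induction n arbitrary: t)
    case 0
    have "norm (Z (Suc 0) t - Z 0 t) \<le> norm (Z (Suc 0) t) + norm (Z 0 t)" by (rule norm_triangle_ineq4)
    also have "\<dots> \<le> 4 * norm h" using inv[of "Suc 0"] inv[of 0] 0 by force
    finally show ?case by simp
  next
    case (Suc n)
    have sub: "{0..t} \<subseteq> {0..L}" using Suc by auto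
    have "Z (Suc (Suc n)) t - Z (Suc n) t
        = integral {0..t} (\<lambda>s. rhs G B s (Z (Suc n) s)) - integral {0..t} (\<lambda>s. rhs G B s (Z n s))"
      by (simp add: ZS[of "Suc n"] ZS[of n] \<Phi>_def)
    also have "\<dots> = integral {0..t} (\<lambda>s. rhs G B s (Z (Suc n) s) - rhs G B s (Z n s))"
      by (intro integral_diff[symmetric] integrable_continuous_real continuous_on_subset[OF _ sub] cf)
    also have "norm \<dots> \<le> (q * (4 * norm h * (1/4)^n)) * L"
    proof (rule integral_norm_bound_sup[OF _ _ Suc.prems])
      show "continuous_on {0..L} (\<lambda>s. rhs G B s (Z (Suc n) s) - rhs G B s (Z n s))"
        by (intro continuous_intros cf)
      fix s assume s: "s \<in> {0..L}"
      have "norm (rhs G B s (Z (Suc n) s) - rhs G B s (Z n s)) \<le> q * norm (Z (Suc n) s - Z n s)"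
        unfolding q_def by (rule rhs_lipschitz[of G s M B, OF M(1)[OF s] M(2)[OF s] M0 L zs[OF s] zs[OF s]])
      also have "\<dots> \<le> q * (4 * norm h * (1/4)^n)"
        using Suc.IH[OF s] q by (intro mult_left_mono) auto
      finally show "norm (rhs G B s (Z (Suc n) s) - rhs G B s (Z n s)) \<le> q * (4 * norm h * (1/4)^n)" .
    qed (use q in auto)
    also have "\<dots> = (q * L) * (4 * norm h * (1/4)^n)" by simp
    also have "\<dots> \<le> 1/4 * (4 * norm h * (1/4)^n)" using q by (intro mult_right_mono) auto
    finally show ?case by simp
  qed
  define z where "z t = h + (\<Sum>i. Z (Suc i) t - Z i t)" for t
  have tele: "(\<Sum>i<n. Z (Suc i) t - Z i t) = Z n t - h" for n t
    using sum_lessThan_telescope[of "\<lambda>i. Z i t" n] by (simp add: Z0)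
  have "uniform_limit {0..L} (\<lambda>n t. \<Sum>i<n. Z (Suc i) t - Z i t) (\<lambda>t. \<Sum>i. Z (Suc i) t - Z i t) sequentially"
    by (rule Weierstrass_m_test[where M = "\<lambda>n. 4 * norm h * (1/4)^n"]) (auto intro!: step)
  then have "uniform_limit {0..L} (\<lambda>n t. h + (\<Sum>i<n. Z (Suc i) t - Z i t)) z sequentially"
    unfolding z_def by (intro uniform_limit_intros)
  then have ul: "uniform_limit {0..L} Z z sequentially" unfolding tele by simp
  have cz: "continuous_on {0..L} z"
    by (rule uniform_limit_theorem[OF _ ul]) (use inv in auto)
  have pt: "(\<lambda>n. Z n t) \<longlonglongrightarrow> z t" if "t \<in> {0..L}" for t
    by (rule tendsto_uniform_limitI[OF ul that])
  have nz: "norm (z t) \<le> 2 * norm h" if "t \<in> {0..L}" for t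
    by (rule LIMSEQ_le_const2[OF tendsto_norm[OF pt[OF that]]]) (use inv that in auto)
  have zs': "norm (z t) \<le> small_radius M L" if "t \<in> {0..L}" for t using nz[OF that] h by linarith
  have cfz: "continuous_on {0..L} (\<lambda>s. rhs G B s (z s))"
    by (rule continuous_on_rhs[OF cont cz M(2) M0 L zs'])
  have "z t = h + integral {0..t} (\<lambda>s. rhs G B s (z s))" if t: "t \<in> {0..L}" for t
  proof -
    have sub: "{0..t} \<subseteq> {0..L}" using t by auto
    have "uniform_limit {0..L} (\<lambda>n s. rhs G B s (Z n s)) (\<lambda>s. rhs G B s (z s)) sequentially"
    proof (rule uniform_limitI)
      fix e :: real assume e: "e > 0"
      have "\<forall>\<^sub>F n in sequentially. \<forall>s\<in>{0..L}. dist (Z n s) (z s) < e / (q + 1)"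
        using uniform_limitD[OF ul] e q by simp
      then show "\<forall>\<^sub>F n in sequentially. \<forall>s\<in>{0..L}. dist (rhs G B s (Z n s)) (rhs G B s (z s)) < e"
      proof (rule eventually_mono, intro ballI)
        fix n s assume *: "\<forall>s\<in>{0..L}. dist (Z n s) (z s) < e / (q + 1)" and s: "s \<in> {0..L}"
        have "norm (rhs G B s (Z n s) - rhs G B s (z s)) \<le> q * norm (Z n s - z s)"
          unfolding q_def by (rule rhs_lipschitz[of G s M B, OF M(1)[OF s] M(2)[OF s] M0 L zs[OF s] zs'[OF s]])
        also have "\<dots> \<le> q * (e / (q + 1))"
          using * s q by (intro mult_left_mono) (auto simp: dist_norm less_imp_le)
        also have "\<dots> < e" using e q by (simp add: field_simps)
        finally show "dist (rhs G B s (Z n s)) (rhs G B s (z s)) < e" by (simp add: dist_norm)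
      qed
    qed
    then have ul': "uniform_limit {0..t} (\<lambda>n s. rhs G B s (Z n s)) (\<lambda>s. rhs G B s (z s)) sequentially"
      using sub by (rule uniform_limit_on_subset)
    have "(\<lambda>n. integral {0..t} (\<lambda>s. rhs G B s (Z n s))) \<longlonglongrightarrow> integral {0..t} (\<lambda>s. rhs G B s (z s))"
    proof -
      have "\<forall>n. continuous_on {0..t} (\<lambda>s. rhs G B s (Z n s))"
        using cf continuous_on_subset sub by blast
      then obtain I J where I: "\<And>n. ((\<lambda>s. rhs G B s (Z n s)) has_integral I n) {0..t}"
        and J: "((\<lambda>s. rhs G B s (z s)) has_integral J) {0..t}" and IJ: "I \<longlonglongrightarrow> J"
        using uniform_limit_integral[OF ul'] by (metis sequentially_bot)
      have "I = (\<lambda>n. integral {0..t} (\<lambda>s. rhs G B s (Z n s)))"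
        using integral_unique[OF I] by auto
      then show ?thesis using IJ integral_unique[OF J] by simp
    qed
    then have "(\<lambda>n. h + integral {0..t} (\<lambda>s. rhs G B s (Z n s))) \<longlonglongrightarrow> h + integral {0..t} (\<lambda>s. rhs G B s (z s))"
      by (intro tendsto_intros)
    moreover have "(\<lambda>n. Z (Suc n) t) \<longlonglongrightarrow> z t" using pt[OF t] by (rule LIMSEQ_Suc)
    ultimately show ?thesis unfolding ZS \<Phi>_def using LIMSEQ_unique by blast
  qed
  then show ?thesis using cz nz by (auto simp: flow_solution_def)
qed

lemma flow_solution_lipschitz:
  fixes z w :: "real \<Rightarrow> 'a::{real_normed_field,euclidean_space}"
  assumes z: "flow_solution G B L h z" "\<And>t. t \<in> {0..L} \<Longrightarrow> norm (z t) \<le> small_radius M L"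
    and w: "flow_solution G B L k w" "\<And>t. t \<in> {0..L} \<Longrightarrow> norm (w t) \<le> small_radius M L"
    and t: "t \<in> {0..L}"
  shows "norm (z t - w t) \<le> 4/3 * norm (h - k)"
    "norm (z t - w t - (h - k)) \<le> 1/3 * norm (h - k)"
  using solution_difference[OF cont cont M M(2) M0 L z w, where e = 0] t by auto

text \<open>The candidate for the derivative in \<open>h\<close> solves the linearized equation
  \<open>w' = \<phi> w\<close> with \<open>w 0 = 1\<close>; this equation is scalar, so
  \<open>w\<close> is an explicit exponential. The remainder of the first order expansion is
  quadratic in \<open>k - h\<close>.\<close>

lemma flow_holomorphic:
  fixes Z :: "real \<Rightarrow> complex \<Rightarrow> complex"
  assumes Z: "\<And>h. h \<in> ball 0 R \<Longrightarrow> flow_solution G B L h (\<lambda>t. Z t h)"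
      "\<And>h t. h \<in> ball 0 R \<Longrightarrow> t \<in> {0..L} \<Longrightarrow> norm (Z t h) \<le> small_radius M L"
    and t0: "t0 \<in> {0..L}"
  shows "Z t0 holomorphic_on ball 0 R"
proof -
  have "(Z t0) field_differentiable (at h)" if h: "h \<in> ball 0 R" for h
  proof -
    define \<phi> where "\<phi> t = rhs_deriv G B t (Z t h)" for t
    define w where "w t = exp (integral {0..t} \<phi>)" for t
    define q where "q = 10 * M * small_radius M L"
    have q: "q * L \<le> 1/4" "q \<ge> 0"
      using small_radius_mult(2)[OF M0 L] small_radius_pos[OF M0 L] M0 by (auto simp: q_def)
    have cz: "continuous_on {0..L} (\<lambda>t. Z t k)" if "k \<in> ball 0 R" for k
      using Z(1)[OF that] by (auto simp: flow_solution_def)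
    have nz: "1 + of_real (B t) * Z t k \<noteq> 0" "norm (1 + of_real (B t) * Z t k) \<ge> 1/2"
      if "k \<in> ball 0 R" "t \<in> {0..L}" for k t
      using denominator_bound[OF M(2)[OF that(2)] M0 L Z(2)[OF that]] by auto
    have c\<phi>: "continuous_on {0..L} \<phi>"
      unfolding \<phi>_def rhs_deriv_def using nz h by (intro continuous_intros cont cz) auto
    have b\<phi>: "norm (\<phi> t) \<le> q" if "t \<in> {0..L}" for t
      unfolding \<phi>_def q_def by (intro rhs_deriv_bound M M0 L Z h that)
    have dw: "(w has_vector_derivative \<phi> t * w t) (at t within {0..L})" if t: "t \<in> {0..L}" for t
    proof -
      have "((\<lambda>t. integral {0..t} \<phi>) has_vector_derivative \<phi> t) (at t within {0..L})"
        by (rule integral_has_vector_derivative[OF c\<phi> t])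
      then have "((exp \<circ> (\<lambda>t. integral {0..t} \<phi>)) has_vector_derivative \<phi> t * exp (integral {0..t} \<phi>)) (at t within {0..L})"
        by (rule field_vector_diff_chain_within) (auto intro!: derivative_eq_intros)
      then show ?thesis by (simp add: o_def w_def[abs_def])
    qed
    have cw: "continuous_on {0..L} w"
      by (rule continuous_on_vector_derivative[OF dw])
    have wint: "integral {0..t} (\<lambda>s. \<phi> s * w s) = w t - 1" if t: "t \<in> {0..L}" for t
    proof -
      have "((\<lambda>s. \<phi> s * w s) has_integral w t - w 0) {0..t}"
      proof (rule fundamental_theorem_of_calculus)
        fix x assume "x \<in> {0..t}"
        then show "(w has_vector_derivative \<phi> x * w x) (at x within {0..t})"
          using t by (intro has_vector_derivative_within_subset[OF dw]) auto
      qed (use t in auto)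
      then show ?thesis by (simp add: integral_unique w_def)
    qed
    have crhs: "continuous_on {0..L} (\<lambda>s. rhs G B s (Z s k))" if "k \<in> ball 0 R" for k
      by (rule continuous_on_rhs[OF cont cz M(2) M0 L Z(2)]) (use that in auto)
    \<comment> \<open>16/9 is the square of the Lipschitz constant 4/3 of the flow, and 8 accounts
      for three denominators of norm at least 1/2.\<close>
    define Cst where "Cst = 8 * M * (16/9) * L"
    have err: "norm (Z t0 k - Z t0 h - (k - h) * w t0) \<le> 4/3 * (Cst * (norm (k - h))^2)"
      if k: "k \<in> ball 0 R" for k
    proof (rule sup_contraction[OF _ L _ t0])
      show "continuous_on {0..L} (\<lambda>t. Z t k - Z t h - (k - h) * w t)"
        by (intro continuous_intros cz cw h k)
      fix m s assume m: "\<And>s. s \<in> {0..L} \<Longrightarrow> norm (Z s k - Z s h - (k - h) * w s) \<le> m" and s: "s \<in> {0..L}"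
      have m0: "m \<ge> 0" using m[OF s] norm_ge_zero order_trans by blast
      have sub: "{0..s} \<subseteq> {0..L}" using s by auto
      have int: "(\<lambda>x. rhs G B x (Z x k)) integrable_on {0..s}" "(\<lambda>x. rhs G B x (Z x h)) integrable_on {0..s}"
        "(\<lambda>x. (k - h) * (\<phi> x * w x)) integrable_on {0..s}"
        by (intro integrable_continuous_real continuous_on_subset[OF _ sub] continuous_intros crhs c\<phi> cw h k)+
      have "Z s k - Z s h - (k - h) * w s
        = integral {0..s} (\<lambda>x. rhs G B x (Z x k)) - integral {0..s} (\<lambda>x. rhs G B x (Z x h)) - (k - h) * (w s - 1)"
        using Z(1)[OF k] Z(1)[OF h] s by (simp add: flow_solution_def algebra_simps)
      also have "\<dots> = integral {0..s} (\<lambda>x. rhs G B x (Z x k)) - integral {0..s} (\<lambda>x. rhs G B x (Z x h))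
          - integral {0..s} (\<lambda>x. (k - h) * (\<phi> x * w x))"
        by (simp add: wint[OF s])
      also have "\<dots> = integral {0..s} (\<lambda>x. rhs G B x (Z x k) - rhs G B x (Z x h) - (k - h) * (\<phi> x * w x))"
        by (simp only: integral_diff[OF int(1,2)] integral_diff[OF integrable_diff[OF int(1,2)] int(3)])
      also have "norm \<dots> \<le> (q * m + 8 * M * (16/9) * (norm (k - h))^2) * L"
      proof (rule integral_norm_bound_sup[OF _ _ s])
        show "continuous_on {0..L} (\<lambda>x. rhs G B x (Z x k) - rhs G B x (Z x h) - (k - h) * (\<phi> x * w x))"
          by (intro continuous_intros crhs c\<phi> cw h k)
        fix x assume x: "x \<in> {0..L}"
        define D where "D = Z x k - Z x h"
        have D: "norm D \<le> 4/3 * norm (k - h)"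
          unfolding D_def
          by (rule flow_solution_lipschitz(1)[OF Z(1)[OF k] Z(2)[OF k] Z(1)[OF h] Z(2)[OF h] x])
        define rem where "rem = of_real (G x) * D^2 / ((1 + of_real (B x) * Z x k) * (1 + of_real (B x) * Z x h)^2)"
        have "rhs G B x (Z x k) - rhs G B x (Z x h) - \<phi> x * D = rem"
          unfolding rem_def D_def \<phi>_def by (rule rhs_second_order) (use nz h k x in auto)
        then have eq: "rhs G B x (Z x k) - rhs G B x (Z x h) - (k - h) * (\<phi> x * w x) = \<phi> x * (D - (k - h) * w x) + rem"
          by (simp add: algebra_simps)
        have "norm rem \<le> (M * (4/3 * norm (k - h))^2) / ((1/2) * (1/2)^2)"
          unfolding rem_def norm_divide norm_mult norm_power
          using D M M0 x nz[OF k x] nz[OF h x]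
          by (intro frac_le mult_mono power_mono) auto
        also have "\<dots> = 8 * M * (16/9) * (norm (k - h))^2" by (simp add: power2_eq_square)
        finally have r: "norm rem \<le> 8 * M * (16/9) * (norm (k - h))^2" .
        have "norm (\<phi> x * (D - (k - h) * w x)) \<le> q * m"
          unfolding norm_mult using b\<phi>[OF x] m[OF x] q by (intro mult_mono) (auto simp: D_def)
        then show "norm (rhs G B x (Z x k) - rhs G B x (Z x h) - (k - h) * (\<phi> x * w x))
            \<le> q * m + 8 * M * (16/9) * (norm (k - h))^2"
          unfolding eq using r norm_triangle_ineq[of "\<phi> x * (D - (k - h) * w x)" rem] by linarith
      qed (use q M0 m0 in auto)
      also have "\<dots> = (q * L) * m + Cst * (norm (k - h))^2" by (simp add: Cst_def algebra_simps)
      also have "\<dots> \<le> 1/4 * m + Cst * (norm (k - h))^2"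
        using q m0 by (intro add_mono mult_right_mono) auto
      finally show "norm (Z s k - Z s h - (k - h) * w s) \<le> 1/4 * m + Cst * (norm (k - h))^2" .
    qed
    have "((\<lambda>k. (Z t0 k - Z t0 h) / (k - h)) \<longlongrightarrow> w t0) (at h)"
    proof -
      show ?thesis
      proof (subst LIM_zero_iff[symmetric], rule Lim_null_comparison)
        have "\<forall>\<^sub>F k in at h. k \<in> ball 0 R \<and> k \<noteq> h"
          using h by (auto simp: eventually_at_filter intro!: eventually_nhds_in_open eventually_mono[OF eventually_nhds_in_open[of "ball 0 R" h]])
        then show "\<forall>\<^sub>F k in at h. norm ((Z t0 k - Z t0 h) / (k - h) - w t0) \<le> 4/3 * Cst * norm (k - h)"
        proof (rule eventually_mono)
          fix k assume k: "k \<in> ball 0 R \<and> k \<noteq> h"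
          then have "(Z t0 k - Z t0 h) / (k - h) - w t0 = (Z t0 k - Z t0 h - (k - h) * w t0) / (k - h)"
            by (simp add: field_simps)
          also have "norm \<dots> \<le> (4/3 * (Cst * (norm (k - h))^2)) / norm (k - h)"
            unfolding norm_divide using k by (intro divide_right_mono err) auto
          also have "\<dots> = 4/3 * Cst * norm (k - h)" using k by (simp add: power2_eq_square)
          finally show "norm ((Z t0 k - Z t0 h) / (k - h) - w t0) \<le> 4/3 * Cst * norm (k - h)" .
        qed
        have "((\<lambda>k. 4/3 * Cst * norm (k - h)) \<longlongrightarrow> 4/3 * Cst * norm (h - h)) (at h)"
          by (intro tendsto_intros)
        then show "((\<lambda>k. 4/3 * Cst * norm (k - h)) \<longlongrightarrow> 0) (at h)" by simp
      qed
    qed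
    then have "(Z t0 has_field_derivative w t0) (at h)"
      by (simp add: has_field_derivative_iff)
    then show ?thesis by (auto simp: field_differentiable_def)
  qed
  then show ?thesis by (auto simp: holomorphic_on_def intro: field_differentiable_at_within)
qed

end

section \<open>Displacement function and focal values\<close>

text \<open>On \<open>[0, L]\<close>, and for \<open>h\<close> in the small disc, the choice is
  determined by uniqueness; see \<open>flow_solution_lipschitz\<close>.\<close>

definition cflow :: "(real \<Rightarrow> real) \<Rightarrow> (real \<Rightarrow> real) \<Rightarrow> real \<Rightarrow> complex \<Rightarrow> real \<Rightarrow> complex" where
  "cflow G B L h = (SOME z. flow_solution G B L h z \<and> (\<forall>t\<in>{0..L}. norm (z t) \<le> 2 * norm h))"

definition rflow :: "(real \<Rightarrow> real) \<Rightarrow> (real \<Rightarrow> real) \<Rightarrow> real \<Rightarrow> real \<Rightarrow> real \<Rightarrow> real" where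
  "rflow G B L x t = Re (cflow G B L (of_real x) t)"

text \<open>Cancelling powers of \<open>z\<close> in \<open>1 + z B\<close> times the derivative of
  a logarithmic first integral forces this recursion: the first term comes from the factor
  \<open>1 + z B\<close>, the second from differentiating \<open>z ^ Suc k\<close>. If the integrals
  of smaller index vanish, the integral of \<open>focal G B k\<close> over \<open>[0, L]\<close> is
  the coefficient of \<open>x ^ (k + 2)\<close> in the return map; see
  \<open>taylor_coeff_return\<close>.\<close>

fun focal :: "(real \<Rightarrow> real) \<Rightarrow> (real \<Rightarrow> real) \<Rightarrow> nat \<Rightarrow> real \<Rightarrow> real" where
  "focal G B 0 t = G t"
| "focal G B (Suc k) t = - B t * focal G B k t - real (Suc k) * G t * integral {0..t} (focal G B k)"

text \<open>Once the coefficients below \<open>k\<close> vanish, dividing by \<open>x ^ k\<close>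
  leaves a function with limit \<open>p k\<close> at 0, while the estimate bounds it by a multiple
  of \<open>x\<close>. Positive \<open>x\<close> suffice, and only these are accessible to the
  logarithm in \<open>log_displacement\<close>.\<close>

lemma powser_small_coeffs:
  fixes p :: "nat \<Rightarrow> real"
  assumes sums: "\<And>x. \<bar>x\<bar> < R \<Longrightarrow> (\<lambda>k. p k * x ^ k) sums f x" and R: "R > 0"
    and small: "\<And>x. 0 < x \<Longrightarrow> x < \<eta> \<Longrightarrow> \<bar>f x\<bar> \<le> C * x ^ Suc n" and \<eta>: "\<eta> > 0"
    and k: "k \<le> n"
  shows "p k = 0"
  using k
proof (induction k rule: less_induct)
  case (less k)
  define g where "g x = (\<Sum>j. p (j + k) * x ^ j)" for x
  have gs: "(\<lambda>j. p (j + k) * x ^ j) sums g x" and gf: "x ^ k * g x = f x" if x: "\<bar>x\<bar> < R" for x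
  proof -
    have z: "(\<Sum>i<k. p i * x ^ i) = 0" using less by simp
    have "(\<lambda>j. p (j + k) * x ^ (j + k)) sums (f x - (\<Sum>i<k. p i * x ^ i))"
      using sums[OF x] by (subst sums_iff_shift) simp
    then have s: "(\<lambda>j. x ^ k * (p (j + k) * x ^ j)) sums f x" by (simp add: z power_add mult_ac)
    show "(\<lambda>j. p (j + k) * x ^ j) sums g x"
    proof (cases "x = 0")
      case True
      have "(\<lambda>j. p (j + k) * 0 ^ j) sums p (0 + k)" by (rule powser_sums_zero)
      then show ?thesis unfolding g_def True by (simp add: sums_iff)
    next
      case False
      have "(\<lambda>j. (x ^ k * (p (j + k) * x ^ j)) / x ^ k) sums (f x / x ^ k)"
        by (rule sums_divide[OF s])
      then show ?thesis using False by (simp add: g_def sums_iff)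
    qed
    then have "(\<lambda>j. x ^ k * (p (j + k) * x ^ j)) sums (x ^ k * g x)" by (rule sums_mult)
    with s show "x ^ k * g x = f x" by (rule sums_unique2[symmetric])
  qed
  have "(g \<longlongrightarrow> p (0 + k)) (at 0)"
    by (rule powser_limit_0[OF R]) (use gs in auto)
  then have lim: "(g \<longlongrightarrow> p k) (at_right 0)" by (simp add: filterlim_at_split)
  have "(g \<longlongrightarrow> 0) (at_right 0)"
  proof (rule Lim_null_comparison)
    have "\<forall>\<^sub>F x in at_right 0. 0 < x \<and> x < min (min R \<eta>) 1"
      using eventually_at_right_real[of 0 "min (min R \<eta>) 1"] R \<eta> by simp
    then show "\<forall>\<^sub>F x in at_right 0. norm (g x) \<le> \<bar>C\<bar> * x"
    proof (rule eventually_mono)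
      fix x assume x: "0 < x \<and> x < min (min R \<eta>) 1"
      have "x ^ k * \<bar>g x\<bar> = \<bar>f x\<bar>" using gf[of x] x by (metis abs_mult abs_of_pos zero_less_power abs_of_nonneg less_imp_le min_less_iff_conj)
      also have "\<dots> \<le> C * x ^ Suc n" using small x by auto
      also have "\<dots> \<le> \<bar>C\<bar> * x ^ Suc k"
        using x less.prems by (intro mult_mono power_decreasing) auto
      finally have "x ^ k * \<bar>g x\<bar> \<le> x ^ k * (\<bar>C\<bar> * x)" by (simp add: mult_ac)
      then show "norm (g x) \<le> \<bar>C\<bar> * x" using x by simp
    qed
    have "((\<lambda>x. \<bar>C\<bar> * x) \<longlongrightarrow> \<bar>C\<bar> * 0) (at_right 0)" by (intro tendsto_intros)
    then show "((\<lambda>x. \<bar>C\<bar> * x) \<longlongrightarrow> 0) (at_right 0)" by simp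
  qed
  with lim show ?case by (rule tendsto_unique[OF trivial_limit_at_right_real])
qed

lemma exp_quadratic_bound:
  fixes u :: real
  assumes "\<bar>u\<bar> \<le> 1/2"
  shows "\<bar>exp u - 1 - u\<bar> \<le> u^2"
proof -
  have "exp u \<ge> 1 + u" by (rule exp_ge_add_one_self)
  moreover have "exp u \<le> 1 + u + u^2"
  proof (cases "u \<ge> 0")
    case True then show ?thesis using exp_bound[of u] assms by simp
  next
    case False
    have "exp u = 1 / exp (- u)" by (simp add: exp_minus inverse_eq_divide)
    also have "\<dots> \<le> 1 / (1 - u)" using exp_ge_add_one_self[of "- u"] False by (intro divide_left_mono) auto
    also have "\<dots> \<le> 1 + u + u^2"
    proof -
      have "1 \<le> (1 + u + u^2) * (1 - u)"
      proof -
        have "(1 + u + u^2) * (1 - u) = 1 - u^2 * u" by (simp add: algebra_simps power2_eq_square)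
        moreover have "u^2 * u \<le> 0" using False by (intro mult_nonneg_nonpos) auto
        ultimately show ?thesis by linarith
      qed
      then show ?thesis using False by (simp add: divide_le_eq)
    qed
    finally show ?thesis .
  qed
  moreover have "u^2 \<ge> 0" by simp
  ultimately show ?thesis by (intro abs_leI) linarith+
qed

lemma integral_reflected:
  assumes "continuous_on {c - b..c - a} (f :: real \<Rightarrow> real)"
  shows "integral {a..b} (\<lambda>s. f (c - s)) = integral {c - b..c - a} f"
proof -
  have "integral {a..b} (\<lambda>s. f (c - s)) = integral {-b..-a} (f \<circ> (\<lambda>x. x + c))"
    using Henstock_Kurzweil_Integration.integral_reflect_real[where a = a and b = b and f = "\<lambda>s. f (c - s)", symmetric] by (simp add: o_def add.commute)
  also have "\<dots> = integral {-b + c..-a + c} f"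
    by (rule integral_shift) (use assms in \<open>simp add: add.commute\<close>)
  finally show ?thesis by (simp add: add.commute)
qed

context flow_data
begin

section \<open>The flow on the disc of small initial values\<close>

definition "R = small_radius M L / 2"

lemma R_pos: "R > 0" using small_radius_pos[OF M0 L0] by (simp add: R_def)

lemma cflow:
  assumes "norm h < R"
  shows "flow_solution G B L h (cflow G B L h)" "t \<in> {0..L} \<Longrightarrow> norm (cflow G B L h t) \<le> 2 * norm h"
    "t \<in> {0..L} \<Longrightarrow> norm (cflow G B L h t) \<le> small_radius M L"
proof -
  have h: "2 * norm h \<le> small_radius M L" using assms by (simp add: R_def)
  have *: "flow_solution G B L h (cflow G B L h) \<and> (\<forall>t\<in>{0..L}. norm (cflow G B L h t) \<le> 2 * norm h)"
    unfolding cflow_def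
    by (rule someI_ex[OF flow_solution_exists[OF h]])
  then show "flow_solution G B L h (cflow G B L h)"
    "t \<in> {0..L} \<Longrightarrow> norm (cflow G B L h t) \<le> 2 * norm h" by auto
  then show "t \<in> {0..L} \<Longrightarrow> norm (cflow G B L h t) \<le> small_radius M L" using h by force
qed

lemma cflow_holomorphic:
  assumes "t \<in> {0..L}"
  shows "(\<lambda>h. cflow G B L h t) holomorphic_on ball 0 R"
  by (rule flow_holomorphic[where Z = "\<lambda>t h. cflow G B L h t"])
     (use cflow assms in auto)

text \<open>\<open>G\<close> and \<open>B\<close> are real, so conjugating a solution gives a
  solution with the conjugate initial value. For a real initial value uniqueness identifies the
  two.\<close>

lemma cflow_of_real:
  assumes x: "\<bar>x\<bar> < R" and t: "t \<in> {0..L}"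
  shows "cflow G B L (of_real x) t = of_real (rflow G B L x t)"
proof -
  define z where "z = cflow G B L (of_real x)"
  have n: "norm (of_real x :: complex) < R" using x by simp
  have fz: "flow_solution G B L (of_real x) z" unfolding z_def by (rule cflow(1)[OF n])
  have bz: "norm (z s) \<le> small_radius M L" if "s \<in> {0..L}" for s
    unfolding z_def by (rule cflow(3)[OF n that])
  have cz: "continuous_on {0..L} z" using fz by (simp add: flow_solution_def)
  have "flow_solution G B L (of_real x) (\<lambda>s. cnj (z s))"
    unfolding flow_solution_def
  proof (intro conjI ballI)
    show "continuous_on {0..L} (\<lambda>s. cnj (z s))" by (intro continuous_intros cz)
    fix s assume s: "s \<in> {0..L}"
    have sub: "{0..s} \<subseteq> {0..L}" using s by auto
    have i: "(\<lambda>r. rhs G B r (z r)) integrable_on {0..s}"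
      by (intro integrable_continuous_real continuous_on_subset[OF _ sub] continuous_on_rhs[OF contG contB cz boundB M0 L0 bz])
    have "cnj (integral {0..s} (\<lambda>r. rhs G B r (z r))) = integral {0..s} (cnj \<circ> (\<lambda>r. rhs G B r (z r)))"
      by (rule integral_linear[OF i bounded_linear_cnj, symmetric])
    also have "cnj \<circ> (\<lambda>r. rhs G B r (z r)) = (\<lambda>r. rhs G B r (cnj (z r)))"
      by (auto simp: rhs_def)
    finally show "cnj (z s) = of_real x + integral {0..s} (\<lambda>r. rhs G B r (cnj (z r)))"
      using fz s by (simp add: flow_solution_def)
  qed
  then have "norm (z t - cnj (z t)) \<le> 4/3 * norm (of_real x - of_real x :: complex)"
    by (intro flow_solution_lipschitz(1)[OF fz bz _ _ t]) (use bz in auto)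
  then have "z t = cnj (z t)" by simp
  then show ?thesis unfolding rflow_def z_def[symmetric] by (metis Reals_cnj_iff of_real_Re)
qed

lemma rflow_bound:
  assumes "\<bar>x\<bar> < R" "t \<in> {0..L}"
  shows "\<bar>rflow G B L x t\<bar> \<le> 2 * \<bar>x\<bar>" "\<bar>rflow G B L x t\<bar> \<le> small_radius M L"
  using cflow(2,3)[of "of_real x" t] assms unfolding cflow_of_real[OF assms] by auto

lemma rflow_solution:
  assumes x: "\<bar>x\<bar> < R"
  shows "flow_solution G B L x (rflow G B L x)"
proof -
  define z where "z = cflow G B L (of_real x)"
  have n: "norm (of_real x :: complex) < R" using x by simp
  have fz: "flow_solution G B L (of_real x) z" unfolding z_def by (rule cflow(1)[OF n])
  have cz: "continuous_on {0..L} z" using fz by (simp add: flow_solution_def)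
  have zr: "z s = of_real (rflow G B L x s)" if "s \<in> {0..L}" for s
    unfolding z_def by (rule cflow_of_real[OF x that])
  have cr: "continuous_on {0..L} (rflow G B L x)"
    unfolding rflow_def[abs_def] z_def[symmetric] by (intro continuous_intros cz)
  have "rflow G B L x t = x + integral {0..t} (\<lambda>s. rhs G B s (rflow G B L x s))" if t: "t \<in> {0..L}" for t
  proof -
    have sub: "{0..t} \<subseteq> {0..L}" using t by auto
    have i: "(\<lambda>r. rhs G B r (rflow G B L x r)) integrable_on {0..t}"
      by (intro integrable_continuous_real continuous_on_subset[OF _ sub] continuous_on_rhs[OF contG contB cr boundB M0 L0])
         (use rflow_bound x in auto)
    have "integral {0..t} (\<lambda>s. rhs G B s (z s)) = integral {0..t} (of_real \<circ> (\<lambda>s. rhs G B s (rflow G B L x s)))"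
      using sub by (intro integral_cong) (auto simp: zr rhs_def)
    also have "\<dots> = of_real (integral {0..t} (\<lambda>s. rhs G B s (rflow G B L x s)))"
      by (rule integral_linear[OF i bounded_linear_of_real])
    finally have "(of_real (rflow G B L x t) :: complex) = of_real (x + integral {0..t} (\<lambda>s. rhs G B s (rflow G B L x s)))"
      using fz t zr[OF t] by (simp add: flow_solution_def)
    then show ?thesis using of_real_eq_iff by blast
  qed
  then show ?thesis using cr by (simp add: flow_solution_def)
qed

lemma continuous_on_rflow: "\<bar>x\<bar> < R \<Longrightarrow> continuous_on {0..L} (rflow G B L x)"
  using rflow_solution by (simp add: flow_solution_def)

lemma rflow_init: "\<bar>x\<bar> < R \<Longrightarrow> rflow G B L x 0 = x"
  using rflow_solution[of x] L0 by (simp add: flow_solution_def)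

lemma rflow_denominator:
  assumes "\<bar>x\<bar> < R" "t \<in> {0..L}"
  shows "\<bar>B t * rflow G B L x t\<bar> \<le> 1/2"
proof -
  have "\<bar>B t * rflow G B L x t\<bar> \<le> M * small_radius M L"
    unfolding abs_mult using assms rflow_bound boundB M0 by (intro mult_mono) auto
  then show ?thesis using small_radius_mult(1)[OF M0 L0] by linarith
qed

lemma rflow_deriv:
  assumes x: "\<bar>x\<bar> < R" and t: "t \<in> {0..L}"
  shows "(rflow G B L x has_real_derivative rhs G B t (rflow G B L x t)) (at t within {0..L})"
proof -
  have c: "continuous_on {0..L} (\<lambda>s. rhs G B s (rflow G B L x s))"
    by (rule continuous_on_rhs[OF contG contB continuous_on_rflow[OF x] boundB M0 L0])
       (use rflow_bound(2)[OF x] in auto)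
  have "((\<lambda>t. x + integral {0..t} (\<lambda>s. rhs G B s (rflow G B L x s))) has_real_derivative rhs G B t (rflow G B L x t)) (at t within {0..L})"
    using integral_has_real_derivative[OF c t] by (auto intro!: derivative_eq_intros)
  moreover have "rflow G B L x s = x + integral {0..s} (\<lambda>s. rhs G B s (rflow G B L x s))" if "s \<in> {0..L}" for s
    using rflow_solution[OF x] that by (simp add: flow_solution_def)
  ultimately show ?thesis
    using t by (subst has_field_derivative_cong_eventually[OF eventually_at_filter[THEN iffD2]])
      (auto intro!: always_eventually)
qed

lemma rflow_lipschitz:
  assumes "\<bar>x\<bar> < R" "\<bar>y\<bar> < R" "t \<in> {0..L}"
  shows "\<bar>rflow G B L x t - rflow G B L y t\<bar> \<le> 4/3 * \<bar>x - y\<bar>"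
    "\<bar>rflow G B L x t - rflow G B L y t - (x - y)\<bar> \<le> 1/3 * \<bar>x - y\<bar>"
  using flow_solution_lipschitz[OF rflow_solution[OF assms(1)] _ rflow_solution[OF assms(2)] _ assms(3)]
    rflow_bound(2)[OF assms(1)] rflow_bound(2)[OF assms(2)] by auto

text \<open>A deviation from translation by a third of \<open>y - x\<close> cannot reverse the
  order.\<close>

lemma rflow_mono:
  assumes "\<bar>x\<bar> < R" "\<bar>y\<bar> < R" "t \<in> {0..L}" "x < y"
  shows "rflow G B L x t < rflow G B L y t"
  proof -
  have "\<bar>x - y\<bar> = y - x" using assms(4) by simp
  then have "rflow G B L x t - rflow G B L y t - (x - y) \<le> 1/3 * (y - x)"
    using abs_le_D1[OF rflow_lipschitz(2)[OF assms(1-3)]] by simp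
  then show ?thesis using assms(4) by (simp add: field_simps)
qed

lemma rflow_zero: "t \<in> {0..L} \<Longrightarrow> rflow G B L 0 t = 0"
  using rflow_bound(1)[of 0 t] R_pos by simp

lemma rflow_pos: "0 < x \<Longrightarrow> x < R \<Longrightarrow> t \<in> {0..L} \<Longrightarrow> 0 < rflow G B L x t"
  using rflow_mono[of 0 x t] rflow_zero R_pos by simp

lemma continuous_on_rflow_initial:
  assumes "t \<in> {0..L}"
  shows "continuous_on {-R<..<R} (\<lambda>x. rflow G B L x t)"
proof -
  have "(4/3)-lipschitz_on {-R<..<R} (\<lambda>x. rflow G B L x t)"
    by (rule lipschitz_onI) (use rflow_lipschitz(1) assms in \<open>auto simp: dist_real_def\<close>)
  then show ?thesis by (rule lipschitz_on_continuous_on)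
qed

definition "taylor_coeff k t = Re ((deriv ^^ k) (\<lambda>h. cflow G B L h t) 0 / fact k)"

lemma rflow_sums:
  assumes x: "\<bar>x\<bar> < R" and t: "t \<in> {0..L}"
  shows "(\<lambda>k. taylor_coeff k t * x ^ k) sums rflow G B L x t"
proof -
  have "(\<lambda>n. (deriv ^^ n) (\<lambda>h. cflow G B L h t) 0 / fact n * (of_real x - 0) ^ n) sums cflow G B L (of_real x) t"
    by (rule holomorphic_power_series[OF cflow_holomorphic[OF t]]) (use x in simp)
  then have "(\<lambda>n. Re ((deriv ^^ n) (\<lambda>h. cflow G B L h t) 0 / fact n * of_real x ^ n)) sums rflow G B L x t"
    unfolding rflow_def by (intro sums_Re) simp
  moreover have "Re (c * of_real x ^ n) = Re c * x ^ n" for c n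
    by (simp flip: of_real_power)
  ultimately show ?thesis unfolding taylor_coeff_def by (simp only:)
qed

lemma continuous_on_focal: "continuous_on {0..L} (focal G B k)"
proof (induction k)
  case 0 then show ?case using contG by (simp add: focal.simps[abs_def])
next
  case (Suc k)
  then show ?case unfolding focal.simps(2)[abs_def]
    by (intro continuous_intros contG contB indefinite_integral_continuous_1 integrable_continuous_real)
qed

section \<open>Expansion of the return map\<close>

lemma focal_bound: "\<exists>K\<ge>0. \<forall>t\<in>{0..L}. \<bar>focal G B k t\<bar> \<le> K"
proof -
  have "bounded (focal G B k ` {0..L})"
    by (intro compact_imp_bounded compact_continuous_image continuous_on_focal compact_Icc)
  then obtain K where "\<forall>t\<in>{0..L}. \<bar>focal G B k t\<bar> \<le> K" by (auto simp: bounded_iff)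
  then show ?thesis by (intro exI[of _ "max K 0"]) auto
qed

text \<open>Permits replacing the solution by its initial value in the leading term of
  \<open>log_displacement\<close>, at the price of one more power of \<open>x\<close>. The quotient
  \<open>y = z / x\<close> is \<open>1 + O(x)\<close> uniformly in \<open>t\<close>.\<close>

lemma rflow_power_estimate:
  "\<exists>K\<ge>0. \<forall>x t. 0 < x \<and> x < min R 1 \<and> t \<in> {0..L} \<longrightarrow>
     \<bar>rflow G B L x t ^ n / (1 + B t * rflow G B L x t) - x ^ n\<bar> \<le> K * x ^ Suc n"
proof -
  define c where "c = 8 * M * L"
  have c0: "c \<ge> 0" using M0 L0 by (simp add: c_def)
  define K where "K = 2 * (c * (real n * 2 ^ n) + 2 * M)"
  have "\<bar>rflow G B L x t ^ n / (1 + B t * rflow G B L x t) - x ^ n\<bar> \<le> K * x ^ Suc n"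
    if x: "0 < x" "x < min R 1" and t: "t \<in> {0..L}" for x t
  proof -
    define z where "z = rflow G B L x"
    define y where "y = z t / x"
    have xR: "\<bar>x\<bar> < R" using x by simp
    have zt: "z t = x * y" using x by (simp add: y_def)
    have "\<bar>z t - x\<bar> \<le> 8 * M * x^2 * L"
    proof -
      have "z t - x = integral {0..t} (\<lambda>s. rhs G B s (z s))"
        using rflow_solution[OF xR] t by (simp add: flow_solution_def z_def)
      also have "norm \<dots> \<le> 8 * M * x^2 * L"
      proof (rule integral_norm_bound_sup[OF _ _ t])
        show "continuous_on {0..L} (\<lambda>s. rhs G B s (z s))"
          unfolding z_def
          by (rule continuous_on_rhs[OF contG contB continuous_on_rflow[OF xR] boundB M0 L0])
             (use rflow_bound(2)[OF xR] in auto)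
        fix s assume s: "s \<in> {0..L}"
        have "norm (rhs G B s (z s)) \<le> 2 * M * (norm (z s))^2"
          by (rule rhs_bound[of G s M B L, OF boundG[OF s] boundB[OF s] M0 L0]) (use rflow_bound(2)[OF xR s] in \<open>simp add: z_def\<close>)
        also have "\<dots> \<le> 2 * M * (2 * x)^2"
          using rflow_bound(1)[OF xR s] M0 x by (intro mult_left_mono power_mono) (auto simp: z_def)
        finally show "norm (rhs G B s (z s)) \<le> 8 * M * x^2" by (simp add: power2_eq_square)
      qed (use M0 in auto)
      finally show ?thesis by simp
    qed
    moreover have "\<bar>z t - x\<bar> = x * \<bar>y - 1\<bar>"
      using x abs_mult[of x "y - 1"] by (simp add: zt algebra_simps)
    ultimately have "x * \<bar>y - 1\<bar> \<le> x * (c * x)"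
      by (simp add: c_def power2_eq_square mult_ac)
    then have y1: "\<bar>y - 1\<bar> \<le> c * x" using x by simp
    have y2: "\<bar>y\<bar> \<le> 2" using rflow_bound(1)[OF xR t] x by (simp add: y_def z_def abs_divide divide_le_eq)
    have d: "\<bar>B t * z t\<bar> \<le> 1/2" using rflow_denominator[OF xR t] by (simp add: z_def)
    then have d2: "1 + B t * z t \<ge> 1/2" by linarith
    have "y ^ n - 1 = (y - 1) * (\<Sum>i<n. y ^ i)" by (rule power_diff_1_eq)
    moreover have "\<bar>\<Sum>i<n. y ^ i\<bar> \<le> (\<Sum>i<n. 2 ^ n)"
    proof (rule order_trans[OF sum_abs sum_mono])
      fix i assume "i \<in> {..<n}"
      have "\<bar>y ^ i\<bar> \<le> 2 ^ i" unfolding power_abs by (rule power_mono[OF y2]) simp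
      also have "\<dots> \<le> 2 ^ n" using \<open>i \<in> {..<n}\<close> by (intro power_increasing) auto
      finally show "\<bar>y ^ i\<bar> \<le> 2 ^ n" .
    qed
    ultimately have yn: "\<bar>y ^ n - 1\<bar> \<le> (c * x) * (real n * 2 ^ n)"
      using y1 c0 x by (simp add: abs_mult mult_mono)
    have Bz: "\<bar>B t * z t\<bar> \<le> M * (2 * x)"
      unfolding abs_mult using boundB[OF t] rflow_bound(1)[OF xR t] M0 x by (intro mult_mono) (auto simp: z_def)
    have "z t ^ n / (1 + B t * z t) - x ^ n = x ^ n * ((y ^ n - 1 - B t * z t) / (1 + B t * z t))"
      using d2 by (simp add: zt power_mult_distrib field_simps)
    also have "\<bar>\<dots>\<bar> = x ^ n * (\<bar>y ^ n - 1 - B t * z t\<bar> / (1 + B t * z t))"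
      using x d2 by (simp add: abs_mult abs_divide)
    also have "\<dots> \<le> x ^ n * (((c * x) * (real n * 2 ^ n) + M * (2 * x)) / (1/2))"
      using x d2 yn Bz by (intro mult_left_mono frac_le) auto
    also have "\<dots> = K * x ^ Suc n" by (simp add: K_def algebra_simps)
    finally show ?thesis by (simp add: z_def)
  qed
  moreover have "K \<ge> 0" using c0 M0 by (simp add: K_def)
  ultimately show ?thesis by blast
qed

text \<open>Multiplying the derivative of \<open>ln z + \<Sum>k=1..m. z ^ k g k\<close> by \<open>1 + z B\<close>, where
  \<open>g (Suc k)\<close> is minus the primitive of \<open>focal k\<close>, makes the sum telescope to \<open>z ^ Suc m * focal m\<close>.\<close>

lemma log_displacement:
  assumes van: "\<And>j. j < m \<Longrightarrow> integral {0..L} (focal G B j) = 0"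
  shows "\<exists>C\<ge>0. \<forall>x. 0 < x \<and> x < min R 1 \<longrightarrow>
    \<bar>ln (rflow G B L x L / x) - x ^ Suc m * integral {0..L} (focal G B m)\<bar> \<le> C * x ^ (m + 2)"
proof -
  obtain K where K: "K \<ge> 0" "\<And>x t. 0 < x \<Longrightarrow> x < min R 1 \<Longrightarrow> t \<in> {0..L} \<Longrightarrow>
     \<bar>rflow G B L x t ^ Suc m / (1 + B t * rflow G B L x t) - x ^ Suc m\<bar> \<le> K * x ^ (m + 2)"
    using rflow_power_estimate[of "Suc m"] by auto
  obtain P where P: "P \<ge> 0" "\<And>t. t \<in> {0..L} \<Longrightarrow> \<bar>focal G B m t\<bar> \<le> P"
    using focal_bound[of m] by auto
  define I where "I j t = integral {0..t} (focal G B j)" for j t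
  have dI: "(I j has_real_derivative focal G B j t) (at t within {0..L})" if "t \<in> {0..L}" for j t
    unfolding I_def by (rule integral_has_real_derivative[OF continuous_on_focal that])
  have I0: "I j 0 = 0" for j by (simp add: I_def)
  have "\<bar>ln (rflow G B L x L / x) - x ^ Suc m * I m L\<bar> \<le> (K * P * L) * x ^ (m + 2)"
    if x: "0 < x" "x < min R 1" for x
  proof -
    define z where "z = rflow G B L x"
    have xR: "\<bar>x\<bar> < R" "x < R" using x by auto
    have zp: "z t > 0" if "t \<in> {0..L}" for t unfolding z_def by (rule rflow_pos[OF x(1) xR(2) that])
    \<comment> \<open>The last term subtracts the expected leading contribution, so that
      \<open>E'\<close> is of order \<open>x ^ (m + 2)\<close>. The sum vanishes at both ends: at 0
      because the primitives start there, at \<open>L\<close> by \<open>van\<close>.\<close>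
    define E where "E t = ln (z t) - (\<Sum>k<m. z t ^ Suc k * I k t) - x ^ Suc m * I m t" for t
    define E' where "E' t = focal G B m t * (z t ^ Suc m / (1 + B t * z t) - x ^ Suc m)" for t
    have dE: "(E has_real_derivative E' t) (at t within {0..L})" if t: "t \<in> {0..L}" for t
    proof -
      define d where "d = 1 + B t * z t"
      have dpos: "d > 0" using rflow_denominator[OF xR(1) t] unfolding d_def z_def by linarith
      define z' where "z' = G t * (z t)^2 / d"
      have dz: "(z has_real_derivative z') (at t within {0..L})"
        using rflow_deriv[OF xR(1) t] by (simp add: z_def z'_def d_def rhs_def)
      have tele: "d * (\<Sum>k<n. real (Suc k) * z t ^ k * z' * I k t + z t ^ Suc k * focal G B k t)
          = z t * G t - z t ^ Suc n * focal G B n t" for n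
      proof (induction n)
        case 0 then show ?case by simp
      next
        case (Suc n)
        have dz': "d * z' = G t * (z t)^2" using dpos by (simp add: z'_def)
        have "d * (real (Suc n) * z t ^ n * z' * I n t + z t ^ Suc n * focal G B n t)
           = real (Suc n) * z t ^ n * (d * z') * I n t + d * (z t ^ Suc n * focal G B n t)"
          by (simp add: algebra_simps)
        also have "d * (z t ^ Suc n * focal G B n t) = z t ^ Suc n * focal G B n t + z t ^ Suc (Suc n) * (B t * focal G B n t)"
          by (simp add: d_def algebra_simps)
        also have "real (Suc n) * z t ^ n * (d * z') * I n t + (z t ^ Suc n * focal G B n t + z t ^ Suc (Suc n) * (B t * focal G B n t))
          = z t ^ Suc n * focal G B n t - z t ^ Suc (Suc n) * focal G B (Suc n) t"
          unfolding dz' by (simp add: I_def[symmetric] algebra_simps power2_eq_square)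
        finally show ?case using Suc.IH by (simp add: distrib_left)
      qed
      have "(E has_real_derivative z' / z t
          - (\<Sum>k<m. real (Suc k) * z t ^ k * z' * I k t + z t ^ Suc k * focal G B k t)
          - x ^ Suc m * focal G B m t) (at t within {0..L})"
        unfolding E_def
        by (rule derivative_eq_intros DERIV_sum dz dI t refl zp)+ (auto simp: field_simps)
      moreover have "z' / z t - (\<Sum>k<m. real (Suc k) * z t ^ k * z' * I k t + z t ^ Suc k * focal G B k t)
          - x ^ Suc m * focal G B m t = E' t"
      proof -
        have "(\<Sum>k<m. real (Suc k) * z t ^ k * z' * I k t + z t ^ Suc k * focal G B k t)
          = (z t * G t - z t ^ Suc m * focal G B m t) / d"
          using tele[of m] dpos by (simp add: field_simps)
        moreover have "z' / z t = z t * G t / d" using zp[OF t] by (simp add: z'_def power2_eq_square)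
        ultimately show ?thesis by (simp add: E'_def d_def[symmetric] diff_divide_distrib algebra_simps)
      qed
      ultimately show ?thesis by simp
    qed
    have bE: "norm (E' t) \<le> P * (K * x ^ (m + 2))" if t: "t \<in> {0..L}" for t
      unfolding E'_def real_norm_def abs_mult z_def using P K(2)[OF x t] t by (intro mult_mono) auto
    have "norm (E L - E 0) \<le> P * (K * x ^ (m + 2)) * norm (L - 0)"
      by (rule field_differentiable_bound[of "{0..L}" E E']) (use dE bE L0 in auto)
    moreover have "E 0 = ln x" using rflow_init[OF xR(1)] by (simp add: E_def I0 z_def)
    moreover have "E L = ln (z L) - x ^ Suc m * I m L"
      using van by (simp add: E_def I_def)
    ultimately show ?thesis
      using zp[of L] L0 x by (simp add: z_def ln_div mult_ac)
  qed
  then show ?thesis unfolding I_def using K(1) P(1) L0 by (intro exI[of _ "K * P * L"]) auto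
qed

text \<open>Exponentiates \<open>log_displacement\<close>: the logarithm \<open>u\<close> of the
  quotient has order \<open>x ^ (m + 1)\<close>, and the error of \<open>exp u = 1 + u\<close>, at
  most \<open>u^2\<close>, has order \<open>2 m + 2\<close>, which is at least \<open>m + 2\<close>.
  The choice of the radius \<open>\<eta>\<close> keeps \<open>u\<close> within 1/2.\<close>

lemma displacement_expansion:
  assumes van: "\<And>j. j < m \<Longrightarrow> integral {0..L} (focal G B j) = 0"
  shows "\<exists>C \<eta>. \<eta> > 0 \<and> \<eta> \<le> R \<and> (\<forall>x. 0 < x \<and> x < \<eta> \<longrightarrow>
    \<bar>rflow G B L x L - x - x ^ (m + 2) * integral {0..L} (focal G B m)\<bar> \<le> C * x ^ (m + 3))"
proof -
  define J where "J = integral {0..L} (focal G B m)"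
  obtain C where C: "C \<ge> 0" "\<And>x. 0 < x \<Longrightarrow> x < min R 1 \<Longrightarrow>
    \<bar>ln (rflow G B L x L / x) - x ^ Suc m * J\<bar> \<le> C * x ^ (m + 2)"
    using log_displacement[OF van] unfolding J_def by blast
  define D where "D = \<bar>J\<bar> + C"
  define \<eta> where "\<eta> = min (min R 1) (1 / (2 * (D + 1)))"
  have D0: "D \<ge> 0" using C by (simp add: D_def)
  have "\<bar>rflow G B L x L - x - x ^ (m + 2) * J\<bar> \<le> (D^2 + C) * x ^ (m + 3)" if x: "0 < x" "x < \<eta>" for x
  proof -
    have x': "x < min R 1" "x \<le> 1" "x < R" using x by (auto simp: \<eta>_def)
    define u where "u = ln (rflow G B L x L / x)"
    have z: "rflow G B L x L / x = exp u"
      using rflow_pos[of x L] x x' L0 by (simp add: u_def)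
    have u1: "\<bar>u - x ^ Suc m * J\<bar> \<le> C * x ^ (m + 2)" unfolding u_def by (rule C(2)[OF x(1) x'(1)])
    have "\<bar>u\<bar> \<le> x ^ Suc m * \<bar>J\<bar> + C * x ^ (m + 2)"
    proof -
      have "\<bar>x ^ Suc m * J\<bar> = x ^ Suc m * \<bar>J\<bar>" using x unfolding abs_mult by simp
      then show ?thesis using u1 by linarith
    qed
    also have "\<dots> \<le> x ^ Suc m * \<bar>J\<bar> + C * x ^ Suc m"
      using C(1) x x' by (intro add_mono mult_left_mono power_decreasing) auto
    finally have u2: "\<bar>u\<bar> \<le> D * x ^ Suc m" by (simp add: D_def algebra_simps)
    also have "\<dots> \<le> D * x ^ 1" using D0 x x' by (intro mult_left_mono power_decreasing) auto
    also have "\<dots> \<le> (D + 1) * (1 / (2 * (D + 1)))" using D0 x by (intro mult_mono) (auto simp: \<eta>_def)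
    also have "\<dots> = 1/2" using D0 by (simp add: divide_simps)
    finally have u3: "\<bar>u\<bar> \<le> 1/2" .
    have "\<bar>exp u - 1 - u\<bar> \<le> u^2" by (rule exp_quadratic_bound[OF u3])
    also have "u^2 \<le> (D * x ^ Suc m)^2" using u2 by (simp add: abs_le_square_iff[symmetric])
    also have "\<dots> = D^2 * x ^ (2 * m + 2)" 
    proof -
      have "(D * x ^ Suc m)^2 = D^2 * x ^ (Suc m * 2)" by (simp only: power_mult_distrib power_mult)
      moreover have "Suc m * 2 = 2 * m + 2" by simp
      ultimately show ?thesis by (simp only:)
    qed
    also have "\<dots> \<le> D^2 * x ^ (m + 2)" using x x' by (intro mult_left_mono power_decreasing) auto
    finally have "\<bar>exp u - 1 - x ^ Suc m * J\<bar> \<le> (D^2 + C) * x ^ (m + 2)"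
      using u1 unfolding distrib_right by linarith
    then have "x * \<bar>exp u - 1 - x ^ Suc m * J\<bar> \<le> x * ((D^2 + C) * x ^ (m + 2))"
      using x by (intro mult_left_mono) auto
    moreover have "x * \<bar>exp u - 1 - x ^ Suc m * J\<bar> = \<bar>x * exp u - x - x ^ (m + 2) * J\<bar>"
      using x by (subst abs_of_pos[OF x(1), symmetric], subst abs_mult[symmetric]) (simp add: algebra_simps)
    moreover have "x * exp u = rflow G B L x L" using x by (simp add: z[symmetric])
    moreover have "x * ((D^2 + C) * x ^ (m + 2)) = (D^2 + C) * x ^ (m + 3)" by (simp add: power_add power2_eq_square power3_eq_cube mult_ac)
    ultimately show ?thesis by (simp only:)
  qed
  moreover have "\<eta> > 0" "\<eta> \<le> R" using R_pos D0 by (auto simp: \<eta>_def)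
  ultimately show ?thesis unfolding J_def by blast
qed

lemma taylor_coeff_return:
  assumes van: "\<And>j. j < m \<Longrightarrow> integral {0..L} (focal G B j) = 0" and k: "k \<le> m + 2"
  shows "taylor_coeff k L = (if k = 1 then 1 else if k = m + 2 then integral {0..L} (focal G B m) else 0)"
proof -
  define J where "J = integral {0..L} (focal G B m)"
  obtain C \<eta> where C: "\<eta> > 0" "\<And>x. 0 < x \<Longrightarrow> x < \<eta> \<Longrightarrow>
    \<bar>rflow G B L x L - x - x ^ (m + 2) * J\<bar> \<le> C * x ^ (m + 3)"
    using displacement_expansion[OF van] unfolding J_def by blast
  define c where "c k = (if k = 1 then 1 else if k = m + 2 then J else 0)" for k
  have cs: "(\<lambda>k. c k * x ^ k) sums (x + x ^ (m + 2) * J)" for x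
  proof -
    have "(\<lambda>k. if k \<in> {1, m + 2} then c k * x ^ k else 0) sums (\<Sum>k\<in>{1, m + 2}. c k * x ^ k)"
      by (rule sums_If_finite_set) simp
    moreover have "(\<lambda>k. if k \<in> {1, m + 2} then c k * x ^ k else 0) = (\<lambda>k. c k * x ^ k)"
      by (auto simp: c_def)
    moreover have "(\<Sum>k\<in>{1, m + 2}. c k * x ^ k) = x + x ^ (m + 2) * J" by (simp add: c_def)
    ultimately show ?thesis by simp
  qed
  have "taylor_coeff k L - c k = 0"
  proof (rule powser_small_coeffs[where f = "\<lambda>x. rflow G B L x L - (x + x ^ (m + 2) * J)" and \<eta> = \<eta> and C = C and n = "m + 2" and R = R])
    show "(\<lambda>k. (taylor_coeff k L - c k) * x ^ k) sums (rflow G B L x L - (x + x ^ (m + 2) * J))" if "\<bar>x\<bar> < R" for x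
      unfolding left_diff_distrib by (intro sums_diff rflow_sums cs that) (use L0 in auto)
    show "\<bar>rflow G B L x L - (x + x ^ (m + 2) * J)\<bar> \<le> C * x ^ Suc (m + 2)" if "0 < x" "x < \<eta>" for x
      using C(2)[OF that] by (simp add: algebra_simps eval_nat_numeral)
  qed (use R_pos C k in auto)
  then show ?thesis by (simp add: c_def J_def)
qed

lemma displacement_sign:
  assumes van: "\<And>j. j < m \<Longrightarrow> integral {0..L} (focal G B j) = 0"
    and J: "integral {0..L} (focal G B m) \<noteq> 0"
  shows "\<exists>\<eta>>0. \<eta> \<le> R \<and> (\<forall>x. 0 < x \<and> x < \<eta> \<longrightarrow>
    (rflow G B L x L - x) * integral {0..L} (focal G B m) > 0)"
proof -
  define J where "J = integral {0..L} (focal G B m)"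
  obtain C \<eta> where C: "\<eta> > 0" "\<eta> \<le> R" "\<And>x. 0 < x \<Longrightarrow> x < \<eta> \<Longrightarrow>
    \<bar>rflow G B L x L - x - x ^ (m + 2) * J\<bar> \<le> C * x ^ (m + 3)"
    using displacement_expansion[OF van] unfolding J_def by blast
  define \<eta>' where "\<eta>' = min \<eta> (\<bar>J\<bar> / (\<bar>C\<bar> + 1))"
  have J0: "\<bar>J\<bar> > 0" using assms by (simp add: J_def)
  have "(rflow G B L x L - x) * J > 0" if x: "0 < x" "x < \<eta>'" for x
  proof -
    have "\<bar>C\<bar> * x \<le> (\<bar>C\<bar> + 1) * x" using x by simp
    also have "\<dots> < (\<bar>C\<bar> + 1) * (\<bar>J\<bar> / (\<bar>C\<bar> + 1))"
      using x by (intro mult_strict_left_mono) (auto simp: \<eta>'_def)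
    also have "\<dots> = \<bar>J\<bar>" by (simp add: divide_simps)
    finally have Cx: "\<bar>C\<bar> * x < \<bar>J\<bar>" .
    define e where "e = rflow G B L x L - x - x ^ (m + 2) * J"
    have "\<bar>e\<bar> \<le> C * x ^ (m + 3)" using C(3) x unfolding e_def \<eta>'_def by simp
    also have "\<dots> \<le> \<bar>C\<bar> * x ^ (m + 3)" using x by (intro mult_right_mono) auto
    also have "\<dots> = x ^ (m + 2) * (\<bar>C\<bar> * x)" by (simp add: power_add eval_nat_numeral)
    also have "\<dots> < x ^ (m + 2) * \<bar>J\<bar>" using Cx x by (intro mult_strict_left_mono) auto
    finally have e: "\<bar>e\<bar> < x ^ (m + 2) * \<bar>J\<bar>" .
    have "\<bar>e * J\<bar> < (x ^ (m + 2) * \<bar>J\<bar>) * \<bar>J\<bar>"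
      unfolding abs_mult using e J0 by (rule mult_strict_right_mono)
    also have "\<dots> = x ^ (m + 2) * (J * J)" by (simp add: abs_mult[symmetric])
    finally have "e * J > - (x ^ (m + 2) * (J * J))" by linarith
    moreover have "(rflow G B L x L - x) * J = e * J + x ^ (m + 2) * (J * J)"
      by (simp add: e_def algebra_simps)
    ultimately show ?thesis by linarith
  qed
  moreover have "\<eta>' > 0" "\<eta>' \<le> R" using C J0 by (auto simp: \<eta>'_def)
  ultimately show ?thesis unfolding J_def by blast
qed

text \<open>Time reversal is the reflection \<open>y \<mapsto> -y\<close>. A primitive from 0 with
  zero total integral has the parity opposite to its integrand, and \<open>B\<close> is odd, so both
  terms of the recursion change parity with \<open>k\<close>.\<close>

lemma focal_parity:
  assumes par: "\<And>t. t \<in> {0..L} \<Longrightarrow> G (L - t) = G t" "\<And>t. t \<in> {0..L} \<Longrightarrow> B (L - t) = - B t"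
    and van: "\<And>j. j < k \<Longrightarrow> integral {0..L} (focal G B j) = 0"
    and t: "t \<in> {0..L}"
  shows "focal G B k (L - t) = (-1) ^ k * focal G B k t"
  using van t
proof (induction k arbitrary: t)
  case 0 then show ?case using par by simp
next
  case (Suc k)
  let ?f = "focal G B k"
  have IH: "?f (L - s) = (-1) ^ k * ?f s" if "s \<in> {0..L}" for s using Suc.IH Suc.prems that by simp
  have c: "continuous_on {a..b} ?f" if "0 \<le> a" "b \<le> L" for a b
    by (rule continuous_on_subset[OF continuous_on_focal]) (use that in auto)
  have "integral {0..L - t} ?f + integral {L - t..L} ?f = integral {0..L} ?f"
    by (rule Henstock_Kurzweil_Integration.integral_combine)
       (use Suc.prems in \<open>auto intro!: integrable_continuous_real c\<close>)
  moreover have "integral {L - t..L} ?f = integral {0..t} (\<lambda>s. ?f (L - s))"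
    using integral_reflected[of L t 0 ?f] c Suc.prems by simp
  moreover have "integral {0..t} (\<lambda>s. ?f (L - s)) = integral {0..t} (\<lambda>s. (-1) ^ k * ?f s)"
    using Suc.prems by (intro integral_cong IH) auto
  ultimately have "integral {0..L - t} ?f = - ((-1) ^ k * integral {0..t} ?f)"
    using Suc.prems(1)[of k] by simp
  then show ?case using par[OF Suc.prems(2)] IH[OF Suc.prems(2)] by (simp add: algebra_simps)
qed

text \<open>The reason why the first nonzero coefficient of the return map has even
  exponent.\<close>

lemma focal_odd_vanishes:
  assumes par: "\<And>t. t \<in> {0..L} \<Longrightarrow> G (L - t) = G t" "\<And>t. t \<in> {0..L} \<Longrightarrow> B (L - t) = - B t"
    and van: "\<And>j. j < k \<Longrightarrow> integral {0..L} (focal G B j) = 0" and k: "odd k"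
  shows "integral {0..L} (focal G B k) = 0"
proof -
  have "integral {0..L} (focal G B k) = integral {0..L} (\<lambda>s. focal G B k (L - s))"
    using integral_reflected[of L L 0 "focal G B k"] continuous_on_focal by simp
  also have "\<dots> = integral {0..L} (\<lambda>s. - focal G B k s)"
    using focal_parity[OF par van] k by (intro integral_cong) auto
  finally show ?thesis by simp
qed

text \<open>The displacement extends holomorphically to the disc. The point \<open>y\<close>, which
  is not fixed, rules out that it vanishes identically, so its zeros are isolated.\<close>

lemma isolated_fixed_point:
  assumes x: "0 < x" "x < R" "rflow G B L x L = x" and y: "0 < y" "y < R" "rflow G B L y L \<noteq> y"
  shows "\<exists>\<eta>>0. \<forall>w. \<bar>w - x\<bar> < \<eta> \<and> w \<noteq> x \<longrightarrow> \<bar>w\<bar> < R \<and> rflow G B L w L \<noteq> w"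
proof -
  have L: "L \<in> {0..L}" using L0 by simp
  define F where "F h = cflow G B L h L - h" for h
  have F: "F (of_real w) = 0 \<longleftrightarrow> rflow G B L w L = w" if "\<bar>w\<bar> < R" for w
    unfolding F_def cflow_of_real[OF that L] by (metis eq_iff_diff_eq_0 of_real_eq_iff)
  have hol: "F holomorphic_on ball 0 R"
    unfolding F_def by (intro holomorphic_intros cflow_holomorphic L)
  obtain r where r: "r > 0" "ball (of_real x) r \<subseteq> ball (0::complex) R"
    "\<And>z. z \<in> ball (of_real x) r - {of_real x} \<Longrightarrow> F z \<noteq> 0"
    by (rule isolated_zeros[OF hol, of "of_real x" "of_real y"]) (use x y F in auto)
  have "\<bar>w\<bar> < R \<and> rflow G B L w L \<noteq> w" if w: "\<bar>w - x\<bar> < r \<and> w \<noteq> x" for w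
  proof -
    have "dist (complex_of_real x) (of_real w) < r"
      using w by (simp add: dist_of_real dist_real_def abs_minus_commute)
    then have *: "of_real w \<in> ball (complex_of_real x) r" by simp
    then have "complex_of_real w \<in> ball 0 R" using r(2) by blast
    then have wR: "\<bar>w\<bar> < R" by simp
    have "F (of_real w) \<noteq> 0" by (rule r(3)) (use * w in auto)
    then show ?thesis using F[OF wR] wR by simp
  qed
  with r(1) show ?thesis by blast
qed

end

text \<open>Both data share \<open>M\<close>, hence the disc of initial values. The constant is 4/3
  times \<open>3 * e * L\<close>, where \<open>3 * e\<close> bounds the change of the right hand
  side.\<close>

lemma rflow_parameter_lipschitz:
  assumes "flow_data G B M L" "flow_data G' B' M L"
    and e: "\<And>t. t \<in> {0..L} \<Longrightarrow> \<bar>G t - G' t\<bar> \<le> e" "\<And>t. t \<in> {0..L} \<Longrightarrow> \<bar>B t - B' t\<bar> \<le> e"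
    and x: "\<bar>x\<bar> < small_radius M L / 2"
  shows "\<bar>rflow G B L x L - rflow G' B' L x L\<bar> \<le> 4 * L * e"
proof -
  interpret F: flow_data G B M L by fact
  interpret F': flow_data G' B' M L by fact
  have R: "F.R = small_radius M L / 2" "F'.R = small_radius M L / 2" by (simp_all add: F.R_def F'.R_def)
  have xR: "\<bar>x\<bar> < F.R" "\<bar>x\<bar> < F'.R" using x by (simp_all add: R)
  have e0: "e \<ge> 0" using e(1)[of 0] F.L0 by fastforce
  have s1: "small_radius M L \<le> 1"
  proof -
    have "1 * 1 \<le> (M + 1) * (L + 1)" using F.M0 F.L0 by (intro mult_mono) auto
    then have "1 \<le> 40 * ((M + 1) * (L + 1))" by linarith
    then have "1 \<le> 40 * (M + 1) * (L + 1)" by (simp only: mult.assoc)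
    then show ?thesis by (simp add: small_radius_def divide_le_eq)
  qed
  have diff: "norm (rhs G B t w - rhs G' B' t w) \<le> 3 * e"
    if t: "t \<in> {0..L}" and w: "norm w \<le> small_radius M L" for t and w :: real
  proof -
    define d d' where "d = 1 + B t * w" and "d' = 1 + B' t * w"
    have d: "\<bar>d\<bar> \<ge> 1/2" "d \<noteq> 0" "\<bar>d'\<bar> \<ge> 1/2" "d' \<noteq> 0"
      using denominator_bound[OF F.boundB[OF t] F.M0 F.L0 w] denominator_bound[OF F'.boundB[OF t] F.M0 F.L0 w]
      by (auto simp: d_def d'_def)
    have Mw: "M * \<bar>w\<bar> \<le> 1/40"
      using small_radius_mult(1)[OF F.M0 F.L0] mult_left_mono[OF w F.M0] by simp
    have w1: "w^2 \<le> 1" using w s1 by (simp add: abs_square_le_1)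
    have "rhs G B t w - rhs G' B' t w = w^2 * ((G t - G' t) / d - G' t * ((B t - B' t) * w) / (d * d'))"
      
    proof -
      have *: "(B t - B' t) * w = d - d'" by (simp add: d_def d'_def algebra_simps)
      show ?thesis unfolding rhs_def * of_real_eq_id id_apply using d(2,4)
        unfolding d_def[symmetric] d'_def[symmetric] by (simp add: field_simps)
    qed
    also have "\<bar>\<dots>\<bar> \<le> 1 * (\<bar>(G t - G' t) / d\<bar> + \<bar>G' t * ((B t - B' t) * w) / (d * d')\<bar>)"
      unfolding abs_mult[of "w^2"] using w1 by (intro mult_mono abs_triangle_ineq4) auto
    also have "\<bar>(G t - G' t) / d\<bar> \<le> e / (1/2)"
      unfolding abs_divide using e(1)[OF t] d by (intro frac_le) auto
    also have "\<bar>G' t * ((B t - B' t) * w) / (d * d')\<bar> \<le> (M * (e * \<bar>w\<bar>)) / ((1/2) * (1/2))"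
      unfolding abs_divide abs_mult using e(2)[OF t] d F'.boundG[OF t] F.M0 e0
      by (intro frac_le mult_mono) auto
    also have "(M * (e * \<bar>w\<bar>)) / ((1/2) * (1/2)) = 4 * e * (M * \<bar>w\<bar>)" by simp
    also have "\<dots> \<le> 4 * e * (1/40)" using Mw e0 by (intro mult_left_mono) auto
    finally show ?thesis using e0 by simp
  qed
  have "norm (rflow G B L x L - rflow G' B' L x L) \<le> 4/3 * (norm (x - x) + (3 * e) * L)"
    by (rule solution_difference(1)[OF F.contG F.contB F'.contG F'.contB F.boundG F.boundB F'.boundB F.M0 F.L0
          F.rflow_solution[OF xR(1)] _ F'.rflow_solution[OF xR(2)]])
      (use F.rflow_bound(2)[OF xR(1)] F'.rflow_bound(2)[OF xR(2)] diff e0 F.L0 in auto)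
  then show ?thesis by (simp add: mult_ac)
qed

section \<open>Generalized trigonometric functions\<close>

text \<open>The unperturbed system \<open>x' = -2 y^3\<close>, \<open>y' = 3 x^5\<close> conserves
  \<open>x^6 + y^4\<close>, and \<open>r = nu \<theta>\<close> is its level 1 in the given
  coordinates. Hence \<open>cs\<close> and \<open>sn\<close> parametrize this level by the angle,
  and \<open>spd\<close> is the derivative of the time of the unperturbed system with respect to the
  angle.\<close>

definition nu :: "real \<Rightarrow> real" where "nu t = (cos t ^ 6 + sin t ^ 4) powr (-1/12)"
definition cs :: "real \<Rightarrow> real" where "cs t = nu t ^ 2 * cos t"
definition sn :: "real \<Rightarrow> real" where "sn t = nu t ^ 3 * sin t"
definition spd :: "real \<Rightarrow> real" where "spd t = nu t ^ 5 * (2 * cos t ^ 2 + 3 * sin t ^ 2) / 6"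

lemma Q0_base_pos: "cos t ^ 6 + sin t ^ 4 > (0::real)"
proof -
  have "cos t ^ 6 \<ge> 0" "sin t ^ 4 \<ge> 0" by auto
  moreover have "cos t \<noteq> 0 \<or> sin t \<noteq> 0" using sin_cos_squared_add[of t] by fastforce
  then have "cos t ^ 6 > 0 \<or> sin t ^ 4 > 0" by (auto simp: zero_less_power_eq)
  ultimately show ?thesis by linarith
qed

lemma nu_pos: "nu t > 0" using Q0_base_pos[of t] by (simp add: nu_def)

lemma nu_power: "nu t ^ 12 * (cos t ^ 6 + sin t ^ 4) = 1"
proof -
  have "nu t ^ 12 = (cos t ^ 6 + sin t ^ 4) powr (-1)"
    using Q0_base_pos[of t] by (simp add: nu_def powr_power)
  then show ?thesis using Q0_base_pos[of t] by (simp add: powr_minus)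
qed

lemma cs_sn: "cs t ^ 6 + sn t ^ 4 = 1"
  using nu_power[of t] by (simp add: cs_def sn_def power_mult_distrib power_mult[symmetric] distrib_left)

lemma nu_deriv: "(nu has_real_derivative nu t * (R0 t / Q0 t)) (at t)"
proof -
  define e where "e = cos t ^ 6 + sin t ^ 4"
  have e: "e > 0" using Q0_base_pos[of t] by (simp add: e_def)
  have "((\<lambda>t. (cos t ^ 6 + sin t ^ 4) powr (-1/12)) has_real_derivative
      (-1/12) * e powr (-1/12 - 1) * (- (6 * cos t ^ 5 * sin t) + 4 * sin t ^ 3 * cos t)) (at t)"
    unfolding e_def by (rule derivative_eq_intros refl | use Q0_base_pos[of t] in simp)+
  moreover have "(-1/12) * e powr (-1/12 - 1) * (- (6 * cos t ^ 5 * sin t) + 4 * sin t ^ 3 * cos t) = nu t * (R0 t / Q0 t)"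
  proof -
    have "e powr (-1/12 - 1) = nu t / e" using e powr_diff[of e "-1/12" 1] by (simp add: nu_def e_def)
    moreover have "- (6 * cos t ^ 5 * sin t) + 4 * sin t ^ 3 * cos t = -2 * R0 t"
      unfolding R0_def by algebra
    moreover have "Q0 t = 6 * e" by (simp add: Q0_def e_def)
    ultimately show ?thesis using e by simp
  qed
  ultimately show ?thesis by (simp add: nu_def[abs_def])
qed

lemma cs_deriv: "(cs has_real_derivative -2 * sn t ^ 3 * spd t) (at t)"
proof -
  define e where "e = cos t ^ 6 + sin t ^ 4"
  have e: "e > 0" "Q0 t = 6 * e" using Q0_base_pos[of t] by (auto simp: e_def Q0_def)
  have "((\<lambda>t. nu t ^ 2 * cos t) has_real_derivative 2 * nu t * (nu t * (R0 t / Q0 t)) * cos t - nu t ^ 2 * sin t) (at t)"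
    by (rule derivative_eq_intros nu_deriv refl | simp)+
  moreover have "2 * nu t * (nu t * (R0 t / Q0 t)) * cos t - nu t ^ 2 * sin t = -2 * sn t ^ 3 * spd t"
  proof -
    have "e * (2 * nu t * (nu t * (R0 t / Q0 t)) * cos t - nu t ^ 2 * sin t)
        = nu t ^ 2 * (cos t * R0 t / 3 - e * sin t)"
      using e by (simp add: field_simps power2_eq_square)
    also have "cos t * R0 t / 3 - e * sin t = - (sin t ^ 3 * (2 * cos t ^ 2 + 3 * sin t ^ 2) / 3)"
      unfolding R0_def e_def by algebra
    \<comment> \<open>The inserted factor equals 1 and raises the degree in \<open>nu\<close> from 2
      to 14, that of \<open>sn ^ 3 * spd\<close>.\<close>
    also have "nu t ^ 2 * - (sin t ^ 3 * (2 * cos t ^ 2 + 3 * sin t ^ 2) / 3)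
        = (nu t ^ 12 * e) * (nu t ^ 2 * - (sin t ^ 3 * (2 * cos t ^ 2 + 3 * sin t ^ 2) / 3))"
      using nu_power[of t] by (simp add: e_def)
    also have "\<dots> = e * (-2 * sn t ^ 3 * spd t)" unfolding sn_def spd_def by algebra
    finally show ?thesis using e(1) by (simp only: mult_cancel_left) simp
  qed
  ultimately show ?thesis by (simp add: cs_def[abs_def])
qed

lemma sn_deriv: "(sn has_real_derivative 3 * cs t ^ 5 * spd t) (at t)"
proof -
  define e where "e = cos t ^ 6 + sin t ^ 4"
  have e: "e > 0" "Q0 t = 6 * e" using Q0_base_pos[of t] by (auto simp: e_def Q0_def)
  have "((\<lambda>t. nu t ^ 3 * sin t) has_real_derivative 3 * nu t ^ 2 * (nu t * (R0 t / Q0 t)) * sin t + nu t ^ 3 * cos t) (at t)"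
    by (rule derivative_eq_intros nu_deriv refl | simp)+
  moreover have "3 * nu t ^ 2 * (nu t * (R0 t / Q0 t)) * sin t + nu t ^ 3 * cos t = 3 * cs t ^ 5 * spd t"
  proof -
    have "e * (3 * nu t ^ 2 * (nu t * (R0 t / Q0 t)) * sin t + nu t ^ 3 * cos t)
        = nu t ^ 3 * (sin t * R0 t / 2 + e * cos t)"
      using e by (simp add: field_simps power2_eq_square power3_eq_cube)
    also have "sin t * R0 t / 2 + e * cos t = cos t ^ 5 * (2 * cos t ^ 2 + 3 * sin t ^ 2) / 2"
      unfolding R0_def e_def by algebra
    also have "nu t ^ 3 * (cos t ^ 5 * (2 * cos t ^ 2 + 3 * sin t ^ 2) / 2)
        = (nu t ^ 12 * e) * (nu t ^ 3 * (cos t ^ 5 * (2 * cos t ^ 2 + 3 * sin t ^ 2) / 2))"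
      using nu_power[of t] by (simp add: e_def)
    also have "\<dots> = e * (3 * cs t ^ 5 * spd t)" unfolding cs_def spd_def by algebra
    finally show ?thesis using e(1) by (simp only: mult_cancel_left) simp
  qed
  ultimately show ?thesis by (simp add: sn_def[abs_def])
qed

lemma spd_pos: "spd t > 0"
proof -
  have "2 * cos t ^ 2 + 3 * sin t ^ 2 = 2 + sin t ^ 2" by (simp add: cos_squared_eq)
  then show ?thesis using nu_pos[of t] by (simp only: spd_def) (simp add: add_pos_nonneg)
qed

lemma continuous_on_basic [continuous_intros]:
  "continuous_on A nu" "continuous_on A cs" "continuous_on A sn" "continuous_on A spd"
proof -
  show nu: "continuous_on A nu"
    by (rule DERIV_continuous_on[OF has_field_derivative_at_within[OF nu_deriv]])
  show "continuous_on A cs" "continuous_on A sn" "continuous_on A spd"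
    unfolding cs_def[abs_def] sn_def[abs_def] spd_def[abs_def] by (intro continuous_intros nu; simp)+
qed

text \<open>With \<open>x = z^2 cs\<close> and \<open>y = z^3 sn\<close> one has
  \<open>x^6 + y^4 = z^12\<close>. The bracket is the derivative of \<open>x^6 + y^4\<close> along
  the perturbing terms at \<open>z = 1\<close>; 12 is the exponent of \<open>z\<close>, and
  \<open>spd\<close> passes from time to angle. The function \<open>twist\<close> measures the
  relative change of the angular speed; see \<open>Q_twist\<close>.\<close>

definition drift :: "real \<Rightarrow> real \<Rightarrow> real \<Rightarrow> real \<Rightarrow> real \<Rightarrow> real" where
  "drift a22 a50 b13 b41 t =
     (6 * a22 * cs t ^ 7 * sn t ^ 2 + 4 * b13 * cs t * sn t ^ 6 + 6 * a50 * cs t ^ 10 + 4 * b41 * cs t ^ 4 * sn t ^ 4) / 12 * spd t"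

definition twist :: "real \<Rightarrow> real \<Rightarrow> real \<Rightarrow> real \<Rightarrow> real \<Rightarrow> real" where
  "twist a22 a50 b13 b41 t = ((2 * b13 - 3 * a22) * cs t ^ 2 * sn t ^ 3 + (2 * b41 - 3 * a50) * cs t ^ 5 * sn t) / 6"

lemma Q_twist:
  "Q0 t + Q1 a22 a50 b13 b41 t * (nu t * z) = Q0 t * (1 + twist a22 a50 b13 b41 t * z)"
proof -
  have "Q0 t * twist a22 a50 b13 b41 t = (nu t ^ 12 * (cos t ^ 6 + sin t ^ 4)) * (nu t * Q1 a22 a50 b13 b41 t)"
    unfolding Q0_def Q1_def twist_def cs_def sn_def by algebra
  then have "Q0 t * twist a22 a50 b13 b41 t = nu t * Q1 a22 a50 b13 b41 t" by (simp only: nu_power mult_1)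
  then show ?thesis by (simp add: algebra_simps)
qed

text \<open>By the product rule the left hand side is the derivative of \<open>r = nu z\<close>. The
  factor \<open>nu\<close> absorbs the \<open>R0\<close> part of the polar equation except for the
  contribution of \<open>R0\<close> times the twist, and \<open>key\<close> shows that the drift
  accounts for it.\<close>

lemma polar_rhs:
  assumes "1 + twist a22 a50 b13 b41 t * z \<noteq> 0"
  shows "nu t * (R0 t / Q0 t) * z + nu t * rhs (drift a22 a50 b13 b41) (twist a22 a50 b13 b41) t z
    = (nu t * z) * ((R0 t + R1 a22 a50 b13 b41 t * (nu t * z)) / (Q0 t + Q1 a22 a50 b13 b41 t * (nu t * z)))"
proof -
  define e where "e = cos t ^ 6 + sin t ^ 4"
  have e: "e > 0" "Q0 t = 6 * e" using Q0_base_pos[of t] by (auto simp: e_def Q0_def)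
  define B where "B = twist a22 a50 b13 b41 t"
  have B: "6 * e * B = nu t * Q1 a22 a50 b13 b41 t"
    using Q_twist[of t a22 a50 b13 b41 1] e by (simp add: B_def algebra_simps)
  define A where "A = drift a22 a50 b13 b41 t"
  define P where "P = 6 * a22 * cos t ^ 7 * sin t ^ 2 + 4 * b13 * cos t * sin t ^ 6 + 6 * a50 * cos t ^ 10 + 4 * b41 * cos t ^ 4 * sin t ^ 4"
  have "36 * e^2 * A = (nu t ^ 12 * e)^2 * (nu t * ((2 * cos t ^ 2 + 3 * sin t ^ 2) * P / 2))"
    unfolding A_def drift_def cs_def sn_def spd_def P_def by algebra
  also have "(2 * cos t ^ 2 + 3 * sin t ^ 2) * P / 2 = 6 * e * R1 a22 a50 b13 b41 t - R0 t * Q1 a22 a50 b13 b41 t"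
    unfolding R0_def R1_def Q1_def e_def P_def by algebra
  finally have "36 * e^2 * A = 6 * e * (nu t * R1 a22 a50 b13 b41 t) - R0 t * (nu t * Q1 a22 a50 b13 b41 t)"
    using nu_power[of t] by (simp add: e_def algebra_simps)
  then have "6 * e * (6 * e * A) = 6 * e * (nu t * R1 a22 a50 b13 b41 t - R0 t * B)"
    unfolding B[symmetric] by (simp add: algebra_simps power2_eq_square)
  then have key: "6 * e * A = nu t * R1 a22 a50 b13 b41 t - R0 t * B" using e by simp
  define d where "d = 1 + B * z"
  have d: "d \<noteq> 0" using assms by (simp add: d_def B_def)
  have "nu t * (R0 t / Q0 t) * z + nu t * rhs (drift a22 a50 b13 b41) (twist a22 a50 b13 b41) t z
      = nu t * z * ((R0 t * d + 6 * e * A * z) / (6 * e * d))"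
    using d e unfolding rhs_def of_real_eq_id id_apply A_def[symmetric] B_def[symmetric] d_def[symmetric]
    by (simp add: field_simps power2_eq_square)
  also have "R0 t * d + 6 * e * A * z = R0 t + R1 a22 a50 b13 b41 t * (nu t * z)"
    unfolding key d_def by (simp add: algebra_simps)
  finally show ?thesis unfolding d_def B_def Q_twist unfolding e(2) .
qed

lemma polar_derivative:
  assumes "1 + twist a22 a50 b13 b41 t * z t \<noteq> 0"
    and "(z has_real_derivative rhs (drift a22 a50 b13 b41) (twist a22 a50 b13 b41) t (z t)) (at t within A)"
  shows "Q0 t + Q1 a22 a50 b13 b41 t * (nu t * z t) \<noteq> 0"
    "((\<lambda>t. nu t * z t) has_real_derivative (nu t * z t) *
       ((R0 t + R1 a22 a50 b13 b41 t * (nu t * z t)) / (Q0 t + Q1 a22 a50 b13 b41 t * (nu t * z t)))) (at t within A)"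
proof -
  show "Q0 t + Q1 a22 a50 b13 b41 t * (nu t * z t) \<noteq> 0"
    unfolding Q_twist using assms(1) Q0_base_pos[of t] by (simp add: Q0_def)
  have "((\<lambda>t. nu t * z t) has_real_derivative nu t * (R0 t / Q0 t) * z t
      + nu t * rhs (drift a22 a50 b13 b41) (twist a22 a50 b13 b41) t (z t)) (at t within A)"
    by (rule DERIV_mult'[OF has_field_derivative_at_within[OF nu_deriv] assms(2), THEN DERIV_cong]) simp
  then show "((\<lambda>t. nu t * z t) has_real_derivative (nu t * z t) *
       ((R0 t + R1 a22 a50 b13 b41 t * (nu t * z t)) / (Q0 t + Q1 a22 a50 b13 b41 t * (nu t * z t)))) (at t within A)"
    unfolding polar_rhs[OF assms(1)] .
qed


section \<open>Focal values through integration by parts\<close>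

lemma integral_ftc:
  fixes f :: "real \<Rightarrow> real"
  assumes "\<And>t. t \<in> {0..L} \<Longrightarrow> (f has_real_derivative f' t) (at t within {0..L})" "t \<in> {0..L}"
  shows "integral {0..t} f' = f t - f 0"
proof (rule integral_unique, rule fundamental_theorem_of_calculus)
  fix x assume x: "x \<in> {0..t}"
  then have "(f has_real_derivative f' x) (at x within {0..t})"
    using assms(2) by (intro DERIV_subset[OF assms(1)]) auto
  then show "(f has_vector_derivative f' x) (at x within {0..t})"
    by (simp add: has_real_derivative_iff_has_vector_derivative)
qed (use assms in auto)

lemma focal_step:
  assumes g: "\<And>t. t \<in> {0..L} \<Longrightarrow> (g has_real_derivative P t) (at t within {0..L})" "g 0 = 0"
    and P: "\<And>t. t \<in> {0..L} \<Longrightarrow> focal G B k t = P t" and t: "t \<in> {0..L}"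
  shows "focal G B (Suc k) t = - B t * P t - real (Suc k) * G t * g t"
    "integral {0..t} (focal G B k) = g t"
proof -
  have "integral {0..t} (focal G B k) = g t - g 0"
    by (rule integral_ftc[OF _ t]) (use g P in auto)
  then show *: "integral {0..t} (focal G B k) = g t" using g by simp
  then show "focal G B (Suc k) t = - B t * P t - real (Suc k) * G t * g t" using P[OF t] by simp
qed

text \<open>With \<open>B = T - 13 a\<close> the integrand is \<open>G\<close> times
  \<open>144 a^2 - 25 a T + T^2 + 2 H\<close>. As \<open>G\<close> is the derivative of
  \<open>a\<close>, every term is integrated by parts. The one with \<open>H\<close> turns -25 into
  -27, and moving the derivative from \<open>a^2\<close> to \<open>T\<close> leaves
  \<open>27/2 a^2 T'\<close>; the one with \<open>T^2\<close> leaves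
  \<open>- 2 a T T'\<close>.\<close>

lemma focal_two:
  assumes L: "L \<ge> 0"
    and a: "\<And>t. t \<in> {0..L} \<Longrightarrow> (a has_real_derivative G t) (at t within {0..L})" "a 0 = 0" "a L = 0"
    and T: "\<And>t. t \<in> {0..L} \<Longrightarrow> (T has_real_derivative T' t) (at t within {0..L})" "T 0 = 0" "T L = 0"
    and H: "\<And>t. t \<in> {0..L} \<Longrightarrow> (H has_real_derivative T t * G t) (at t within {0..L})" "H 0 = 0" "H L = 0"
    and B: "\<And>t. t \<in> {0..L} \<Longrightarrow> B t = T t - 13 * a t"
    and cont: "continuous_on {0..L} T'"
  shows "integral {0..L} (focal G B 0) = 0" "integral {0..L} (focal G B 1) = 0"
    "integral {0..L} (focal G B 2) = integral {0..L} (\<lambda>t. (27/2 * (a t)^2 - 2 * a t * T t) * T' t)"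
proof -
  have Lm: "L \<in> {0..L}" using L by simp
  define h where "h t = 6 * (a t)^2 - H t" for t
  define P1 where "P1 t = - (T t - 12 * a t) * G t" for t
  define P2 where "P2 t = ((T t - 13 * a t) * (T t - 12 * a t) - 2 * h t) * G t" for t
  have f0: "focal G B 0 t = G t" if "t \<in> {0..L}" for t by simp
  note s0 = focal_step[OF a(1,2) f0]
  have f1: "focal G B (Suc 0) t = P1 t" if "t \<in> {0..L}" for t
  proof -
    have "focal G B (Suc 0) t = - B t * G t - real (Suc 0) * G t * a t"
      by (rule focal_step(1)[where L = L, OF a(1,2) f0 that])
    then show ?thesis using B[OF that] by (simp only: P1_def of_nat_Suc of_nat_0) (simp add: algebra_simps)
  qed
  have dh: "(h has_real_derivative P1 t) (at t within {0..L})" if t: "t \<in> {0..L}" for t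
    unfolding h_def P1_def by (rule derivative_eq_intros a(1) H(1) t refl)+ (simp add: algebra_simps)
  have h0: "h 0 = 0" "h L = 0" using a H by (auto simp: h_def)
  note s1 = focal_step[OF dh h0(1) f1]
  have f2: "focal G B (Suc (Suc 0)) t = P2 t" if "t \<in> {0..L}" for t
  proof -
    have "focal G B (Suc (Suc 0)) t = - B t * P1 t - real (Suc (Suc 0)) * G t * h t"
      by (rule focal_step(1)[where L = L, OF dh h0(1) f1 that])
    then show ?thesis using B[OF that] by (simp only: P1_def P2_def of_nat_Suc of_nat_0) (simp add: algebra_simps)
  qed
  show "integral {0..L} (focal G B 0) = 0" using s0(2)[OF _ _ Lm] a by simp
  show "integral {0..L} (focal G B 1) = 0" using s1(2)[OF _ _ Lm] h0 by simp
  define U where "U t = 48 * (a t)^3 + 2 * a t * H t + a t * (T t)^2 - 27/2 * (a t)^2 * T t" for t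
  define Q where "Q t = (27/2 * (a t)^2 - 2 * a t * T t) * T' t" for t
  have dU: "(U has_real_derivative P2 t - Q t) (at t within {0..L})" if t: "t \<in> {0..L}" for t
    unfolding U_def P2_def Q_def h_def
    by (rule derivative_eq_intros a(1) H(1) T(1) t refl)+ (simp add: algebra_simps power2_eq_square)
  have cG: "continuous_on {0..L} a" "continuous_on {0..L} T"
    by (rule DERIV_continuous_on, erule a(1) T(1))+
  have "integral {0..L} (\<lambda>t. P2 t - Q t) = U L - U 0" by (rule integral_ftc[OF dU Lm])
  then have "integral {0..L} (\<lambda>t. P2 t - Q t) = 0" using a T H by (simp add: U_def)
  moreover have "Q integrable_on {0..L}"
    unfolding Q_def by (intro integrable_continuous_real continuous_intros cG cont)
  moreover have "(\<lambda>t. P2 t - Q t) integrable_on {0..L}"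
    using fundamental_theorem_of_calculus[of 0 L U "\<lambda>t. P2 t - Q t"] dU L
    by (auto simp: has_real_derivative_iff_has_vector_derivative)
  ultimately have "integral {0..L} P2 = integral {0..L} Q"
    using integral_add[of "\<lambda>t. P2 t - Q t" "{0..L}" Q] by simp
  moreover have "integral {0..L} (focal G B 2) = integral {0..L} P2"
    using f2 by (intro integral_cong) (simp add: numeral_2_eq_2)
  ultimately show "integral {0..L} (focal G B 2) = integral {0..L} (\<lambda>t. (27/2 * (a t)^2 - 2 * a t * T t) * T' t)"
    by (simp add: Q_def[abs_def])
qed

text \<open>The denominators of the coefficients are cleared by \<open>1594323 = 3 ^ 13\<close>; \<open>U1\<close> and \<open>U2\<close> collect the
  boundary terms of the integrations by parts, before and after substituting \<open>a = 2/27 (T - \<eta>)\<close>.\<close>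

lemma focal_four:
  fixes a \<eta> T H1 H2 :: "real \<Rightarrow> real"
  assumes L: "L \<ge> 0"
    and T: "\<And>t. t \<in> {0..L} \<Longrightarrow> (T has_real_derivative T' t) (at t within {0..L})" "T 0 = 0" "T L = 0"
    and \<eta>: "\<And>t. t \<in> {0..L} \<Longrightarrow> (\<eta> has_real_derivative \<eta>' t) (at t within {0..L})" "\<eta> 0 = 0" "\<eta> L = 0"
    and H1: "\<And>t. t \<in> {0..L} \<Longrightarrow> (H1 has_real_derivative \<eta> t * T' t) (at t within {0..L})" "H1 0 = 0" "H1 L = 0"
    and H2: "\<And>t. t \<in> {0..L} \<Longrightarrow> (H2 has_real_derivative (\<eta> t)^2 * T' t) (at t within {0..L})" "H2 0 = 0" "H2 L = 0"
    and G: "\<And>t. t \<in> {0..L} \<Longrightarrow> G t = 2/27 * (T' t - \<eta>' t)"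
    and B: "\<And>t. t \<in> {0..L} \<Longrightarrow> B t = T t / 27 + 26/27 * \<eta> t"
    and cont: "continuous_on {0..L} T'" "continuous_on {0..L} \<eta>'"
    and odd: "integral {0..L} (focal G B 3) = 0"
  shows "integral {0..L} (focal G B 0) = 0" "integral {0..L} (focal G B 1) = 0"
    "integral {0..L} (focal G B 2) = 0"
    "1594323 * integral {0..L} (focal G B 4) = integral {0..L} (\<lambda>t. (126034 * \<eta> t ^ 4 - 8524 * T t * \<eta> t ^ 3
       - 174 * T t ^ 2 * \<eta> t ^ 2 + 8 * T t ^ 3 * \<eta> t - 8748 * H1 t * \<eta> t ^ 2) * T' t)"
proof -
  have Lm: "L \<in> {0..L}" using L by simp
  define a where "a t = 2/27 * (T t - \<eta> t)" for t
  define h1 where "h1 t = 2/27 * (H1 t - 1/2 * \<eta> t ^ 2)" for t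
  define h2 where "h2 t = 2/27 * (H2 t - 1/3 * \<eta> t ^ 3)" for t
  \<comment> \<open>This is \<open>T - 13 a\<close> again, rewritten with
    \<open>T = \<eta> + 27/2 a\<close>. The condition \<open>H2 L = 0\<close> will be the vanishing
    of the second focal value.\<close>
  have B': "B t = 1/2 * a t + \<eta> t" if "t \<in> {0..L}" for t using B[OF that] by (simp add: a_def field_simps)
  have da: "(a has_real_derivative G t) (at t within {0..L})" if t: "t \<in> {0..L}" for t
    unfolding a_def G[OF t] by (rule derivative_eq_intros T(1) \<eta>(1) t refl)+ simp
  have dh1: "(h1 has_real_derivative \<eta> t * G t) (at t within {0..L})" if t: "t \<in> {0..L}" for t
    unfolding h1_def G[OF t] by (rule derivative_eq_intros H1(1) \<eta>(1) t refl)+ (simp add: algebra_simps)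
  have dh2: "(h2 has_real_derivative (\<eta> t)^2 * G t) (at t within {0..L})" if t: "t \<in> {0..L}" for t
    unfolding h2_def G[OF t] by (rule derivative_eq_intros H2(1) \<eta>(1) t refl)+ (simp add: algebra_simps power2_eq_square)
  have a0: "a 0 = 0" "a L = 0" and h10: "h1 0 = 0" "h1 L = 0" and h20: "h2 0 = 0" "h2 L = 0"
    using T \<eta> H1 H2 by (auto simp: a_def h1_def h2_def)
  define g2 where "g2 t = - (3/4 * (a t)^2 + h1 t)" for t
  define P1 where "P1 t = - (3/2 * a t + \<eta> t) * G t" for t
  define N where "N t = 3/4 * (a t)^3 + 2 * a t * h1 t + h2 t" for t
  define P2 where "P2 t = (9/4 * (a t)^2 + 2 * a t * \<eta> t + (\<eta> t)^2 + 2 * h1 t) * G t" for t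
  define P3 where "P3 t = - (1/2 * a t + \<eta> t) * P2 t - 3 * G t * N t" for t
  \<comment> \<open>No closed form of this primitive is used: \<open>- 4 * G t * g4 t\<close> is
    integrated by parts into \<open>- 4 * a t * g4 t\<close>, which vanishes at both ends, and a
    multiple of \<open>a t * P3 t\<close>.\<close>
  define g4 where "g4 t = integral {0..t} P3" for t
  define P4 where "P4 t = - (1/2 * a t + \<eta> t) * P3 t - 4 * G t * g4 t" for t
  have dg2: "(g2 has_real_derivative P1 t) (at t within {0..L})" if t: "t \<in> {0..L}" for t
    unfolding g2_def P1_def by (rule derivative_eq_intros da dh1 t refl)+ (simp add: algebra_simps)
  have dN: "(N has_real_derivative P2 t) (at t within {0..L})" if t: "t \<in> {0..L}" for t
    unfolding N_def P2_def by (rule derivative_eq_intros da dh1 dh2 t refl)+ (simp add: algebra_simps power2_eq_square)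
  have z: "g2 0 = 0" "g2 L = 0" "N 0 = 0" "N L = 0" by (auto simp: g2_def N_def a0 h10 h20)
  have cT: "continuous_on {0..L} T" "continuous_on {0..L} \<eta>" "continuous_on {0..L} a" "continuous_on {0..L} h1"
     "continuous_on {0..L} N" "continuous_on {0..L} H1"
    by (rule DERIV_continuous_on, erule T(1) \<eta>(1) da dh1 dN H1(1))+
  have cG: "continuous_on {0..L} G"
    by (subst continuous_on_cong[OF refl G]) (auto intro!: continuous_intros cont)
  have cP: "continuous_on {0..L} P2" "continuous_on {0..L} P3"
    unfolding P3_def[abs_def] P2_def[abs_def] by (intro continuous_intros cT cG)+
  have dg4: "(g4 has_real_derivative P3 t) (at t within {0..L})" if t: "t \<in> {0..L}" for t
    unfolding g4_def by (rule integral_has_real_derivative[OF cP(2) t])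
  have g40: "g4 0 = 0" by (simp add: g4_def)
  have f0: "focal G B 0 t = G t" if "t \<in> {0..L}" for t by simp
  have f1: "focal G B (Suc 0) t = P1 t" if t: "t \<in> {0..L}" for t
  proof -
    have "focal G B (Suc 0) t = - B t * G t - real (Suc 0) * G t * a t"
      by (rule focal_step(1)[where L = L, OF da a0(1) f0 t])
    also have "\<dots> = P1 t" unfolding B'[OF t] by (simp add: P1_def field_simps power2_eq_square)
    finally show ?thesis .
  qed
  have f2: "focal G B (Suc (Suc 0)) t = P2 t" if t: "t \<in> {0..L}" for t
  proof -
    have "focal G B (Suc (Suc 0)) t = - B t * P1 t - real (Suc (Suc 0)) * G t * g2 t"
      by (rule focal_step(1)[where L = L, OF dg2 z(1) f1 t])
    also have "\<dots> = P2 t" unfolding B'[OF t] by (simp add: P1_def P2_def g2_def field_simps power2_eq_square)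
    finally show ?thesis .
  qed
  have f3: "focal G B (Suc (Suc (Suc 0))) t = P3 t" if t: "t \<in> {0..L}" for t
  proof -
    have "focal G B (Suc (Suc (Suc 0))) t = - B t * P2 t - real (Suc (Suc (Suc 0))) * G t * N t"
      by (rule focal_step(1)[where L = L, OF dN z(3) f2 t])
    also have "\<dots> = P3 t" unfolding B'[OF t] by (simp add: P3_def field_simps power2_eq_square)
    finally show ?thesis .
  qed
  have f4: "focal G B (Suc (Suc (Suc (Suc 0)))) t = P4 t" if t: "t \<in> {0..L}" for t
  proof -
    have "focal G B (Suc (Suc (Suc (Suc 0)))) t = - B t * P3 t - real (Suc (Suc (Suc (Suc 0)))) * G t * g4 t"
      by (rule focal_step(1)[where L = L, OF dg4 g40 f3 t])
    also have "\<dots> = P4 t" unfolding B'[OF t] by (simp add: P4_def field_simps power2_eq_square)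
    finally show ?thesis .
  qed
  have "integral {0..L} (focal G B 0) = a L" by (rule focal_step(2)[where L = L, OF da a0(1) f0 Lm])
  then show "integral {0..L} (focal G B 0) = 0" by (simp only: a0)
  have "integral {0..L} (focal G B (Suc 0)) = g2 L" by (rule focal_step(2)[where L = L, OF dg2 z(1) f1 Lm])
  then show "integral {0..L} (focal G B 1) = 0" by (simp only: z One_nat_def)
  have "integral {0..L} (focal G B (Suc (Suc 0))) = N L" by (rule focal_step(2)[where L = L, OF dN z(3) f2 Lm])
  then show "integral {0..L} (focal G B 2) = 0" by (simp only: z numeral_2_eq_2)
  have "integral {0..L} (focal G B (Suc (Suc (Suc 0)))) = g4 L" by (rule focal_step(2)[where L = L, OF dg4 g40 f3 Lm])
  then have g4L: "g4 L = 0" using odd by (simp only: numeral_3_eq_3)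
  define U1 where "U1 t = - 4 * a t * g4 t - 3 * (7/4 * (a t)^2 - h1 t) * N t
     + 63/40 * a t ^ 5 + 1/12 * a t ^ 3 * h1 t - 6 * a t * (h1 t)^2 + 1/24 * a t ^ 4 * \<eta> t
     - 1/12 * a t ^ 3 * \<eta> t ^ 2 - 1/2 * a t ^ 2 * \<eta> t ^ 3" for t
  define \<Psi>1 where "\<Psi>1 t = \<eta> t ^ 4 * G t + (3/2 * a t ^ 2 * \<eta> t ^ 2 + a t ^ 3 * \<eta> t / 6 - a t ^ 4 / 24) * \<eta>' t
     - h1 t * \<eta> t ^ 2 * G t" for t
  have dU1: "(U1 has_real_derivative P4 t - \<Psi>1 t) (at t within {0..L})" if t: "t \<in> {0..L}" for t
    unfolding U1_def P4_def \<Psi>1_def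
    apply (rule derivative_eq_intros da dh1 dN dg4 \<eta>(1) t refl)+
    apply (simp only: P3_def P2_def N_def)
    apply (simp add: field_simps power2_eq_square power3_eq_cube power4_eq_xxxx eval_nat_numeral)
    done
  define U2 where "U2 t =
      2/243 * (1/3 * T t ^ 2 * \<eta> t ^ 3 - 1/2 * T t * \<eta> t ^ 4 + 1/5 * \<eta> t ^ 5)
    + 4/59049 * (1/2 * T t ^ 3 * \<eta> t ^ 2 - T t ^ 2 * \<eta> t ^ 3 + 3/4 * T t * \<eta> t ^ 4 - 1/5 * \<eta> t ^ 5)
    - 2/1594323 * (T t ^ 4 * \<eta> t - 2 * T t ^ 3 * \<eta> t ^ 2 + 2 * T t ^ 2 * \<eta> t ^ 3 - T t * \<eta> t ^ 4 + 1/5 * \<eta> t ^ 5)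
    - 4/729 * (1/10 * \<eta> t ^ 5 - 1/3 * H1 t * \<eta> t ^ 3) - 2/135 * \<eta> t ^ 5" for t
  define \<Psi> where "\<Psi> t = (126034 * \<eta> t ^ 4 - 8524 * T t * \<eta> t ^ 3
       - 174 * T t ^ 2 * \<eta> t ^ 2 + 8 * T t ^ 3 * \<eta> t - 8748 * H1 t * \<eta> t ^ 2) * T' t" for t
  have dU2: "(U2 has_real_derivative \<Psi>1 t - \<Psi> t / 1594323) (at t within {0..L})" if t: "t \<in> {0..L}" for t
    unfolding U2_def \<Psi>_def \<Psi>1_def G[OF t] a_def h1_def
    apply (rule derivative_eq_intros T(1) H1(1) \<eta>(1) t refl)+
    apply (simp add: field_simps power2_eq_square power3_eq_cube power4_eq_xxxx eval_nat_numeral)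
    done
  have "((\<lambda>t. U1 t + U2 t) has_real_derivative P4 t - \<Psi> t / 1594323) (at t within {0..L})" if t: "t \<in> {0..L}" for t
    by (rule DERIV_cong[OF DERIV_add[OF dU1[OF t] dU2[OF t]]]) simp
  from integral_ftc[OF this Lm]
  have "integral {0..L} (\<lambda>t. P4 t - \<Psi> t / 1594323) = 0"
    by (simp add: U1_def U2_def T \<eta> H1 a0 h10 z g4L g40)
  moreover have "\<Psi> integrable_on {0..L}"
    unfolding \<Psi>_def by (intro integrable_continuous_real continuous_intros cT cont)
  moreover have "P4 integrable_on {0..L}"
    unfolding P4_def by (intro integrable_continuous_real continuous_intros cT cG cP DERIV_continuous_on[OF dg4])
  ultimately have "integral {0..L} P4 = integral {0..L} \<Psi> / 1594323"
    by (simp add: integral_diff)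
  moreover have "integral {0..L} (focal G B (Suc (Suc (Suc (Suc 0))))) = integral {0..L} P4"
    by (rule integral_cong[OF f4])
  moreover have "4 = Suc (Suc (Suc (Suc 0)))" by simp
  ultimately show "1594323 * integral {0..L} (focal G B 4) = integral {0..L} (\<lambda>t. (126034 * \<eta> t ^ 4 - 8524 * T t * \<eta> t ^ 3
       - 174 * T t ^ 2 * \<eta> t ^ 2 + 8 * T t ^ 3 * \<eta> t - 8748 * H1 t * \<eta> t ^ 2) * T' t)"
    by (simp only: \<Psi>_def[abs_def])
qed

section \<open>Symmetries and moments\<close>

text \<open>The reflection \<open>x \<mapsto> -x\<close> is \<open>\<theta> \<mapsto> \<pi> - \<theta>\<close> modulo \<open>2\<pi>\<close>, here written piecewise so as to stay in \<open>[0, 2\<pi>]\<close>.\<close>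

definition xsym :: "real \<Rightarrow> (real \<Rightarrow> real) \<Rightarrow> bool" where
  "xsym s f \<longleftrightarrow> (\<forall>t\<in>{0..pi}. f (pi - t) = s * f t) \<and> (\<forall>t\<in>{pi..2*pi}. f (3*pi - t) = s * f t)"

lemma cos_3pi_minus: "cos (3 * pi - t) = - cos t" and sin_3pi_minus: "sin (3 * pi - t) = sin t"
proof -
  have "3 * pi - t = (pi - t) + 2 * pi" by simp
  then show "cos (3 * pi - t) = - cos t" "sin (3 * pi - t) = sin t"
    by (simp_all only: cos_periodic sin_periodic cos_pi_minus sin_pi_minus)
qed

lemma pi_minus_simps:
  "nu (pi - t) = nu t" "cs (pi - t) = - cs t" "sn (pi - t) = sn t" "spd (pi - t) = spd t"
  "nu (3 * pi - t) = nu t" "cs (3 * pi - t) = - cs t" "sn (3 * pi - t) = sn t" "spd (3 * pi - t) = spd t"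
  "nu (2 * pi - t) = nu t" "cs (2 * pi - t) = cs t" "sn (2 * pi - t) = - sn t" "spd (2 * pi - t) = spd t"
  by (simp_all add: nu_def cs_def sn_def spd_def cos_3pi_minus sin_3pi_minus)

lemma basic_values:
  "nu 0 = 1" "cs 0 = 1" "sn 0 = 0" "nu (2 * pi) = 1" "cs (2 * pi) = 1" "sn (2 * pi) = 0"
  by (simp_all add: nu_def cs_def sn_def)

text \<open>The reflection maps \<open>[0, pi]\<close> and \<open>[pi, 2 pi]\<close> to themselves,
  so the integrals over both vanish separately. The primitive is therefore 0 at 0, \<open>pi\<close>
  and \<open>2 pi\<close>, which makes it symmetric on each half.\<close>

lemma xsym_odd_integral:
  fixes f :: "real \<Rightarrow> real"
  assumes f: "continuous_on {0..2*pi} f" and sym: "xsym (-1) f"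
  shows "xsym 1 (\<lambda>t. integral {0..t} f)" "integral {0..2*pi} f = 0"
proof -
  define F where "F t = integral {0..t} f" for t
  have c: "continuous_on {a..b} f" if "0 \<le> a" "b \<le> 2 * pi" for a b
    by (rule continuous_on_subset[OF f]) (use that in auto)
  have split: "integral {a..b} f = F b - F a" if "0 \<le> a" "a \<le> b" "b \<le> 2 * pi" for a b
    using Henstock_Kurzweil_Integration.integral_combine[of 0 a b f] that integrable_continuous_real[OF c[of 0 b]]
    by (auto simp: F_def)
  have A: "F (pi - t) = - (F pi - F t)" if t: "t \<in> {0..pi}" for t
  proof -
    have "F (pi - t) = integral {t..pi} (\<lambda>s. f (pi - s))"
      using integral_reflected[of pi pi t f] c t by (simp add: F_def)
    also have "\<dots> = integral {t..pi} (\<lambda>s. - f s)"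
      using sym t by (intro integral_cong) (auto simp: xsym_def)
    also have "\<dots> = - (F pi - F t)" using split[of t pi] t by simp
    finally show ?thesis .
  qed
  have F0: "F 0 = 0" by (simp add: F_def)
  have Fpi: "F pi = 0" using A[of 0] F0 by simp
  have A': "F (3 * pi - t) = - (F (2 * pi) - F t)" if t: "t \<in> {pi..2 * pi}" for t
  proof -
    have "F (3 * pi - t) - F pi = integral {pi..3 * pi - t} f" using split[of pi "3 * pi - t"] t by simp
    also have "\<dots> = integral {t..2 * pi} (\<lambda>s. f (3 * pi - s))"
      using integral_reflected[of "3 * pi" "2 * pi" t f] c t by simp
    also have "\<dots> = integral {t..2 * pi} (\<lambda>s. - f s)"
      using sym t by (intro integral_cong) (auto simp: xsym_def)
    also have "\<dots> = - (F (2 * pi) - F t)" using split[of t "2 * pi"] t by simp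
    finally show ?thesis using Fpi by simp
  qed
  have F2: "F (2 * pi) = 0" using A'[of pi] Fpi by simp
  then show "integral {0..2*pi} f = 0" by (simp add: F_def)
  show "xsym 1 (\<lambda>t. integral {0..t} f)"
    using A A' Fpi F2 by (auto simp: xsym_def F_def)
qed

text \<open>The counterpart for \<open>y \<mapsto> -y\<close>. With \<open>s = 1\<close> and zero
  total integral it makes the primitive odd; with \<open>s = -1\<close> and
  \<open>t = 2 * pi\<close> it makes the total integral vanish.\<close>

lemma y_even_integral:
  fixes f :: "real \<Rightarrow> real"
  assumes f: "continuous_on {0..2*pi} f" and sym: "\<And>t. t \<in> {0..2*pi} \<Longrightarrow> f (2 * pi - t) = s * f t"
    and t: "t \<in> {0..2*pi}"
  shows "integral {0..2*pi - t} f = integral {0..2*pi} f - s * integral {0..t} f"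
proof -
  have c: "continuous_on {a..b} f" if "0 \<le> a" "b \<le> 2 * pi" for a b
    by (rule continuous_on_subset[OF f]) (use that in auto)
  have "integral {0..2*pi - t} f + integral {2*pi - t..2*pi} f = integral {0..2*pi} f"
    by (rule Henstock_Kurzweil_Integration.integral_combine)
       (use t in \<open>auto intro!: integrable_continuous_real c\<close>)
  moreover have "integral {2*pi - t..2*pi} f = integral {0..t} (\<lambda>s. f (2*pi - s))"
    using integral_reflected[of "2*pi" t 0 f] c t by simp
  moreover have "integral {0..t} (\<lambda>r. f (2*pi - r)) = integral {0..t} (\<lambda>r. s * f r)"
    using t by (intro integral_cong sym) auto
  ultimately show ?thesis by simp
qed

section \<open>Monomials in the generalized trigonometric functions and their moments\<close>

definition dtt :: "real \<Rightarrow> real" where "dtt t = cs t * sn t ^ 2 * spd t"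
definition tt :: "real \<Rightarrow> real" where "tt t = integral {0..t} dtt"
definition kk :: "real \<Rightarrow> real" where "kk t = cs t ^ 5 * sn t"
definition ll :: "real \<Rightarrow> real" where "ll t = cs t ^ 2 * sn t ^ 3"
definition xx :: "real \<Rightarrow> real" where "xx t = cs t ^ 7"
definition mono_integral :: "nat \<Rightarrow> nat \<Rightarrow> real" where
  "mono_integral m n = integral {0..2*pi} (\<lambda>t. cs t ^ m * sn t ^ n * spd t)"

lemma continuous_on_dtt [continuous_intros]: "continuous_on A dtt"
  unfolding dtt_def[abs_def] by (intro continuous_intros)

lemma tt_deriv: "t \<in> {0..2*pi} \<Longrightarrow> (tt has_real_derivative dtt t) (at t within {0..2*pi})"
  unfolding tt_def by (rule integral_has_real_derivative[OF continuous_on_dtt])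

lemma monomial_deriv:
  "((\<lambda>t. cs t ^ m * sn t ^ n) has_real_derivative
     (3 * real n * cs t ^ (m + 5) * sn t ^ (n - 1) - 2 * real m * cs t ^ (m - 1) * sn t ^ (n + 3)) * spd t) (at t within A)"
  by (rule has_field_derivative_at_within,
      rule DERIV_cong[OF DERIV_mult'[OF DERIV_power[OF cs_deriv] DERIV_power[OF sn_deriv]]])
     (simp add: algebra_simps power_add)

lemma kk_deriv: "(kk has_real_derivative (3 * cs t ^ 10 - 10 * cs t ^ 4 * sn t ^ 4) * spd t) (at t within A)"
  using monomial_deriv[of 5 1 t A] by (simp add: kk_def[abs_def])
lemma ll_deriv: "(ll has_real_derivative (9 * cs t ^ 7 * sn t ^ 2 - 4 * cs t * sn t ^ 6) * spd t) (at t within A)"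
  using monomial_deriv[of 2 3 t A] by (simp add: ll_def[abs_def])
lemma xx_deriv: "(xx has_real_derivative - 14 * cs t ^ 6 * sn t ^ 3 * spd t) (at t within A)"
  using monomial_deriv[of 7 0 t A] by (simp add: xx_def[abs_def])

lemma continuous_on_tt: "continuous_on {0..2*pi} tt"
  by (rule DERIV_continuous_on[OF tt_deriv])

lemma continuous_on_monomials [continuous_intros]:
  "continuous_on A kk" "continuous_on A ll" "continuous_on A xx"
  unfolding kk_def[abs_def] ll_def[abs_def] xx_def[abs_def] by (intro continuous_intros)+

lemma tt_symmetry: "xsym 1 tt" "tt (2 * pi) = 0" "tt 0 = 0"
proof -
  have *: "xsym (-1) dtt" by (simp add: xsym_def dtt_def pi_minus_simps)
  then show "xsym 1 tt" "tt (2 * pi) = 0"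
    using xsym_odd_integral[OF continuous_on_dtt *] by (simp_all add: tt_def[abs_def])
  show "tt 0 = 0" by (simp add: tt_def)
qed

lemma tt_y_odd: "t \<in> {0..2*pi} \<Longrightarrow> tt (2 * pi - t) = - tt t"
  using y_even_integral[OF continuous_on_dtt, of 1 t] tt_symmetry
  by (simp add: tt_def[abs_def] dtt_def pi_minus_simps)

text \<open>Multiplying the integrand by \<open>cs^6 + sn^4 = 1\<close> gives one linear relation
  between the moments, and the vanishing integral of the derivative of
  \<open>cs ^ (m + 1) * sn ^ (n + 1)\<close> another. Together they determine both higher
  moments.\<close>

lemma mono_integral_recurrences:
  "mono_integral (m + 6) n = 2 * (real m + 1) / (2 * real m + 3 * real n + 5) * mono_integral m n"
  "mono_integral m (n + 4) = 3 * (real n + 1) / (2 * real m + 3 * real n + 5) * mono_integral m n"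
proof -
  have int: "(\<lambda>t. cs t ^ i * sn t ^ j * spd t) integrable_on {0..2*pi}" for i j
    by (intro integrable_continuous_real continuous_intros)
  have "mono_integral (m + 6) n + mono_integral m (n + 4)
      = integral {0..2*pi} (\<lambda>t. cs t ^ (m + 6) * sn t ^ n * spd t + cs t ^ m * sn t ^ (n + 4) * spd t)"
    unfolding mono_integral_def by (rule integral_add[OF int int, symmetric])
  also have "\<dots> = mono_integral m n"
    unfolding mono_integral_def
  proof (rule integral_cong)
    fix t
    have "cs t ^ (m + 6) * sn t ^ n * spd t + cs t ^ m * sn t ^ (n + 4) * spd t
        = cs t ^ m * sn t ^ n * spd t * (cs t ^ 6 + sn t ^ 4)" by (simp add: power_add algebra_simps)
    then show "cs t ^ (m + 6) * sn t ^ n * spd t + cs t ^ m * sn t ^ (n + 4) * spd t = cs t ^ m * sn t ^ n * spd t"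
      by (simp add: cs_sn)
  qed
  finally have 1: "mono_integral (m + 6) n + mono_integral m (n + 4) = mono_integral m n" .
  have "integral {0..2*pi} (\<lambda>t. (3 * real (n + 1) * cs t ^ (m + 1 + 5) * sn t ^ (n + 1 - 1)
       - 2 * real (m + 1) * cs t ^ (m + 1 - 1) * sn t ^ (n + 1 + 3)) * spd t)
      = cs (2*pi) ^ (m + 1) * sn (2*pi) ^ (n + 1) - cs 0 ^ (m + 1) * sn 0 ^ (n + 1)"
    by (rule integral_ftc[where L = "2*pi", OF monomial_deriv]) simp
  also have "\<dots> = 0" by (simp add: basic_values)
  also have "(\<lambda>t. (3 * real (n + 1) * cs t ^ (m + 1 + 5) * sn t ^ (n + 1 - 1)
       - 2 * real (m + 1) * cs t ^ (m + 1 - 1) * sn t ^ (n + 1 + 3)) * spd t)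
     = (\<lambda>t. 3 * (real n + 1) * (cs t ^ (m + 6) * sn t ^ n * spd t) - 2 * (real m + 1) * (cs t ^ m * sn t ^ (n + 4) * spd t))"
    by (auto simp: algebra_simps)
  also have "integral {0..2*pi} \<dots> = 3 * (real n + 1) * mono_integral (m + 6) n - 2 * (real m + 1) * mono_integral m (n + 4)"
    unfolding mono_integral_def by (subst integral_diff) (auto intro!: integrable_on_mult_right int)
  finally have 2: "3 * (real n + 1) * mono_integral (m + 6) n = 2 * (real m + 1) * mono_integral m (n + 4)" by simp
  have d: "2 * real m + 3 * real n + 5 > 0" by linarith
  have "(2 * real m + 3 * real n + 5) * mono_integral (m + 6) n = 2 * (real m + 1) * mono_integral m n"
    using 2 unfolding 1[symmetric] by (simp add: algebra_simps)
  then show "mono_integral (m + 6) n = 2 * (real m + 1) / (2 * real m + 3 * real n + 5) * mono_integral m n"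
    using d by (simp add: field_simps)
  have "(2 * real m + 3 * real n + 5) * mono_integral m (n + 4) = 3 * (real n + 1) * mono_integral m n"
    using 2 unfolding 1[symmetric] by (simp add: algebra_simps)
  then show "mono_integral m (n + 4) = 3 * (real n + 1) / (2 * real m + 3 * real n + 5) * mono_integral m n"
    using d by (simp add: field_simps)
qed

lemma mono_integral_pos:
  assumes "even m" "even n"
  shows "mono_integral m n > 0"
proof -
  let ?f = "\<lambda>t. cs t ^ m * sn t ^ n * spd t"
  have c: "continuous_on (cbox 0 (2*pi)) ?f" by (intro continuous_intros)
  have nn: "?f t \<ge> 0" for t using assms spd_pos[of t] by (simp add: zero_le_even_power)
  have "mono_integral m n \<ge> 0" unfolding mono_integral_def
    by (intro Henstock_Kurzweil_Integration.integral_nonneg integrable_continuous_real continuous_intros nn)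
  moreover have "mono_integral m n \<noteq> 0"
  proof
    assume "mono_integral m n = 0"
    then have "(?f has_integral 0) (cbox 0 (2*pi))"
      using integrable_integral[OF integrable_continuous[OF c]] by (simp add: mono_integral_def)
    then have "?f (pi/4) = 0"
      by (intro has_integral_0_cbox_imp_0[OF c]) (use nn pi_gt_zero in \<open>auto simp: not_le\<close>)
    moreover have "cs (pi/4) > 0" "sn (pi/4) > 0"
      using nu_pos[of "pi/4"] by (simp_all add: cs_def sn_def cos_45 sin_45)
    ultimately show False using spd_pos[of "pi/4"] by simp
  qed
  ultimately show ?thesis by simp
qed

text \<open>1/9 is the constant for which the terms \<open>cs^5 sn^2\<close> cancel in the
  derivative of \<open>sn^3 / 9 - T cs^4\<close>. What remains, \<open>8 T cs^3 sn^3\<close> times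
  \<open>spd\<close>, is nonnegative on the first quadrant, and both reflections carry the bound to
  the other quadrants.\<close>

lemma tt_bound:
  assumes t: "t \<in> {0..2*pi}"
  shows "cs t ^ 4 * sn t * tt t \<le> sn t ^ 4 / 9"
proof -
  have quarter: "cs t ^ 4 * sn t * tt t \<le> sn t ^ 4 / 9" if t: "0 \<le> t" "t \<le> pi / 2" for t
  proof -
    have nn: "cs s \<ge> 0" "sn s \<ge> 0" if "s \<in> {0..t}" for s
      using nu_pos[of s] that t cos_ge_zero[of s] sin_ge_zero[of s] by (auto simp: cs_def sn_def)
    have tt0: "tt s \<ge> 0" if "s \<in> {0..t}" for s
      unfolding tt_def
    proof (rule Henstock_Kurzweil_Integration.integral_nonneg)
      show "dtt integrable_on {0..s}" by (intro integrable_continuous_real continuous_intros)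
      show "dtt x \<ge> 0" if "x \<in> {0..s}" for x
        using nn[of x] spd_pos[of x] that \<open>s \<in> {0..t}\<close> by (simp add: dtt_def)
    qed
    define D where "D s = 1/9 * sn s ^ 3 - tt s * cs s ^ 4" for s
    have sub: "{0..t} \<subseteq> {0..2*pi}" using t by auto
    have dD: "(D has_real_derivative 8 * tt s * cs s ^ 3 * sn s ^ 3 * spd s) (at s within {0..t})"
      if s: "s \<in> {0..t}" for s
    proof -
      have T: "(tt has_real_derivative dtt s) (at s within {0..t})"
        by (rule DERIV_subset[OF tt_deriv sub]) (use s sub in auto)
      show ?thesis unfolding D_def
        by (rule derivative_eq_intros T has_field_derivative_at_within[OF cs_deriv] has_field_derivative_at_within[OF sn_deriv] refl)+
           (simp add: dtt_def algebra_simps power2_eq_square eval_nat_numeral)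
    qed
    have "integral {0..t} (\<lambda>s. 8 * tt s * cs s ^ 3 * sn s ^ 3 * spd s) = D t - D 0"
      by (rule integral_ftc[OF dD]) (use t in auto)
    moreover have "integral {0..t} (\<lambda>s. 8 * tt s * cs s ^ 3 * sn s ^ 3 * spd s) \<ge> 0"
    proof (rule Henstock_Kurzweil_Integration.integral_nonneg)
      show "(\<lambda>s. 8 * tt s * cs s ^ 3 * sn s ^ 3 * spd s) integrable_on {0..t}"
        by (intro integrable_continuous_real continuous_intros continuous_on_subset[OF continuous_on_tt sub])
      show "8 * tt s * cs s ^ 3 * sn s ^ 3 * spd s \<ge> 0" if "s \<in> {0..t}" for s
        using nn[OF that] tt0[OF that] spd_pos[of s] by simp
    qed
    moreover have "D 0 = 0" by (simp add: D_def tt_symmetry basic_values)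
    ultimately have "tt t * cs t ^ 4 \<le> 1/9 * sn t ^ 3" by (simp add: D_def)
    then have "(tt t * cs t ^ 4) * sn t \<le> (1/9 * sn t ^ 3) * sn t"
      using nn(2)[of t] t by (intro mult_right_mono) auto
    then show ?thesis by (simp add: mult_ac eval_nat_numeral)
  qed
  have half: "cs t ^ 4 * sn t * tt t \<le> sn t ^ 4 / 9" if t: "0 \<le> t" "t \<le> pi" for t
  proof (cases "t \<le> pi / 2")
    case False
    have "tt (pi - t) = tt t" using tt_symmetry(1) t by (simp add: xsym_def)
    then show ?thesis using quarter[of "pi - t"] False t by (simp add: pi_minus_simps)
  qed (use quarter t in auto)
  show ?thesis
  proof (cases "t \<le> pi")
    case False
    then show ?thesis using half[of "2 * pi - t"] t by (simp add: pi_minus_simps tt_y_odd)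
  qed (use half t in auto)
qed

section \<open>Focal values of the system\<close>

lemma cs_sn_bound: "\<bar>cs t\<bar> \<le> 1" "\<bar>sn t\<bar> \<le> 1"
proof -
  have "cs t ^ 6 \<ge> 0" "sn t ^ 4 \<ge> 0" by auto
  then have "cs t ^ 6 \<le> 1" "sn t ^ 4 \<le> 1" using cs_sn[of t] by linarith+
  then have "\<bar>cs t\<bar> ^ 6 \<le> 1" "\<bar>sn t\<bar> ^ 4 \<le> 1" by (simp_all add: power_even_abs)
  then show "\<bar>cs t\<bar> \<le> 1" "\<bar>sn t\<bar> \<le> 1" using power_le_one_iff[of "\<bar>cs t\<bar>" 6] power_le_one_iff[of "\<bar>sn t\<bar>" 4] by auto
qed

lemma monomial_bound: "\<bar>cs t ^ m * sn t ^ n\<bar> \<le> 1"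
  unfolding abs_mult power_abs using cs_sn_bound by (intro mult_le_one power_le_one) auto

lemma spd_bound: "\<exists>S\<ge>0. \<forall>t\<in>{0..2*pi}. spd t \<le> S"
proof -
  have "bounded (spd ` {0..2*pi})"
    by (intro compact_imp_bounded compact_continuous_image continuous_intros compact_Icc)
  then obtain S where "\<forall>t\<in>{0..2*pi}. \<bar>spd t\<bar> \<le> S" by (auto simp: bounded_iff)
  then show ?thesis by (intro exI[of _ "max S 0"]) (auto simp: abs_le_iff le_max_iff_disj)
qed

lemma continuous_on_drift [continuous_intros]: "continuous_on A (drift a22 a50 b13 b41)"
  and continuous_on_twist [continuous_intros]: "continuous_on A (twist a22 a50 b13 b41)"
  unfolding drift_def[abs_def] twist_def[abs_def] by (intro continuous_intros; simp)+

lemma abs_mult_le: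
  fixes x y :: real
  assumes "\<bar>x\<bar> \<le> e" "\<bar>y\<bar> \<le> 1"
  shows "\<bar>x * y\<bar> \<le> e"
proof -
  have "\<bar>x * y\<bar> \<le> e * 1" unfolding abs_mult using assms by (intro mult_mono) auto
  then show ?thesis by simp
qed

lemma four_term_bound:
  fixes a b c d :: real
  assumes "\<bar>m1\<bar> \<le> 1" "\<bar>m2\<bar> \<le> 1" "\<bar>m3\<bar> \<le> 1" "\<bar>m4\<bar> \<le> 1"
    and "\<bar>a\<bar> \<le> e" "\<bar>b\<bar> \<le> e" "\<bar>c\<bar> \<le> e" "\<bar>d\<bar> \<le> e"
  shows "\<bar>6 * a * m1 + 4 * b * m2 + 6 * c * m3 + 4 * d * m4\<bar> \<le> 20 * e"
proof -
  define p q r s where "p = a * m1" and "q = b * m2" and "r = c * m3" and "s = d * m4"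
  have "\<bar>p\<bar> \<le> e" "\<bar>q\<bar> \<le> e" "\<bar>r\<bar> \<le> e" "\<bar>s\<bar> \<le> e"
    unfolding p_def q_def r_def s_def by (intro abs_mult_le assms)+
  then have "\<bar>6 * p + 4 * q + 6 * r + 4 * s\<bar> \<le> 20 * e" by (simp add: abs_le_iff)
  then show ?thesis by (simp add: p_def q_def r_def s_def mult.assoc)
qed

lemma drift_bound:
  assumes "\<bar>a22\<bar> \<le> e" "\<bar>a50\<bar> \<le> e" "\<bar>b13\<bar> \<le> e" "\<bar>b41\<bar> \<le> e" and S: "spd t \<le> S"
  shows "\<bar>drift a22 a50 b13 b41 t\<bar> \<le> 2 * S * e"
proof -
  have "\<bar>6 * a22 * (cs t ^ 7 * sn t ^ 2) + 4 * b13 * (cs t ^ 1 * sn t ^ 6) + 6 * a50 * (cs t ^ 10 * sn t ^ 0) + 4 * b41 * (cs t ^ 4 * sn t ^ 4)\<bar> \<le> 20 * e"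
    by (intro four_term_bound monomial_bound assms)
  then have "\<bar>6 * a22 * cs t ^ 7 * sn t ^ 2 + 4 * b13 * cs t * sn t ^ 6 + 6 * a50 * cs t ^ 10 + 4 * b41 * cs t ^ 4 * sn t ^ 4\<bar> / 12 \<le> 2 * e"
    using abs_ge_zero[of a22] assms(1) by (simp add: mult.assoc)
  then have "\<bar>6 * a22 * cs t ^ 7 * sn t ^ 2 + 4 * b13 * cs t * sn t ^ 6 + 6 * a50 * cs t ^ 10 + 4 * b41 * cs t ^ 4 * sn t ^ 4\<bar> / 12 * spd t \<le> 2 * e * S"
    using S spd_pos[of t] abs_ge_zero[of a22] assms(1) by (intro mult_mono) auto
  then show ?thesis using spd_pos[of t] by (simp add: drift_def abs_mult mult_ac)
qed

lemma twist_bound: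
  assumes "\<bar>a22\<bar> \<le> e" "\<bar>a50\<bar> \<le> e" "\<bar>b13\<bar> \<le> e" "\<bar>b41\<bar> \<le> e"
  shows "\<bar>twist a22 a50 b13 b41 t\<bar> \<le> 2 * e"
proof -
  have "\<bar>2 * b13 - 3 * a22\<bar> \<le> 5 * e" "\<bar>2 * b41 - 3 * a50\<bar> \<le> 5 * e" using assms by linarith+
  then have "\<bar>(2 * b13 - 3 * a22) * (cs t ^ 2 * sn t ^ 3)\<bar> \<le> 5 * e"
    "\<bar>(2 * b41 - 3 * a50) * (cs t ^ 5 * sn t ^ 1)\<bar> \<le> 5 * e"
    by (intro abs_mult_le monomial_bound; simp)+
  then have "\<bar>(2 * b13 - 3 * a22) * (cs t ^ 2 * sn t ^ 3) + (2 * b41 - 3 * a50) * (cs t ^ 5 * sn t ^ 1)\<bar> \<le> 10 * e"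
    by linarith
  then show ?thesis by (simp add: twist_def mult.assoc)
qed

lemma drift_diff: "drift a22 a50 b13 b41 t - drift a22' a50' b13 b41 t = drift (a22 - a22') (a50 - a50') 0 0 t"
  and twist_diff: "twist a22 a50 b13 b41 t - twist a22' a50' b13 b41 t = twist (a22 - a22') (a50 - a50') 0 0 t"
  by (simp_all add: drift_def twist_def algebra_simps diff_divide_distrib add_divide_distrib)

text \<open>A single \<open>M\<close> for a whole box of coefficients provides a single disc of
  initial values, on which return maps for different parameters can be compared. The dependence on
  \<open>e\<close> is linear because \<open>drift\<close> and \<open>twist\<close> are linear in the
  coefficients.\<close>

lemma system_flow_data:
  "\<exists>M\<ge>2. (\<forall>a22 a50 b13 b41. \<bar>a22\<bar> \<le> 1 \<and> \<bar>a50\<bar> \<le> 1 \<and> \<bar>b13\<bar> \<le> 1 \<and> \<bar>b41\<bar> \<le> 1 \<longrightarrow>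
      flow_data (drift a22 a50 b13 b41) (twist a22 a50 b13 b41) M (2*pi)) \<and>
    (\<forall>a22 a50 a22' a50' b13 b41 e t. \<bar>a22 - a22'\<bar> \<le> e \<and> \<bar>a50 - a50'\<bar> \<le> e \<and> t \<in> {0..2*pi} \<longrightarrow>
      \<bar>drift a22 a50 b13 b41 t - drift a22' a50' b13 b41 t\<bar> \<le> M * e \<and>
      \<bar>twist a22 a50 b13 b41 t - twist a22' a50' b13 b41 t\<bar> \<le> M * e)"
proof -
  obtain S where S: "S \<ge> 0" "\<And>t. t \<in> {0..2*pi} \<Longrightarrow> spd t \<le> S" using spd_bound by auto
  define M where "M = 2 * S + 2"
  show ?thesis
  proof (intro exI[of _ M] conjI allI impI)
    show "M \<ge> 2" using S by (simp add: M_def)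
    fix a22 a50 b13 b41 :: real
    assume p: "\<bar>a22\<bar> \<le> 1 \<and> \<bar>a50\<bar> \<le> 1 \<and> \<bar>b13\<bar> \<le> 1 \<and> \<bar>b41\<bar> \<le> 1"
    show "flow_data (drift a22 a50 b13 b41) (twist a22 a50 b13 b41) M (2*pi)"
    proof
      fix t :: real assume t: "t \<in> {0..2*pi}"
      show "\<bar>drift a22 a50 b13 b41 t\<bar> \<le> M" using drift_bound[of a22 1 a50 b13 b41 t S] p S t by (simp add: M_def)
      show "\<bar>twist a22 a50 b13 b41 t\<bar> \<le> M" using twist_bound[of a22 1 a50 b13 b41 t] p S by (simp add: M_def)
    qed (use S in \<open>auto simp: M_def intro!: continuous_intros\<close>)
  next
    fix a22 a50 a22' a50' b13 b41 e t :: real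
    assume p: "\<bar>a22 - a22'\<bar> \<le> e \<and> \<bar>a50 - a50'\<bar> \<le> e \<and> t \<in> {0..2*pi}"
    then have e: "e \<ge> 0" by linarith
    have "\<bar>drift a22 a50 b13 b41 t - drift a22' a50' b13 b41 t\<bar> \<le> 2 * S * e"
      unfolding drift_diff using p e S by (intro drift_bound) auto
    also have "\<dots> \<le> M * e" using e by (intro mult_right_mono) (auto simp: M_def)
    finally show "\<bar>drift a22 a50 b13 b41 t - drift a22' a50' b13 b41 t\<bar> \<le> M * e" .
    have "\<bar>twist a22 a50 b13 b41 t - twist a22' a50' b13 b41 t\<bar> \<le> 2 * e"
      unfolding twist_diff using p e by (intro twist_bound) auto
    also have "\<dots> \<le> M * e" using e S by (intro mult_right_mono) (auto simp: M_def)
    finally show "\<bar>twist a22 a50 b13 b41 t - twist a22' a50' b13 b41 t\<bar> \<le> M * e" .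
  qed
qed

lemma drift_twist_parity:
  "drift a22 a50 b13 b41 (2*pi - t) = drift a22 a50 b13 b41 t"
  "twist a22 a50 b13 b41 (2*pi - t) = - twist a22 a50 b13 b41 t"
  unfolding drift_def twist_def pi_minus_simps by (simp_all add: field_simps)

text \<open>Terms odd under \<open>x \<mapsto> -x\<close> integrate to zero, and -1/30 times the
  derivative of \<open>kk\<close> takes up the \<open>cs^4 sn^4\<close> term. The remaining multiple
  of \<open>cs^10\<close> carries the factor \<open>5 * a50 + 1\<close>, which is
  \<open>\<epsilon>\<^sub>1\<close> in the theorem.\<close>

lemma focal_zero_value:
  "integral {0..2*pi} (focal (drift a22 a50 b13 1) B 0) = (5 * a50 + 1) / 10 * mono_integral 10 0"
proof -
  have t: "2*pi \<in> {0..2*pi}" by simp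
  define f where "f t = (6 * a22 * cs t ^ 7 * sn t ^ 2 + 4 * b13 * cs t * sn t ^ 6) / 12 * spd t" for t
  have cf: "continuous_on {0..2*pi} f" unfolding f_def by (intro continuous_intros; simp)
  have "xsym (-1) f" unfolding xsym_def f_def pi_minus_simps by (simp add: field_simps)
  then have f0: "integral {0..2*pi} f = 0" by (rule xsym_odd_integral(2)[OF cf])
  define k where "k t = (3 * cs t ^ 10 - 10 * cs t ^ 4 * sn t ^ 4) * spd t" for t
  have "integral {0..2*pi} k = kk (2*pi) - kk 0" unfolding k_def by (rule integral_ftc[OF kk_deriv t])
  then have k0: "integral {0..2*pi} k = 0" by (simp add: kk_def basic_values)
  have int: "f integrable_on {0..2*pi}" "k integrable_on {0..2*pi}" "(\<lambda>t. cs t ^ 10 * spd t) integrable_on {0..2*pi}"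
    using cf unfolding k_def by (auto intro!: integrable_continuous_real continuous_intros)
  have "integral {0..2*pi} (focal (drift a22 a50 b13 1) B 0)
      = integral {0..2*pi} (\<lambda>t. (f t + (-1/30) * k t) + (5 * a50 + 1) / 10 * (cs t ^ 10 * spd t))"
    by (intro integral_cong) (simp add: drift_def f_def k_def field_simps)
  also have "\<dots> = (integral {0..2*pi} f + (-1/30) * integral {0..2*pi} k) + (5 * a50 + 1) / 10 * mono_integral 10 0"
    unfolding mono_integral_def using int
    by (intro integral_unique has_integral_add has_integral_mult_right) (simp_all add: has_integral_integral[symmetric])
  finally show ?thesis by (simp add: f0 k0)
qed

lemma xsym_tt: "t \<in> {0..pi} \<Longrightarrow> tt (pi - t) = tt t" "t \<in> {pi..2*pi} \<Longrightarrow> tt (3 * pi - t) = tt t"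
  using tt_symmetry(1) by (auto simp: xsym_def)

lemmas symmetry_simps = xsym_def dtt_def kk_def ll_def xx_def pi_minus_simps xsym_tt

text \<open>Here \<open>d\<close> is \<open>\<epsilon>\<^sub>2 / 5\<close>, as
  \<open>a22 = 1/7 + \<epsilon>\<^sub>2 / 5\<close>. Under \<open>x \<mapsto> -x\<close> only the
  terms of odd degree in \<open>K\<close> survive integration against \<open>dT\<close>; in the
  quadratic integrand of \<open>focal_two\<close> this is the cross term \<open>Q\<close>.\<close>

lemma focal_two_value:
  fixes d :: real
  defines "G \<equiv> drift (1/7 + d) (-1/5) (5/21) 1" and "B \<equiv> twist (1/7 + d) (-1/5) (5/21) 1"
  shows "integral {0..2*pi} (focal G B 0) = 0" "integral {0..2*pi} (focal G B 1) = 0"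
    "integral {0..2*pi} (focal G B 2) = - (1 + 2 * d) * d / 84 * mono_integral 8 2"
proof -
  let ?L = "2 * pi :: real"
  have Lm: "?L \<in> {0..?L}" by simp
  \<comment> \<open>The part of \<open>a\<close> invariant under \<open>x \<mapsto> -x\<close>. Its
    two coefficients solve the linear system that writes the corresponding terms of \<open>G\<close>
    as a combination of the derivatives of \<open>tt\<close> and \<open>ll\<close>.\<close>
  define ae where "ae t = (1/13 + 2/13 * d) * tt t + (1/26 * d - 1/1638) * ll t" for t
  define a where "a t = ae t - 1/30 * kk t" for t
  define Th where "Th t = (1 + 2 * d) * tt t" for t
  define Th' where "Th' t = (1 + 2 * d) * dtt t" for t
  define H where "H t = integral {0..t} (\<lambda>t. Th t * G t)" for t
  define dae where "dae t = (1/13 + 2/13 * d) * dtt t + (1/26 * d - 1/1638) * ((9 * cs t ^ 7 * sn t ^ 2 - 4 * cs t * sn t ^ 6) * spd t)" for t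
  have dae: "(ae has_real_derivative dae t) (at t within {0..?L})" if "t \<in> {0..?L}" for t
    unfolding ae_def dae_def by (rule derivative_eq_intros tt_deriv ll_deriv that refl)+ simp
  have da: "(a has_real_derivative G t) (at t within {0..?L})" if t: "t \<in> {0..?L}" for t
  proof -
    have "(a has_real_derivative dae t - 1/30 * ((3 * cs t ^ 10 - 10 * cs t ^ 4 * sn t ^ 4) * spd t)) (at t within {0..?L})"
      unfolding a_def by (rule derivative_eq_intros dae kk_deriv t refl)+ simp
    moreover have "dtt t = (cs t ^ 6 + sn t ^ 4) * dtt t" by (simp add: cs_sn)
    then have "dtt t = (cs t ^ 7 * sn t ^ 2 + cs t * sn t ^ 6) * spd t"
      by (simp add: dtt_def algebra_simps eval_nat_numeral)
    then have "dae t - 1/30 * ((3 * cs t ^ 10 - 10 * cs t ^ 4 * sn t ^ 4) * spd t) = G t"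
      by (simp add: dae_def G_def drift_def field_simps)
    ultimately show ?thesis by simp
  qed
  have dT: "(Th has_real_derivative Th' t) (at t within {0..?L})" if "t \<in> {0..?L}" for t
    unfolding Th_def Th'_def by (rule derivative_eq_intros tt_deriv that refl)+ simp
  have cT: "continuous_on {0..?L} Th" "continuous_on {0..?L} ae" "continuous_on {0..?L} a"
    by (rule DERIV_continuous_on, erule dT dae da)+
  have cG: "continuous_on {0..?L} G" unfolding G_def by (intro continuous_intros)
  have cTG: "continuous_on {0..?L} (\<lambda>t. Th t * G t)" by (intro continuous_intros cT cG)
  have dH: "(H has_real_derivative Th t * G t) (at t within {0..?L})" if "t \<in> {0..?L}" for t
    unfolding H_def by (rule integral_has_real_derivative[OF cTG that])
  have "integral {0..?L - ?L} (\<lambda>t. Th t * G t) = integral {0..?L} (\<lambda>t. Th t * G t) - (-1) * integral {0..?L} (\<lambda>t. Th t * G t)"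
    by (rule y_even_integral[OF cTG _ Lm]) (simp add: Th_def tt_y_odd G_def drift_twist_parity)
  then have H0: "H 0 = 0" "H ?L = 0" by (simp_all add: H_def)
  have v: "a 0 = 0" "a ?L = 0" "Th 0 = 0" "Th ?L = 0" "ae 0 = 0" "ae ?L = 0"
    by (simp_all add: a_def ae_def Th_def tt_symmetry kk_def ll_def basic_values)
  have B: "B t = Th t - 13 * a t" for t
    by (simp add: B_def twist_def Th_def a_def ae_def kk_def ll_def field_simps)
  have cT': "continuous_on {0..?L} Th'" unfolding Th'_def by (intro continuous_intros)
  note f = focal_two[where L = "2*pi", OF _ da v(1,2) dT v(3,4) dH H0 B cT']
  show "integral {0..2*pi} (focal G B 0) = 0" "integral {0..2*pi} (focal G B 1) = 0"
    by (rule f; simp)+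
  have "integral {0..2*pi} (focal G B 2) = integral {0..?L} (\<lambda>t. (27/2 * (a t)^2 - 2 * a t * Th t) * Th' t)"
    by (rule f) simp_all
  also have "\<dots> = - (1 + 2 * d) * d / 84 * mono_integral 8 2"
  proof -
    define E where "E t = (27/2 * ((ae t)^2 + 1/900 * (kk t)^2) - 2 * ae t * Th t) * Th' t" for t
    have cE: "continuous_on {0..?L} E" unfolding E_def by (intro continuous_intros cT cT')
    have "xsym (-1) E" unfolding E_def ae_def Th_def Th'_def
      by (simp add: symmetry_simps)
    then have E0: "integral {0..?L} E = 0" by (rule xsym_odd_integral(2)[OF cE])
    \<comment> \<open>This is the product of \<open>xx\<close> and \<open>ll\<close>. A multiple of
      its derivative turns the mixture of \<open>cs^14 sn^2\<close> and \<open>cs^8 sn^6\<close>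
      left by integration by parts into a multiple of \<open>cs^8 sn^2\<close>; see
      \<open>e2\<close>.\<close>
    define mm where "mm t = cs t ^ 9 * sn t ^ 3" for t
    define dmm where "dmm t = (9 * cs t ^ 14 * sn t ^ 2 - 18 * cs t ^ 8 * sn t ^ 6) * spd t" for t
    have dm: "(mm has_real_derivative dmm t) (at t within {0..?L})" for t
      using monomial_deriv[of 9 3 t "{0..?L}"] by (simp add: mm_def[abs_def] dmm_def)
    \<comment> \<open>420 = 30 * 14: the factor 1/30 belongs to \<open>K\<close> in
      \<open>a\<close>, and 1/14 comes from \<open>K dT = - dX / 14\<close>.\<close>
    define U where "U t = 1/420 * (1 + 2 * d) * (xx t * (27 * ae t - 2 * Th t) + (1/126 - 1/2 * d) * mm t)" for t
    define Q where "Q t = -1/30 * kk t * (27 * ae t - 2 * Th t) * Th' t" for t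
    have dU: "(U has_real_derivative Q t + (1 + 2 * d) * d / 84 * (cs t ^ 8 * sn t ^ 2 * spd t)) (at t within {0..?L})"
      if t: "t \<in> {0..?L}" for t
    proof -
      have *: "(U has_real_derivative 1/420 * (1 + 2 * d) * (- 14 * cs t ^ 6 * sn t ^ 3 * spd t * (27 * ae t - 2 * Th t)
         + xx t * (27 * dae t - 2 * Th' t) + (1/126 - 1/2 * d) * dmm t)) (at t within {0..?L})"
        unfolding U_def by (rule derivative_eq_intros xx_deriv dae dT dm t refl)+ (simp add: algebra_simps)
      have e1: "- 14 * cs t ^ 6 * sn t ^ 3 * spd t = - 14 * (kk t * dtt t)"
        by (simp add: kk_def dtt_def eval_nat_numeral)
      have e2: "xx t * (27 * dae t - 2 * Th' t) + (1/126 - 1/2 * d) * dmm t = 5 * d * (cs t ^ 8 * sn t ^ 2 * spd t)"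
        using cs_sn[of t] unfolding xx_def dae_def Th'_def dmm_def dtt_def by algebra
      show ?thesis
        by (rule DERIV_cong[OF *], unfold e1 add.assoc e2) (simp add: Q_def Th'_def field_simps)
    qed
    have int: "Q integrable_on {0..?L}" "E integrable_on {0..?L}" "(\<lambda>t. cs t ^ 8 * sn t ^ 2 * spd t) integrable_on {0..?L}"
      using cE unfolding Q_def by (auto intro!: integrable_continuous_real continuous_intros cT cT')
    have "integral {0..?L} (\<lambda>t. Q t + (1 + 2 * d) * d / 84 * (cs t ^ 8 * sn t ^ 2 * spd t)) = U ?L - U 0"
      by (rule integral_ftc[OF dU Lm])
    also have "\<dots> = 0" by (simp add: U_def v mm_def basic_values)
    finally have "integral {0..?L} Q + (1 + 2 * d) * d / 84 * mono_integral 8 2 = 0"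
      using int by (simp add: integral_add integrable_on_mult_right mono_integral_def)
    moreover have "(\<lambda>t. (27/2 * (a t)^2 - 2 * a t * Th t) * Th' t) = (\<lambda>t. E t + Q t)"
      by (auto simp: E_def Q_def a_def power2_eq_square algebra_simps)
    ultimately show ?thesis using int E0 by (simp add: integral_add field_simps)
  qed
  finally show "integral {0..2*pi} (focal G B 2) = - (1 + 2 * d) * d / 84 * mono_integral 8 2" .
qed

text \<open>For \<open>\<epsilon>\<^sub>1 = \<epsilon>\<^sub>2 = 0\<close> the function
  \<open>\<eta> = T - 27/2 a\<close> equals \<open>9/20 K + N\<close>; this is \<open>N\<close>, its
  part invariant under \<open>x \<mapsto> -x\<close>.\<close>

definition nn :: "real \<Rightarrow> real" where "nn t = 3/364 * ll t - 1/26 * tt t"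
definition dnn :: "real \<Rightarrow> real" where
  "dnn t = 3/364 * ((9 * cs t ^ 7 * sn t ^ 2 - 4 * cs t * sn t ^ 6) * spd t) - 1/26 * dtt t"
definition m1 :: "real \<Rightarrow> real" where "m1 t = integral {0..t} (\<lambda>t. nn t * dtt t)"

lemma nn_deriv: "t \<in> {0..2*pi} \<Longrightarrow> (nn has_real_derivative dnn t) (at t within {0..2*pi})"
  unfolding nn_def dnn_def by (rule derivative_eq_intros tt_deriv ll_deriv refl | assumption)+ simp

lemma continuous_on_nn: "continuous_on {0..2*pi} nn"
  by (rule DERIV_continuous_on[OF nn_deriv])

lemma m1_deriv: "t \<in> {0..2*pi} \<Longrightarrow> (m1 has_real_derivative nn t * dtt t) (at t within {0..2*pi})"
  unfolding m1_def by (rule integral_has_real_derivative) (intro continuous_intros continuous_on_nn)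

lemma m1_symmetry: "xsym 1 m1" "m1 (2*pi) = 0" "m1 0 = 0"
proof -
  have c: "continuous_on {0..2*pi} (\<lambda>t. nn t * dtt t)" by (intro continuous_intros continuous_on_nn)
  have *: "xsym (-1) (\<lambda>t. nn t * dtt t)" by (simp add: symmetry_simps nn_def)
  show "xsym 1 m1" "m1 (2 * pi) = 0"
    using xsym_odd_integral[OF c *] by (simp_all add: m1_def[abs_def])
  show "m1 0 = 0" by (simp add: m1_def)
qed

lemma xsym_m1: "t \<in> {0..pi} \<Longrightarrow> m1 (pi - t) = m1 t" "t \<in> {pi..2*pi} \<Longrightarrow> m1 (3 * pi - t) = m1 t"
  using m1_symmetry(1) by (auto simp: xsym_def)

lemma kk_dtt: "- 14 * cs t ^ 6 * sn t ^ 3 * spd t = - 14 * (kk t * dtt t)"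
  by (simp add: kk_def dtt_def eval_nat_numeral)

text \<open>Since \<open>26 N + T = 3/14 L\<close>, the product \<open>X (26 N + T)\<close> is a
  multiple of \<open>cs^9 sn^3\<close>, whose derivative is proportional to \<open>X N'\<close>. It
  is the case \<open>d = 0\<close> of the identity \<open>e2\<close> in
  \<open>focal_two_value\<close>.\<close>

lemma xx_dnn: "54 * (xx t * dnn t) = - 14 * (kk t * dtt t) * (26 * nn t + tt t) + xx t * (26 * dnn t + dtt t)"
  using cs_sn[of t] unfolding xx_def dnn_def dtt_def kk_def nn_def ll_def by algebra

definition \<Psi> :: "real \<Rightarrow> real \<Rightarrow> real \<Rightarrow> real" where
  "\<Psi> T \<eta> H = 126034 * \<eta> ^ 4 - 8524 * T * \<eta> ^ 3 - 174 * T ^ 2 * \<eta> ^ 2 + 8 * T ^ 3 * \<eta> - 8748 * H * \<eta> ^ 2"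

text \<open>\<open>Psi_even\<close> and \<open>Psi_odd\<close> are the parts of \<open>\<Psi>\<close> even and odd under \<open>(K, X) \<mapsto> (-K, -X)\<close>, with
  \<open>X = C\<^sup>7\<close>, \<open>\<eta> = 9/20 K + N\<close> and \<open>H = 9/280 (1 - X) + M\<close>, where \<open>N\<close> and \<open>M\<close> are \<open>nn\<close> and \<open>m1\<close>;
  the reflection \<open>x \<mapsto> -x\<close> acts in this way.\<close>

definition Psi_even :: "real \<Rightarrow> real \<Rightarrow> real \<Rightarrow> real \<Rightarrow> real \<Rightarrow> real" where
  "Psi_even T K N X M = 126034 * ((9/20*K)^4 + 6 * (9/20*K)^2 * N^2 + N^4)
     - 8524 * T * (3 * (9/20*K)^2 * N + N^3) - 174 * T^2 * ((9/20*K)^2 + N^2) + 8 * T^3 * N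
     - 8748 * ((9/280 + M) * ((9/20*K)^2 + N^2) - 9/280 * X * (2 * (9/20*K) * N))"

definition Psi_odd :: "real \<Rightarrow> real \<Rightarrow> real \<Rightarrow> real \<Rightarrow> real \<Rightarrow> real" where
  "Psi_odd T K N X M = 126034 * (4 * (9/20*K)^3 * N + 4 * (9/20*K) * N^3)
     - 8524 * T * ((9/20*K)^3 + 3 * (9/20*K) * N^2) - 174 * T^2 * (2 * (9/20*K) * N) + 8 * T^3 * (9/20*K)
     - 8748 * ((9/280 + M) * (2 * (9/20*K) * N) - 9/280 * X * ((9/20*K)^2 + N^2))"

lemma Psi_split: "\<Psi> T (9/20 * K + N) (9/280 * (1 - X) + M) = Psi_even T K N X M + Psi_odd T K N X M"
  unfolding \<Psi>_def Psi_even_def Psi_odd_def by algebra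

lemma integral_Psi_even: "integral {0..2*pi} (\<lambda>t. Psi_even (tt t) (kk t) (nn t) (xx t) (m1 t) * dtt t) = 0"
proof (rule xsym_odd_integral(2))
  have cm: "continuous_on {0..2*pi} m1" by (rule DERIV_continuous_on[OF m1_deriv])
  show "continuous_on {0..2*pi} (\<lambda>t. Psi_even (tt t) (kk t) (nn t) (xx t) (m1 t) * dtt t)"
    unfolding Psi_even_def by (intro continuous_intros continuous_on_tt continuous_on_nn cm)
  show "xsym (-1) (\<lambda>t. Psi_even (tt t) (kk t) (nn t) (xx t) (m1 t) * dtt t)"
    by (simp add: symmetry_simps nn_def xsym_m1 Psi_even_def)
qed

text \<open>The terms of \<open>Psi_odd\<close> of degree 3 in \<open>K\<close> and \<open>X\<close>
  together, with \<open>(9/20)^3\<close> taken out; this makes the last coefficient 8748 * 9/280 *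
  20/9 = 4374/7.\<close>

definition Psi_cubic :: "real \<Rightarrow> real" where
  "Psi_cubic t = (9/20)^3 * (504136 * kk t ^ 3 * nn t - 8524 * tt t * kk t ^ 3 + 4374/7 * xx t * kk t ^ 2) * dtt t"

text \<open>The terms of \<open>Psi_odd\<close> linear in \<open>K\<close> form an exact differential, because \<open>K dT = - dX / 14\<close>
  and \<open>X dN = d (X (26 N + T) / 54)\<close>.\<close>

lemma integral_Psi_odd:
  "integral {0..2*pi} (\<lambda>t. Psi_odd (tt t) (kk t) (nn t) (xx t) (m1 t) * dtt t) = integral {0..2*pi} Psi_cubic"
proof -
  have cm: "continuous_on {0..2*pi} m1" by (rule DERIV_continuous_on[OF m1_deriv])
  define W where "W t = 504136 * nn t ^ 3 - 25572 * tt t * nn t ^ 2 - 348 * tt t ^ 2 * nn t + 8 * tt t ^ 3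
     - 17496 * m1 t * nn t - 19683/35 * nn t" for t
  \<comment> \<open>A primitive of \<open>X N'\<close>, by \<open>xx_dnn\<close>; it removes the
    terms of \<open>X W'\<close> in which \<open>N'\<close> is multiplied by \<open>M\<close> or by
    a constant.\<close>
  define Rf where "Rf t = 1/54 * (xx t * (26 * nn t + tt t))" for t
  \<comment> \<open>What is left after these cancellations is \<open>X N'\<close> and
    \<open>X T'\<close> times quadratic forms in \<open>N\<close> and \<open>T\<close>. The
    coefficients are those for which \<open>X (26 N + T) Q2\<close> is a primitive of it.\<close>
  define Q2 where "Q2 t = 14268 * nn t ^ 2 - 996 * tt t * nn t + 12 * tt t ^ 2" for t
  define U where "U t = - (9/280) * (xx t * W t + 17496 * (m1 t * Rf t) + 19683/35 * Rf t - xx t * (26 * nn t + tt t) * Q2 t)" for t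
  have dR: "(Rf has_real_derivative xx t * dnn t) (at t within {0..2*pi})" if t: "t \<in> {0..2*pi}" for t
  proof (rule DERIV_cong)
    show "(Rf has_real_derivative 1/54 * (- 14 * cs t ^ 6 * sn t ^ 3 * spd t * (26 * nn t + tt t) + xx t * (26 * dnn t + dtt t))) (at t within {0..2*pi})"
      unfolding Rf_def by (rule derivative_eq_intros xx_deriv nn_deriv[OF t] tt_deriv[OF t] refl)+ (simp add: algebra_simps)
    show "1/54 * (- 14 * cs t ^ 6 * sn t ^ 3 * spd t * (26 * nn t + tt t) + xx t * (26 * dnn t + dtt t)) = xx t * dnn t"
      unfolding kk_dtt using xx_dnn[of t] by simp
  qed
  define dW where "dW t = (1512408 * nn t ^ 2 - 51144 * tt t * nn t - 348 * tt t ^ 2 - 17496 * m1 t - 19683/35) * dnn t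
     + (- 25572 * nn t ^ 2 - 696 * tt t * nn t + 24 * tt t ^ 2 - 17496 * nn t ^ 2) * dtt t" for t
  have dW: "(W has_real_derivative dW t) (at t within {0..2*pi})" if t: "t \<in> {0..2*pi}" for t
    unfolding W_def dW_def
    by (rule derivative_eq_intros nn_deriv[OF t] tt_deriv[OF t] m1_deriv[OF t] refl)+ (simp add: algebra_simps power2_eq_square)
  define dQ where "dQ t = (28536 * nn t - 996 * tt t) * dnn t + (24 * tt t - 996 * nn t) * dtt t" for t
  have dQ: "(Q2 has_real_derivative dQ t) (at t within {0..2*pi})" if t: "t \<in> {0..2*pi}" for t
    unfolding Q2_def dQ_def
    by (rule derivative_eq_intros nn_deriv[OF t] tt_deriv[OF t] refl)+ (simp add: algebra_simps power2_eq_square)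
  have dU: "(U has_real_derivative Psi_odd (tt t) (kk t) (nn t) (xx t) (m1 t) * dtt t - Psi_cubic t) (at t within {0..2*pi})"
    if t: "t \<in> {0..2*pi}" for t
  proof (rule DERIV_cong)
    define K where "K = kk t * dtt t"
    show "(U has_real_derivative - (9/280) * (- 14 * K * W t + xx t * dW t + 17496 * (nn t * dtt t * Rf t + m1 t * (xx t * dnn t))
       + 19683/35 * (xx t * dnn t) - (54 * (xx t * dnn t) * Q2 t + xx t * (26 * nn t + tt t) * dQ t))) (at t within {0..2*pi})"
      unfolding U_def
      apply (rule derivative_eq_intros xx_deriv[unfolded kk_dtt] dW[OF t] m1_deriv[OF t] dR[OF t] nn_deriv[OF t] tt_deriv[OF t] dQ[OF t] refl)+
      using arg_cong[OF xx_dnn[of t], of "\<lambda>u. u * Q2 t"] unfolding K_def by (simp add: algebra_simps)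
    show "- (9/280) * (- 14 * K * W t + xx t * dW t + 17496 * (nn t * dtt t * Rf t + m1 t * (xx t * dnn t))
       + 19683/35 * (xx t * dnn t) - (54 * (xx t * dnn t) * Q2 t + xx t * (26 * nn t + tt t) * dQ t))
      = Psi_odd (tt t) (kk t) (nn t) (xx t) (m1 t) * dtt t - Psi_cubic t"
      unfolding K_def W_def dW_def Rf_def Q2_def dQ_def Psi_odd_def Psi_cubic_def by algebra
  qed
  have int: "(\<lambda>t. Psi_odd (tt t) (kk t) (nn t) (xx t) (m1 t) * dtt t) integrable_on {0..2*pi}" "Psi_cubic integrable_on {0..2*pi}"
    unfolding Psi_odd_def Psi_cubic_def[abs_def]
    by (intro integrable_continuous_real continuous_intros continuous_on_tt continuous_on_nn cm)+
  have "integral {0..2*pi} (\<lambda>t. Psi_odd (tt t) (kk t) (nn t) (xx t) (m1 t) * dtt t - Psi_cubic t) = U (2*pi) - U 0"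
    by (rule integral_ftc[where L = "2*pi", OF dU]) simp_all
  also have "\<dots> = 0"
    by (simp add: U_def W_def Rf_def Q2_def nn_def ll_def m1_symmetry tt_symmetry basic_values)
  finally show ?thesis using int by (simp add: integral_diff)
qed

text \<open>Only the term with \<open>T\<close> is not a monomial, and \<open>tt_bound\<close>
  replaces it by one. The remaining moments are all multiples of the moment of \<open>cs^12\<close>.
  The positive terms win by less than one percent of the negative one, so the constant 1/9 has
  little slack.\<close>

lemma integral_Psi_cubic_pos: "integral {0..2*pi} Psi_cubic > 0"
proof -
  let ?m = "\<lambda>i j t. cs t ^ i * sn t ^ j * spd t"
  define F where "F t = (9/20)^3 * (- 362880/13 * (1/9 * ?m 12 8 t) + 378102/91 * ?m 18 8 t + 4374/7 * ?m 18 4 t)" for t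
  have "mono_integral 12 4 = 3/29 * mono_integral 12 0" "mono_integral 12 8 = 15/41 * mono_integral 12 4"
    "mono_integral 18 0 = 26/29 * mono_integral 12 0" "mono_integral 18 4 = 3/41 * mono_integral 18 0"
    "mono_integral 18 8 = 15/53 * mono_integral 18 4"
    using mono_integral_recurrences(2)[of 12 0] mono_integral_recurrences(2)[of 12 4]
      mono_integral_recurrences(1)[of 12 0] mono_integral_recurrences(2)[of 18 0]
      mono_integral_recurrences(2)[of 18 4] by simp_all
  note rec = this
  have int: "?m i j integrable_on {0..2*pi}" for i j by (intro integrable_continuous_real continuous_intros)
  have "(F has_integral (9/20)^3 * (- 362880/13 * (1/9 * mono_integral 12 8) + 378102/91 * mono_integral 18 8 + 4374/7 * mono_integral 18 4)) {0..2*pi}"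
    unfolding F_def[abs_def] mono_integral_def
    by (intro has_integral_add has_integral_mult_right integrable_integral int)
  then have "integral {0..2*pi} F = (9/20)^3 * (- 362880/13 * (1/9 * mono_integral 12 8) + 378102/91 * mono_integral 18 8 + 4374/7 * mono_integral 18 4)"
    "F integrable_on {0..2*pi}" by (auto simp: has_integral_iff)
  moreover have "(9/20)^3 * (- 362880/13 * (1/9 * mono_integral 12 8) + 378102/91 * mono_integral 18 8 + 4374/7 * mono_integral 18 4) > 0"
    unfolding rec using mono_integral_pos[of 12 0] by (simp add: power3_eq_cube)
  moreover have "F t \<le> Psi_cubic t" if t: "t \<in> {0..2*pi}" for t
  proof -
    have ineq: "cs t ^ 12 * sn t ^ 4 * spd t * (cs t ^ 4 * sn t * tt t) \<le> cs t ^ 12 * sn t ^ 4 * spd t * (sn t ^ 4 / 9)"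
      using spd_pos[of t] by (intro mult_left_mono tt_bound[OF t]) auto
    have eq1: "Psi_cubic t = (9/20)^3 * (- 362880/13 * (cs t ^ 12 * sn t ^ 4 * spd t * (cs t ^ 4 * sn t * tt t)) + 378102/91 * ?m 18 8 t + 4374/7 * ?m 18 4 t)"
      unfolding Psi_cubic_def nn_def kk_def ll_def xx_def dtt_def by algebra
    have eq2: "F t = (9/20)^3 * (- 362880/13 * (cs t ^ 12 * sn t ^ 4 * spd t * (sn t ^ 4 / 9)) + 378102/91 * ?m 18 8 t + 4374/7 * ?m 18 4 t)"
      unfolding F_def by (simp add: field_simps flip: power_add)
    show ?thesis unfolding eq1 eq2
      by (intro mult_left_mono add_right_mono mult_left_mono_neg ineq) simp_all
  qed
  moreover have "Psi_cubic integrable_on {0..2*pi}"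
    unfolding Psi_cubic_def[abs_def]
    by (intro integrable_continuous_real continuous_intros continuous_on_tt continuous_on_nn)
  ultimately show ?thesis
    using integral_le[of F "{0..2*pi}" Psi_cubic] by fastforce
qed

lemma focal_four_value:
  defines "G \<equiv> drift (1/7) (-1/5) (5/21) 1" and "B \<equiv> twist (1/7) (-1/5) (5/21) 1"
  shows "integral {0..2*pi} (focal G B 0) = 0" "integral {0..2*pi} (focal G B 1) = 0"
    "integral {0..2*pi} (focal G B 2) = 0" "integral {0..2*pi} (focal G B 3) = 0"
    "integral {0..2*pi} (focal G B 4) > 0"
proof -
  let ?L = "2 * pi :: real"
  have Lm: "?L \<in> {0..?L}" by simp
  define \<eta> where "\<eta> t = 9/20 * kk t + nn t" for t
  define d\<eta> where "d\<eta> t = 9/20 * ((3 * cs t ^ 10 - 10 * cs t ^ 4 * sn t ^ 4) * spd t) + dnn t" for t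
  define H1 where "H1 t = 9/280 * (1 - xx t) + m1 t" for t
  define H2 where "H2 t = integral {0..t} (\<lambda>t. (\<eta> t)^2 * dtt t)" for t
  have d\<eta>: "(\<eta> has_real_derivative d\<eta> t) (at t within {0..?L})" if t: "t \<in> {0..?L}" for t
    unfolding \<eta>_def d\<eta>_def by (rule derivative_eq_intros kk_deriv nn_deriv[OF t] refl)+ simp
  have dH1: "(H1 has_real_derivative \<eta> t * dtt t) (at t within {0..?L})" if t: "t \<in> {0..?L}" for t
    unfolding H1_def \<eta>_def
    by (rule derivative_eq_intros xx_deriv[unfolded kk_dtt] m1_deriv[OF t] refl)+ (simp add: algebra_simps)
  have cm: "continuous_on {0..?L} m1" by (rule DERIV_continuous_on[OF m1_deriv])
  have c\<eta>: "continuous_on {0..?L} \<eta>" by (rule DERIV_continuous_on[OF d\<eta>])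
  have dH2: "(H2 has_real_derivative (\<eta> t)^2 * dtt t) (at t within {0..?L})" if t: "t \<in> {0..?L}" for t
    unfolding H2_def by (rule integral_has_real_derivative[OF _ t]) (intro continuous_intros c\<eta>)
  \<comment> \<open>The second focal value vanishes at \<open>\<epsilon>\<^sub>2 = 0\<close>: of
    \<open>\<eta>^2 dT\<close> the squares are odd under the reflection, and the cross term
    \<open>9/10 K N dT\<close> is exact by \<open>xx_dnn\<close>.\<close>
  have H2L: "H2 ?L = 0"
  proof -
    define E where "E t = ((9/20 * kk t)^2 + (nn t)^2) * dtt t" for t
    have cE: "continuous_on {0..?L} E" unfolding E_def by (intro continuous_intros continuous_on_nn)
    have "xsym (-1) E" by (simp add: E_def symmetry_simps nn_def)
    then have E0: "integral {0..?L} E = 0" by (rule xsym_odd_integral(2)[OF cE])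
    define V where "V t = - 9/140 * (xx t * nn t - 1/54 * (xx t * (26 * nn t + tt t)))" for t
    have dV: "(V has_real_derivative 9/10 * (kk t * dtt t) * nn t) (at t within {0..?L})" if t: "t \<in> {0..?L}" for t
      unfolding V_def
      apply (rule derivative_eq_intros xx_deriv[unfolded kk_dtt] nn_deriv[OF t] tt_deriv[OF t] refl)+
      using xx_dnn[of t] by (simp add: algebra_simps)
    have "integral {0..?L} (\<lambda>t. 9/10 * (kk t * dtt t) * nn t) = V ?L - V 0" by (rule integral_ftc[OF dV Lm])
    also have "\<dots> = 0" by (simp add: V_def nn_def ll_def tt_symmetry basic_values)
    finally have V0: "integral {0..?L} (\<lambda>t. 9/10 * (kk t * dtt t) * nn t) = 0" .
    have "H2 ?L = integral {0..?L} (\<lambda>t. E t + 9/10 * (kk t * dtt t) * nn t)"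
      unfolding H2_def by (intro integral_cong) (simp add: E_def \<eta>_def power2_eq_square algebra_simps)
    also have "\<dots> = integral {0..?L} E + integral {0..?L} (\<lambda>t. 9/10 * (kk t * dtt t) * nn t)"
      by (intro integral_add integrable_continuous_real continuous_intros cE continuous_on_nn)
    finally show ?thesis unfolding E0 V0 by simp
  qed
  have H20: "H2 0 = 0" by (simp add: H2_def)
  have v: "\<eta> 0 = 0" "\<eta> ?L = 0" "H1 0 = 0" "H1 ?L = 0"
    by (simp_all add: \<eta>_def H1_def kk_def nn_def ll_def xx_def tt_symmetry m1_symmetry basic_values)
  have G: "G t = 2/27 * (dtt t - d\<eta> t)" for t
    using cs_sn[of t] unfolding G_def drift_def d\<eta>_def dnn_def dtt_def by algebra
  have B: "B t = tt t / 27 + 26/27 * \<eta> t" for t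
    by (simp add: B_def twist_def \<eta>_def nn_def kk_def ll_def field_simps)
  have c: "continuous_on {0..?L} dtt" "continuous_on {0..?L} d\<eta>"
    unfolding d\<eta>_def[abs_def] dnn_def[abs_def] by (intro continuous_intros)+
  obtain M where M: "\<And>a22 a50 b13 b41. \<bar>a22\<bar> \<le> 1 \<and> \<bar>a50\<bar> \<le> 1 \<and> \<bar>b13\<bar> \<le> 1 \<and> \<bar>b41\<bar> \<le> 1 \<Longrightarrow>
      flow_data (drift a22 a50 b13 b41) (twist a22 a50 b13 b41) M (2*pi)"
    using system_flow_data by auto
  interpret flow_data G B M "2*pi" unfolding G_def B_def by (rule M) simp
  have p01: "integral {0..2*pi} (focal G B 0) = 0" "integral {0..2*pi} (focal G B 1) = 0"
    using focal_two_value[of 0] by (simp_all add: G_def B_def)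
  have p2: "integral {0..2*pi} (focal G B 2) = 0"
    using focal_two_value(3)[of 0] by (simp add: G_def B_def)
  have p3: "integral {0..2*pi} (focal G B 3) = 0"
  proof (rule focal_odd_vanishes)
    fix j :: nat assume "j < 3"
    then have "j = 0 \<or> j = 1 \<or> j = 2" by auto
    then show "integral {0..2*pi} (focal G B j) = 0" using p01 p2 by blast
  qed (simp_all add: G_def B_def drift_twist_parity)
  have "1594323 * integral {0..2*pi} (focal G B 4) = integral {0..2*pi} (\<lambda>t. (126034 * \<eta> t ^ 4 - 8524 * tt t * \<eta> t ^ 3
       - 174 * tt t ^ 2 * \<eta> t ^ 2 + 8 * tt t ^ 3 * \<eta> t - 8748 * H1 t * \<eta> t ^ 2) * dtt t)"
    by (rule focal_four(4)[where L = "2*pi", OF _ tt_deriv tt_symmetry(3,2) d\<eta> v(1,2) dH1 v(3,4) dH2 H20 H2L G B c p3]) simp_all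
  also have "\<dots> = integral {0..2*pi} (\<lambda>t. Psi_even (tt t) (kk t) (nn t) (xx t) (m1 t) * dtt t + Psi_odd (tt t) (kk t) (nn t) (xx t) (m1 t) * dtt t)"
    unfolding distrib_right[symmetric] Psi_split[symmetric] by (simp only: \<Psi>_def \<eta>_def H1_def)
  also have "\<dots> = integral {0..2*pi} (\<lambda>t. Psi_even (tt t) (kk t) (nn t) (xx t) (m1 t) * dtt t) + integral {0..2*pi} (\<lambda>t. Psi_odd (tt t) (kk t) (nn t) (xx t) (m1 t) * dtt t)"
    unfolding Psi_even_def Psi_odd_def
    by (intro integral_add integrable_continuous_real continuous_intros continuous_on_tt continuous_on_nn cm)
  also have "\<dots> = integral {0..2*pi} Psi_cubic" by (simp add: integral_Psi_even integral_Psi_odd)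
  finally have "1594323 * integral {0..2*pi} (focal G B 4) > 0" using integral_Psi_cubic_pos by (simp only:)
  then show "integral {0..2*pi} (focal G B 4) > 0" by simp
  show "integral {0..2*pi} (focal G B 0) = 0" "integral {0..2*pi} (focal G B 1) = 0"
    "integral {0..2*pi} (focal G B 2) = 0" "integral {0..2*pi} (focal G B 3) = 0" by (fact p01 p2 p3)+
qed

section \<open>Uniqueness for the planar system\<close>

text \<open>\<open>exp (- m t) * N t\<close> does not increase and \<open>exp (m t) * N t\<close>
  does not decrease, so a zero of \<open>N\<close> spreads in both directions.\<close>

lemma gronwall_zero:
  fixes N :: "real \<Rightarrow> real"
  assumes d: "\<And>t. t \<in> {a..b} \<Longrightarrow> (N has_real_derivative N' t) (at t within {a..b})"
    and b: "\<And>t. t \<in> {a..b} \<Longrightarrow> \<bar>N' t\<bar> \<le> m * N t"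
    and nn: "\<And>t. t \<in> {a..b} \<Longrightarrow> N t \<ge> 0"
    and t0: "t0 \<in> {a..b}" "N t0 = 0" and t: "t \<in> {a..b}"
  shows "N t = 0"
proof -
  have D: "((\<lambda>t. exp (k * t) * N t) has_real_derivative exp (k * s) * (k * N s + N' s)) (at s)"
    if "a < s" "s < b" for k s
  proof -
    have "(N has_real_derivative N' s) (at s)"
      using d[of s] that at_within_Icc_at[of a s b] by auto
    then show ?thesis by (auto intro!: derivative_eq_intros simp: algebra_simps)
  qed
  have cN: "continuous_on {a..b} N" by (rule DERIV_continuous_on[OF d])
  have cont: "continuous_on {u..v} (\<lambda>t. exp (k * t) * N t)" if "a \<le> u" "v \<le> b" for k u v
    by (intro continuous_intros continuous_on_subset[OF cN]) (use that in auto)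
  have "N t \<le> 0"
  proof (cases t0 t rule: linorder_cases)
    case less
    have "exp (- m * t) * N t \<le> exp (- m * t0) * N t0"
    proof (rule DERIV_nonpos_imp_decreasing_open[OF less_imp_le[OF less]])
      fix s assume s: "t0 < s" "s < t"
      then have "exp (- m * s) * (- m * N s + N' s) \<le> 0"
        using b[of s] t t0 by (intro mult_nonneg_nonpos) auto
      then show "\<exists>y. ((\<lambda>t. exp (- m * t) * N t) has_real_derivative y) (at s) \<and> y \<le> 0"
        using D[of s "-m"] s t t0 by auto
    next
      show "continuous_on {t0..t} (\<lambda>t. exp (- m * t) * N t)" by (rule cont) (use t t0 in auto)
    qed
    then show ?thesis using t0 by (simp add: mult_le_0_iff)
  next
    case greater
    have "exp (m * t) * N t \<le> exp (m * t0) * N t0"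
    proof (rule DERIV_nonneg_imp_increasing_open[OF less_imp_le[OF greater]])
      fix s assume s: "t < s" "s < t0"
      then have "exp (m * s) * (m * N s + N' s) \<ge> 0"
        using b[of s] t t0 by (intro mult_nonneg_nonneg) auto
      then show "\<exists>y. ((\<lambda>t. exp (m * t) * N t) has_real_derivative y) (at s) \<and> y \<ge> 0"
        using D[of s m] s t t0 by auto
    next
      show "continuous_on {t..t0} (\<lambda>t. exp (m * t) * N t)" by (rule cont) (use t t0 in auto)
    qed
    then show ?thesis using t0 by (simp add: mult_le_0_iff)
  qed (use t0 in auto)
  then show ?thesis using nn[OF t] by simp
qed

text \<open>The scalar factor allows for a change of parameter: \<open>c = 1\<close> for time, and
  \<open>c\<close> the derivative of time with respect to the angle in
  \<open>orbit_contains_curve\<close>.\<close>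

lemma ode_unique:
  fixes F :: "'a::real_inner \<Rightarrow> 'a"
  assumes lip: "\<And>p q. norm p \<le> \<rho> \<Longrightarrow> norm q \<le> \<rho> \<Longrightarrow> norm (F p - F q) \<le> \<Lambda> * norm (p - q)"
    and f: "\<And>t. t \<in> {a..b} \<Longrightarrow> (f has_vector_derivative c t *\<^sub>R F (f t)) (at t within {a..b})"
    and g: "\<And>t. t \<in> {a..b} \<Longrightarrow> (g has_vector_derivative c t *\<^sub>R F (g t)) (at t within {a..b})"
    and c: "\<And>t. t \<in> {a..b} \<Longrightarrow> \<bar>c t\<bar> \<le> C"
    and \<rho>: "\<And>t. t \<in> {a..b} \<Longrightarrow> norm (f t) \<le> \<rho>" "\<And>t. t \<in> {a..b} \<Longrightarrow> norm (g t) \<le> \<rho>"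
    and t0: "t0 \<in> {a..b}" "f t0 = g t0" and t: "t \<in> {a..b}"
  shows "f t = g t"
proof -
  define N where "N t = (f t - g t) \<bullet> (f t - g t)" for t
  define N' where "N' t = 2 * ((f t - g t) \<bullet> (c t *\<^sub>R (F (f t) - F (g t))))" for t
  have dN: "(N has_real_derivative N' s) (at s within {a..b})" if s: "s \<in> {a..b}" for s
  proof -
    have "((\<lambda>t. f t - g t) has_derivative (\<lambda>h. h *\<^sub>R (c s *\<^sub>R (F (f s) - F (g s))))) (at s within {a..b})"
      using has_vector_derivative_diff[OF f[OF s] g[OF s]]
      by (simp add: has_vector_derivative_def scaleR_diff_right)
    from has_derivative_inner[OF this this]
    have "(N has_derivative (\<lambda>h. N' s * h)) (at s within {a..b})"
      unfolding N_def[abs_def]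
      by (rule has_derivative_eq_rhs) (auto simp: N'_def inner_commute mult_ac)
    then show ?thesis by (simp add: has_field_derivative_def)
  qed
  have "N t = 0"
  proof (rule gronwall_zero[OF dN _ _ t0(1) _ t])
    fix s assume s: "s \<in> {a..b}"
    have C0: "C \<ge> 0" using c[OF s] by linarith
    have "\<bar>N' s\<bar> = 2 * \<bar>c s\<bar> * \<bar>(f s - g s) \<bullet> (F (f s) - F (g s))\<bar>"
      by (simp add: N'_def abs_mult)
    also have "\<dots> \<le> 2 * C * (norm (f s - g s) * (\<Lambda> * norm (f s - g s)))"
      using c[OF s] C0 lip[OF \<rho>(1)[OF s] \<rho>(2)[OF s]]
      by (intro mult_mono order_trans[OF Cauchy_Schwarz_ineq2] mult_left_mono) auto
    also have "\<dots> = 2 * C * \<Lambda> * N s"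
      by (simp add: N_def dot_square_norm power2_eq_square)
    finally show "\<bar>N' s\<bar> \<le> (2 * C * \<Lambda>) * N s" .
  qed (use t0 in \<open>auto simp: N_def\<close>)
  then show ?thesis by (simp add: N_def)
qed

text \<open>Keeping the bound together with the Lipschitz constant makes the property stable under
  products, hence available for polynomials on balls.\<close>

definition bdd_lipschitz :: "'a::real_normed_vector set \<Rightarrow> ('a \<Rightarrow> real) \<Rightarrow> bool" where
  "bdd_lipschitz S f \<longleftrightarrow> (\<exists>K\<ge>0. \<forall>p\<in>S. \<bar>f p\<bar> \<le> K \<and> (\<forall>q\<in>S. \<bar>f p - f q\<bar> \<le> K * norm (p - q)))"

lemma bdd_lipschitz_const: "bdd_lipschitz S (\<lambda>_. c)"
  unfolding bdd_lipschitz_def by (intro exI[of _ "\<bar>c\<bar>"]) auto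

lemma bdd_lipschitz_add:
  assumes "bdd_lipschitz S f" "bdd_lipschitz S g"
  shows "bdd_lipschitz S (\<lambda>p. f p + g p)"
proof -
  obtain K L where K: "K \<ge> 0" "\<And>p. p \<in> S \<Longrightarrow> \<bar>f p\<bar> \<le> K" "\<And>p q. p \<in> S \<Longrightarrow> q \<in> S \<Longrightarrow> \<bar>f p - f q\<bar> \<le> K * norm (p - q)"
    and L: "L \<ge> 0" "\<And>p. p \<in> S \<Longrightarrow> \<bar>g p\<bar> \<le> L" "\<And>p q. p \<in> S \<Longrightarrow> q \<in> S \<Longrightarrow> \<bar>g p - g q\<bar> \<le> L * norm (p - q)"
    using assms unfolding bdd_lipschitz_def by metis
  have "\<bar>f p + g p\<bar> \<le> K + L" if "p \<in> S" for p using K(2)[OF that] L(2)[OF that] by linarith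
  moreover have "\<bar>(f p + g p) - (f q + g q)\<bar> \<le> (K + L) * norm (p - q)" if "p \<in> S" "q \<in> S" for p q
    using K(3)[OF that] L(3)[OF that] unfolding distrib_right by linarith
  ultimately show ?thesis unfolding bdd_lipschitz_def using K(1) L(1) by (intro exI[of _ "K + L"]) auto
qed

lemma bdd_lipschitz_mult:
  assumes "bdd_lipschitz S f" "bdd_lipschitz S g"
  shows "bdd_lipschitz S (\<lambda>p. f p * g p)"
proof -
  obtain K L where K: "K \<ge> 0" "\<And>p. p \<in> S \<Longrightarrow> \<bar>f p\<bar> \<le> K" "\<And>p q. p \<in> S \<Longrightarrow> q \<in> S \<Longrightarrow> \<bar>f p - f q\<bar> \<le> K * norm (p - q)"
    and L: "L \<ge> 0" "\<And>p. p \<in> S \<Longrightarrow> \<bar>g p\<bar> \<le> L" "\<And>p q. p \<in> S \<Longrightarrow> q \<in> S \<Longrightarrow> \<bar>g p - g q\<bar> \<le> L * norm (p - q)"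
    using assms unfolding bdd_lipschitz_def by metis
  have KL: "0 \<le> K * L" using K L by simp
  have "\<bar>f p * g p\<bar> \<le> 2 * K * L" if "p \<in> S" for p
  proof -
    have "\<bar>f p * g p\<bar> \<le> K * L" unfolding abs_mult using K(2)[OF that] L(2)[OF that] K(1) by (intro mult_mono) auto
    then show ?thesis using KL by simp
  qed
  moreover have "\<bar>f p * g p - f q * g q\<bar> \<le> (2 * K * L) * norm (p - q)" if "p \<in> S" "q \<in> S" for p q
  proof -
    have "f p * g p - f q * g q = f p * (g p - g q) + (f p - f q) * g q" by (simp add: algebra_simps)
    then have "\<bar>f p * g p - f q * g q\<bar> \<le> \<bar>f p\<bar> * \<bar>g p - g q\<bar> + \<bar>f p - f q\<bar> * \<bar>g q\<bar>"
      using abs_triangle_ineq[of "f p * (g p - g q)" "(f p - f q) * g q"] by (simp add: abs_mult)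
    also have "\<dots> \<le> K * (L * norm (p - q)) + (K * norm (p - q)) * L"
      using K L that by (intro add_mono mult_mono) auto
    finally show ?thesis by (simp add: algebra_simps)
  qed
  ultimately show ?thesis unfolding bdd_lipschitz_def using KL by (intro exI[of _ "2 * K * L"]) auto
qed

lemma bdd_lipschitz_power:
  assumes "bdd_lipschitz S f" shows "bdd_lipschitz S (\<lambda>p. f p ^ n)"
  by (induction n) (simp_all add: bdd_lipschitz_const bdd_lipschitz_mult assms)

lemma vfield_lipschitz:
  "\<exists>\<Lambda>. \<forall>p q. norm p \<le> \<rho> \<longrightarrow> norm q \<le> \<rho> \<longrightarrow>
     norm (vfield a22 a50 b13 b41 p - vfield a22 a50 b13 b41 q) \<le> \<Lambda> * norm (p - q)"
proof -
  let ?F = "vfield a22 a50 b13 b41"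
  let ?S = "{p :: real \<times> real. norm p \<le> \<rho>}"
  have n: "\<bar>fst p\<bar> \<le> norm p" "\<bar>snd p\<bar> \<le> norm p" for p :: "real \<times> real"
    using norm_fst_le[of "fst p" "snd p"] norm_snd_le[of "snd p" "fst p"] by auto
  have "\<bar>fst p - fst q\<bar> \<le> max 1 \<rho> * norm (p - q)" "\<bar>snd p - snd q\<bar> \<le> max 1 \<rho> * norm (p - q)"
    for p q :: "real \<times> real"
    using n[of "p - q"] mult_right_mono[of 1 "max 1 \<rho>" "norm (p - q)"] by simp_all
  moreover have "\<bar>fst p\<bar> \<le> max 1 \<rho>" "\<bar>snd p\<bar> \<le> max 1 \<rho>" if "p \<in> ?S" for p
    using n[of p] that by auto
  ultimately have "bdd_lipschitz ?S fst" "bdd_lipschitz ?S snd"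
    unfolding bdd_lipschitz_def by (intro exI[of _ "max 1 \<rho>"]; simp)+
  note rules = bdd_lipschitz_add bdd_lipschitz_mult bdd_lipschitz_power bdd_lipschitz_const this
  have "fst (?F p) = (- 2) * snd p^3 + (a22 * fst p^2 * snd p^2 + a50 * fst p^5)"
    "snd (?F p) = 3 * fst p^5 + (b13 * fst p * snd p^3 + b41 * fst p^4 * snd p)" for p
    by (simp_all add: vfield_def split_beta)
  moreover have "bdd_lipschitz ?S (\<lambda>p. (- 2) * snd p^3 + (a22 * fst p^2 * snd p^2 + a50 * fst p^5))"
    by (intro rules)
  moreover have "bdd_lipschitz ?S (\<lambda>p. 3 * fst p^5 + (b13 * fst p * snd p^3 + b41 * fst p^4 * snd p))"
    by (intro rules)
  ultimately have b: "bdd_lipschitz ?S (\<lambda>p. fst (?F p))" "bdd_lipschitz ?S (\<lambda>p. snd (?F p))" by simp_all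
  obtain K where K: "\<And>p q. p \<in> ?S \<Longrightarrow> q \<in> ?S \<Longrightarrow> \<bar>fst (?F p) - fst (?F q)\<bar> \<le> K * norm (p - q)"
    using b(1) unfolding bdd_lipschitz_def by blast
  obtain L where L: "\<And>p q. p \<in> ?S \<Longrightarrow> q \<in> ?S \<Longrightarrow> \<bar>snd (?F p) - snd (?F q)\<bar> \<le> L * norm (p - q)"
    using b(2) unfolding bdd_lipschitz_def by blast
  have "norm (?F p - ?F q) \<le> (K + L) * norm (p - q)" if "norm p \<le> \<rho>" "norm q \<le> \<rho>" for p q
  proof -
    have "norm (?F p - ?F q) \<le> \<bar>fst (?F p) - fst (?F q)\<bar> + \<bar>snd (?F p) - snd (?F q)\<bar>"
      using sqrt_sum_squares_le_sum_abs[of "fst (?F p) - fst (?F q)" "snd (?F p) - snd (?F q)"]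
      by (simp add: norm_prod_def)
    then show ?thesis using K[of p q] L[of p q] that unfolding distrib_right by simp
  qed
  then show ?thesis by blast
qed

section \<open>Periodic solutions and periodic extension\<close>

lemma vector_derivative_shift:
  fixes f :: "real \<Rightarrow> 'a::real_normed_vector"
  assumes "(f has_vector_derivative d) (at (t + c) within ((\<lambda>s. s + c) ` S))"
  shows "((\<lambda>s. f (s + c)) has_vector_derivative d) (at t within S)"
proof -
  have "((\<lambda>s. s + c) has_vector_derivative 1) (at t within S)"
    by (rule has_vector_derivative_eq_rhs[OF has_vector_derivative_add[OF has_vector_derivative_id has_vector_derivative_const]]) simp
  from vector_diff_chain_within[OF this assms] show ?thesis by (simp add: o_def)
qed

lemma global_solution_unique:
  fixes f g :: "real \<Rightarrow> real \<times> real" and a22 a50 b13 b41 :: real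
  defines "F \<equiv> vfield a22 a50 b13 b41"
  assumes f: "\<And>t. (f has_vector_derivative F (f t)) (at t)" "\<And>t. norm (f t) \<le> \<rho>"
    and g: "\<And>t. (g has_vector_derivative F (g t)) (at t)" "\<And>t. norm (g t) \<le> \<rho>"
    and eq: "f t0 = g t0"
  shows "f t = g t"
proof -
  obtain \<Lambda> where \<Lambda>: "\<And>p q. norm p \<le> \<rho> \<Longrightarrow> norm q \<le> \<rho> \<Longrightarrow> norm (F p - F q) \<le> \<Lambda> * norm (p - q)"
    unfolding F_def using vfield_lipschitz by blast
  show ?thesis
  proof (rule ode_unique[where a = "min t t0" and b = "max t t0" and c = "\<lambda>_. 1" and C = 1 and F = F and \<rho> = \<rho> and \<Lambda> = \<Lambda>])
    fix s assume "s \<in> {min t t0..max t t0}"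
    show "(f has_vector_derivative 1 *\<^sub>R F (f s)) (at s within {min t t0..max t t0})"
      "(g has_vector_derivative 1 *\<^sub>R F (g s)) (at s within {min t t0..max t t0})"
      using f(1)[of s] g(1)[of s] by (auto intro: has_vector_derivative_at_within)
  qed (use \<Lambda> f(2) g(2) eq in auto)
qed

lemma periodic_orbit_compact:
  assumes "\<And>t. ((\<phi> :: real \<Rightarrow> real \<times> real) has_vector_derivative F (\<phi> t)) (at t)" "T > 0" "\<And>t. \<phi> (t + T) = \<phi> t"
  shows "compact (range \<phi>)"
proof -
  have c: "continuous_on A \<phi>" for A
    by (rule continuous_on_vector_derivative[OF has_vector_derivative_at_within[OF assms(1)]])
  have per: "\<phi> (t + real n * T) = \<phi> t" for t n
  proof (induction n)
    case (Suc n)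
    have "\<phi> (t + real (Suc n) * T) = \<phi> ((t + real n * T) + T)" by (simp add: algebra_simps)
    then show ?case using Suc assms(3) by simp
  qed simp
  have "range \<phi> \<subseteq> \<phi> ` {0..T}"
  proof (rule image_subsetI)
    fix t
    define k where "k = \<lfloor>t / T\<rfloor>"
    have k: "real_of_int k * T \<le> t" "t < (real_of_int k + 1) * T"
      using assms(2) by (simp_all add: k_def flip: pos_le_divide_eq pos_divide_less_eq)
    define s where "s = t - real_of_int k * T"
    have s: "s \<in> {0..T}" using k by (simp add: s_def algebra_simps)
    have "\<phi> t = \<phi> s"
    proof (cases "k \<ge> 0")
      case True
      then have "real (nat k) = real_of_int k" by simp
      then have "\<phi> (s + real_of_int k * T) = \<phi> s" using per[of s "nat k"] by simp
      then show ?thesis by (simp add: s_def)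
    next
      case False
      then have "real (nat (- k)) = - real_of_int k" by simp
      then have "\<phi> (t + (- real_of_int k) * T) = \<phi> t" using per[of t "nat (- k)"] by simp
      then show ?thesis by (simp add: s_def)
    qed
    then show "\<phi> t \<in> \<phi> ` {0..T}" using s by blast
  qed
  then have "range \<phi> = \<phi> ` {0..T}" by blast
  then show ?thesis using c by (simp add: compact_continuous_image)
qed

text \<open>Periodic orbits are compact, so one ball and its Lipschitz constant serve for all times.
  After time shifts both solutions start at the common point.\<close>

lemma periodic_orbit_meet_eq:
  assumes "periodic_orbit (vfield a22 a50 b13 b41) C" "periodic_orbit (vfield a22 a50 b13 b41) C'" "p \<in> C" "p \<in> C'"
  shows "C = C'"
proof -
  let ?F = "vfield a22 a50 b13 b41"
  obtain f T where f: "\<And>t. (f has_vector_derivative ?F (f t)) (at t)" "T > 0" "\<And>t. f (t + T) = f t" "C = range f"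
    using assms(1) unfolding periodic_orbit_def by blast
  obtain g S where g: "\<And>t. (g has_vector_derivative ?F (g t)) (at t)" "S > 0" "\<And>t. g (t + S) = g t" "C' = range g"
    using assms(2) unfolding periodic_orbit_def by blast
  obtain t1 t2 where t: "p = f t1" "p = g t2" using assms f g by blast
  have "bounded (range f \<union> range g)"
    using periodic_orbit_compact[OF f(1-3)] periodic_orbit_compact[OF g(1-3)] by (simp add: compact_imp_bounded)
  then obtain \<rho> where "\<forall>x\<in>range f \<union> range g. norm x \<le> \<rho>" by (auto simp only: bounded_iff)
  then have \<rho>: "norm (f t) \<le> \<rho>" "norm (g t) \<le> \<rho>" for t by auto
  have sh: "((\<lambda>s. h (s + c)) has_vector_derivative ?F (h (s + c))) (at s)"
    if "\<And>t. (h has_vector_derivative ?F (h t)) (at t)" for h :: "real \<Rightarrow> real \<times> real" and c s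
    by (rule vector_derivative_shift[OF has_vector_derivative_at_within[OF that]])
  have "(\<lambda>t. f (t + t1)) s = (\<lambda>t. g (t + t2)) s" for s
  proof (rule global_solution_unique[where f = "\<lambda>t. f (t + t1)" and g = "\<lambda>t. g (t + t2)" and t = s and \<rho> = \<rho> and t0 = 0])
    fix s
    show "((\<lambda>t. f (t + t1)) has_vector_derivative ?F (f (s + t1))) (at s)" by (rule sh[OF f(1)])
    show "((\<lambda>t. g (t + t2)) has_vector_derivative ?F (g (s + t2))) (at s)" by (rule sh[OF g(1)])
    show "norm (f (s + t1)) \<le> \<rho>" "norm (g (s + t2)) \<le> \<rho>" by (rule \<rho>)+
    show "f (0 + t1) = g (0 + t2)" using t by simp
  qed
  then have "f t = g ((t - t1) + t2)" "g t = f ((t - t2) + t1)" for t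
    by (metis diff_add_cancel)+
  then show ?thesis unfolding f(4) g(4) by blast
qed

text \<open>The delicate points are the multiples of \<open>T\<close>, where the left derivative at
  \<open>T\<close> is glued to the translated right derivative at 0.\<close>

lemma periodic_extension_deriv:
  fixes f :: "real \<Rightarrow> 'a::real_normed_vector"
  assumes T: "T > 0" and per: "\<And>t. f (t + T) = f t" "\<And>t. f' (t + T) = f' t"
    and d: "\<And>t. t \<in> {0..T} \<Longrightarrow> (f has_vector_derivative f' t) (at t within {0..T})"
  shows "(f has_vector_derivative f' t) (at t)"
proof -
  have perZ: "f (t + real_of_int k * T) = f t \<and> f' (t + real_of_int k * T) = f' t" for t k
  proof (induction k rule: int_induct[where k = 0])
    case (step1 i)
    have "t + real_of_int (i + 1) * T = (t + real_of_int i * T) + T" by (simp add: algebra_simps)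
    then show ?case using step1 per by metis
  next
    case (step2 i)
    have "t + real_of_int i * T = (t + real_of_int (i - 1) * T) + T" by (simp add: algebra_simps)
    then show ?case using step2 per by metis
  qed simp
  have shift: "(f has_vector_derivative f' t) (at t)"
    if "(f has_vector_derivative f' (t + c)) (at (t + c))" "\<And>s. f (s + c) = f s" "f' (t + c) = f' t" for t c
    using vector_derivative_shift[OF has_vector_derivative_at_within[OF that(1)]] that(2,3) by simp
  have d0: "(f has_vector_derivative f' T) (at T)"
  proof -
    have l: "(f has_vector_derivative f' T) (at_left T)"
      using d[of T] T at_within_Icc_at_left[of 0 T] by simp
    have r0: "(f has_vector_derivative f' 0) (at_right 0)"
      using d[of 0] T at_within_Icc_at_right[of 0 T] by simp
    have "(f has_vector_derivative f' 0) (at 0 within {0..})" 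
      using r0 by (simp add: at_within_Ici_at_right)
    moreover have "(\<lambda>s. s + (- T)) ` {T..} \<subseteq> {0..}" by auto
    ultimately have "(f has_vector_derivative f' 0) (at (T + (- T)) within (\<lambda>s. s + (- T)) ` {T..})"
      by (auto intro: has_vector_derivative_within_subset)
    from vector_derivative_shift[OF this]
    have "(f has_vector_derivative f' 0) (at T within {T..})"
      using per(1)[of "s - T" for s] by simp
    moreover have "f' 0 = f' T" using per(2)[of 0] by simp
    ultimately have r: "(f has_vector_derivative f' T) (at_right T)"
      by (simp add: at_within_Ici_at_right)
    show ?thesis
      using l r unfolding has_vector_derivative_def has_derivative_def filterlim_at_split
      by (auto simp: netlimit_at Lim_ident_at)
  qed
  define k where "k = \<lfloor>t / T\<rfloor>"
  have k: "real_of_int k * T \<le> t" "t < (real_of_int k + 1) * T"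
    using T by (simp_all add: k_def flip: pos_le_divide_eq pos_divide_less_eq)
  define s where "s = t + real_of_int (- k) * T"
  have s: "0 \<le> s" "s < T" using k by (simp_all add: s_def algebra_simps)
  have "(f has_vector_derivative f' s) (at s)"
  proof (cases "s = 0")
    case True
    then show ?thesis using shift[of 0 T] d0 per(1) per(2)[of 0] by simp
  next
    case False
    then show ?thesis using d[of s] s at_within_Icc_at[of 0 s T] by auto
  qed
  then show ?thesis
    using shift[of t "real_of_int (- k) * T"] perZ[of _ "- k"] by (simp add: s_def)
qed

section \<open>Limit cycles from fixed points of the return map\<close>

lemma periodic_residue:
  fixes t P :: real
  assumes "P > 0"
  shows "t - P * of_int \<lfloor>t / P\<rfloor> \<in> {0..P}" "(t + P) - P * of_int \<lfloor>(t + P) / P\<rfloor> = t - P * of_int \<lfloor>t / P\<rfloor>"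
proof -
  have "P * of_int \<lfloor>t / P\<rfloor> \<le> P * (t / P)" "P * (t / P) < P * (of_int \<lfloor>t / P\<rfloor> + 1)"
    using assms by (intro mult_left_mono mult_strict_left_mono; linarith)+
  then have "P * of_int \<lfloor>t / P\<rfloor> \<le> t" "t < P * of_int \<lfloor>t / P\<rfloor> + P"
    using assms by (simp_all add: distrib_left)
  then show "t - P * of_int \<lfloor>t / P\<rfloor> \<in> {0..P}" by simp
  have "(t + P) / P = t / P + 1" using assms by (simp add: field_simps)
  then show "(t + P) - P * of_int \<lfloor>(t + P) / P\<rfloor> = t - P * of_int \<lfloor>t / P\<rfloor>"
    by (simp add: algebra_simps)
qed

text \<open>Passage from angle to time. A primitive \<open>\<tau>\<close> of \<open>s\<close> is an
  increasing bijection of the line that advances by \<open>T\<close> in each period, and its inverse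
  provides the new parameter.\<close>

lemma periodic_reparametrization:
  fixes f :: "real \<Rightarrow> 'a::real_normed_vector" and s :: "real \<Rightarrow> real"
  assumes P: "P > 0" and per: "\<And>t. f (t + P) = f t" "\<And>t. s (t + P) = s t"
    and s: "\<And>t. s t > 0" "continuous_on {0..P} s"
    and f: "\<And>t. (f has_vector_derivative s t *\<^sub>R F (f t)) (at t)"
  shows "\<exists>\<phi> T. T > 0 \<and> (\<forall>t. (\<phi> has_vector_derivative F (\<phi> t)) (at t)) \<and> (\<forall>t. \<phi> (t + T) = \<phi> t) \<and> range \<phi> = range f"
proof -
  define e where "e t = t - P * of_int \<lfloor>t / P\<rfloor>" for t
  have e: "e t \<in> {0..P}" "e (t + P) = e t" for t
    using periodic_residue[OF P, of t] by (simp_all only: e_def)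
  have e0: "e t = t" if "0 \<le> t" "t < P" for t
  proof -
    have "\<lfloor>t / P\<rfloor> = 0" using that P by (simp add: floor_eq_iff)
    then show ?thesis by (simp add: e_def)
  qed
  have eP: "e P = 0" using P by (simp add: e_def)
  define I where "I t = integral {0..t} s" for t
  define T where "T = I P"
  \<comment> \<open>Subtracting the mean slope gives a function with equal values at 0 and
    \<open>P\<close>, which extends periodically through \<open>e\<close>; \<open>\<tau>\<close>
    restores the slope.\<close>
  define g where "g t = I t - T / P * t" for t
  have dg: "(g has_vector_derivative s t - T / P) (at t within {0..P})" if t: "t \<in> {0..P}" for t
  proof -
    have "(I has_real_derivative s t) (at t within {0..P})"
      unfolding I_def by (rule integral_has_real_derivative[OF s(2) t])
    then have "(g has_real_derivative s t - T / P) (at t within {0..P})"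
      unfolding g_def using P by (auto intro!: derivative_eq_intros)
    then show ?thesis by (simp add: has_real_derivative_iff_has_vector_derivative)
  qed
  have gP: "g P = g 0" using P by (simp add: g_def T_def I_def)
  have ge: "g (e t) = g t" if "t \<in> {0..P}" for t
    using that e0[of t] eP gP by (cases "t = P") auto
  have d0: "((\<lambda>t. g (e t)) has_vector_derivative s t - T / P) (at t)" for t
  proof (rule periodic_extension_deriv[OF P])
    fix t assume t: "t \<in> {0..P}"
    show "((\<lambda>t. g (e t)) has_vector_derivative s t - T / P) (at t within {0..P})"
      by (rule has_vector_derivative_transform[OF t _ dg[OF t]]) (use ge in auto)
  qed (use e per in auto)
  define \<tau> where "\<tau> t = g (e t) + T / P * t" for t
  have d\<tau>: "(\<tau> has_real_derivative s t) (at t)" for t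
    unfolding \<tau>_def using d0[of t] P
    by (auto simp: has_real_derivative_iff_has_vector_derivative[symmetric] intro!: derivative_eq_intros)
  have c\<tau>: "isCont \<tau> t" for t using d\<tau> by (rule DERIV_isCont)
  have mono: "\<tau> a < \<tau> b" if "a < b" for a b
    using DERIV_pos_imp_increasing[OF that, of \<tau>] d\<tau> s by blast
  then have sm: "strict_mono \<tau>" by (rule strict_monoI)
  have shift: "\<tau> (t + P) = \<tau> t + T" for t unfolding \<tau>_def e(2) using P by (simp add: field_simps)
  have T: "T > 0" using mono[of 0 P] shift[of 0] P by simp
  have "continuous_on {0..P} g"
    by (rule continuous_on_vector_derivative[OF dg])
  then have "bounded (g ` {0..P})" by (intro compact_imp_bounded compact_continuous_image compact_Icc)
  then obtain K where K: "\<And>t. t \<in> {0..P} \<Longrightarrow> \<bar>g t\<bar> \<le> K"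
    unfolding bounded_iff by (metis imageI real_norm_def)
  have surj: "\<exists>t. \<tau> t = y" for y
  proof -
    define b where "b = (\<bar>y\<bar> + K) * P / T"
    have K0: "K \<ge> 0" using K[of 0] P by simp
    have "T / P * b = \<bar>y\<bar> + K" using T P by (simp add: b_def)
    then have "\<tau> (- b) \<le> y" "y \<le> \<tau> b"
      using K[OF e(1)[of b]] K[OF e(1)[of "- b"]] by (simp_all add: \<tau>_def)
    moreover have "- b \<le> b" using K0 T P by (simp add: b_def)
    ultimately obtain t where "- b \<le> t" "t \<le> b" "\<tau> t = y"
      using IVT'[of \<tau> "- b" y b] c\<tau> continuous_at_imp_continuous_on by blast
    then show ?thesis by blast
  qed
  define \<Theta> where "\<Theta> = inv \<tau>"
  have i1: "\<Theta> (\<tau> t) = t" for t using strict_mono_imp_inj_on[OF sm] by (simp add: \<Theta>_def inv_f_f)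
  have i2: "\<tau> (\<Theta> y) = y" for y using surj[of y] by (metis i1)
  have c\<Theta>: "isCont \<Theta> y" for y
    using isCont_inverse_function[of 1 "\<Theta> y" \<Theta> \<tau>] i1 i2 c\<tau> by simp
  have d\<Theta>: "(\<Theta> has_real_derivative inverse (s (\<Theta> y))) (at y)" for y
    by (rule DERIV_inverse_function[of \<tau> _ _ _ "y - 1" "y + 1"]) (use d\<tau> s i2 c\<Theta> in \<open>auto simp: less_imp_neq[symmetric]\<close>)
  define \<phi> where "\<phi> y = f (\<Theta> y)" for y
  have "(\<phi> has_vector_derivative F (\<phi> y)) (at y)" for y
  proof -
    have "((f \<circ> \<Theta>) has_vector_derivative inverse (s (\<Theta> y)) *\<^sub>R (s (\<Theta> y) *\<^sub>R F (f (\<Theta> y)))) (at y)"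
      by (rule vector_diff_chain_at[OF _ f]) (use d\<Theta> in \<open>simp add: has_real_derivative_iff_has_vector_derivative\<close>)
    then show ?thesis using s(1)[of "\<Theta> y"] by (simp add: \<phi>_def[abs_def] o_def)
  qed
  moreover have "\<phi> (y + T) = \<phi> y" for y
  proof -
    have "\<tau> (\<Theta> y + P) = y + T" by (simp add: shift i2)
    then have "\<Theta> (y + T) = \<Theta> y + P" using i1[of "\<Theta> y + P"] by simp
    then show ?thesis by (simp add: \<phi>_def per)
  qed
  moreover have "range \<phi> = range f"
  proof
    have "f t = \<phi> (\<tau> t)" for t by (simp add: \<phi>_def i1)
    then show "range f \<subseteq> range \<phi>" by auto
  qed (auto simp: \<phi>_def)
  ultimately show ?thesis using T by blast
qed

section \<open>Generalized polar coordinates and the change of time\<close>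

definition pol :: "real \<Rightarrow> real \<Rightarrow> real \<times> real" where "pol \<theta> r = (r^2 * cos \<theta>, r^3 * sin \<theta>)"

text \<open>The derivative of time with respect to the angle along an orbit.\<close>

definition slowness :: "real \<Rightarrow> real \<Rightarrow> real \<Rightarrow> real \<Rightarrow> real \<Rightarrow> real \<Rightarrow> real" where
  "slowness a22 a50 b13 b41 \<theta> r = (2 * cos \<theta> ^ 2 + 3 * sin \<theta> ^ 2) / (r ^ 7 * (Q0 \<theta> + Q1 a22 a50 b13 b41 \<theta> * r))"

lemma pol_deriv:
  assumes r: "(r has_real_derivative r t * ((R0 t + R1 a22 a50 b13 b41 t * r t) / (Q0 t + Q1 a22 a50 b13 b41 t * r t))) (at t within A)"
    and pos: "r t > 0" "Q0 t + Q1 a22 a50 b13 b41 t * r t > 0"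
  shows "((\<lambda>t. pol t (r t)) has_vector_derivative
    slowness a22 a50 b13 b41 t (r t) *\<^sub>R vfield a22 a50 b13 b41 (pol t (r t))) (at t within A)"
proof -
  define c s where "c = cos t" and "s = sin t"
  define a where "a = R0 t + R1 a22 a50 b13 b41 t * r t"
  define b where "b = Q0 t + Q1 a22 a50 b13 b41 t * r t"
  define D where "D = 2 * c^2 + 3 * s^2"
  have D: "D > 0" using sin_cos_squared_add[of t] by (simp add: D_def c_def s_def cos_squared_eq add_nonneg_pos)
  have b: "b > 0" using pos by (simp add: b_def)
  define X Y where "X = fst (vfield a22 a50 b13 b41 (pol t (r t)))" and "Y = snd (vfield a22 a50 b13 b41 (pol t (r t)))"
  have X: "D * X = r t ^ 9 * (2 * c * a - s * b)" and Y: "D * Y = r t ^ 10 * (3 * s * a + c * b)"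
    unfolding X_def Y_def vfield_def pol_def a_def b_def D_def R0_def R1_def Q0_def Q1_def c_def[symmetric] s_def[symmetric]
    by (simp_all only: prod.case fst_conv snd_conv) algebra+
  have sl: "slowness a22 a50 b13 b41 t (r t) = D / (r t ^ 7 * b)"
    by (simp add: slowness_def D_def c_def s_def b_def)
  have "((\<lambda>t. (r t)^2 * cos t) has_real_derivative 2 * r t * (r t * (a / b)) * c - (r t)^2 * s) (at t within A)"
    using r unfolding a_def b_def c_def s_def by (auto intro!: derivative_eq_intros)
  moreover have "2 * r t * (r t * (a / b)) * c - (r t)^2 * s = D / (r t ^ 7 * b) * X"
  proof -
    have "D / (r t ^ 7 * b) * X = (r t ^ 9 * (2 * c * a - s * b)) / (r t ^ 7 * b)" by (simp add: X[symmetric])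
    also have "\<dots> = 2 * r t * (r t * (a / b)) * c - (r t)^2 * s"
      using pos(1) b by (simp add: field_simps eval_nat_numeral)
    finally show ?thesis ..
  qed
  ultimately have dx: "((\<lambda>t. (r t)^2 * cos t) has_vector_derivative D / (r t ^ 7 * b) * X) (at t within A)"
    by (simp add: has_real_derivative_iff_has_vector_derivative)
  have "((\<lambda>t. (r t)^3 * sin t) has_real_derivative 3 * (r t)^2 * (r t * (a / b)) * s + (r t)^3 * c) (at t within A)"
    using r unfolding a_def b_def c_def s_def by (auto intro!: derivative_eq_intros)
  moreover have "3 * (r t)^2 * (r t * (a / b)) * s + (r t)^3 * c = D / (r t ^ 7 * b) * Y"
  proof -
    have "D / (r t ^ 7 * b) * Y = (r t ^ 10 * (3 * s * a + c * b)) / (r t ^ 7 * b)" by (simp add: Y[symmetric])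
    also have "\<dots> = 3 * (r t)^2 * (r t * (a / b)) * s + (r t)^3 * c"
      using pos(1) b by (simp add: field_simps eval_nat_numeral)
    finally show ?thesis ..
  qed
  ultimately have dy: "((\<lambda>t. (r t)^3 * sin t) has_vector_derivative D / (r t ^ 7 * b) * Y) (at t within A)"
    by (simp add: has_real_derivative_iff_has_vector_derivative)
  have "((\<lambda>t. pol t (r t)) has_vector_derivative (D / (r t ^ 7 * b) * X, D / (r t ^ 7 * b) * Y)) (at t within A)"
    unfolding pol_def by (rule has_vector_derivative_Pair[OF dx dy])
  then show ?thesis unfolding sl by (simp add: X_def Y_def scaleR_prod_def)
qed

lemma nu_less_2: "nu t < 2"
proof (rule ccontr)
  assume "\<not> nu t < 2"
  then have "nu t ^ 12 \<ge> 2 ^ 12" by (intro power_mono) auto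
  moreover have "cos t ^ 6 + sin t ^ 4 \<ge> 1/8"
  proof -
    define u where "u = cos t ^ 2"
    have u: "0 \<le> u" "u \<le> 1" by (simp_all add: u_def abs_square_le_1)
    have "cos t ^ 6 = u ^ 3" "sin t ^ 4 = (1 - u)^2"
      by (simp_all add: u_def power_mult[symmetric] sin_squared_eq[symmetric])
    moreover have "u ^ 3 + (1 - u)^2 \<ge> 1/8"
    proof (cases "u \<le> 1/2")
      case True
      then have "(1 - u)^2 \<ge> (1/2)^2" by (intro power_mono) auto
      moreover have "u ^ 3 \<ge> 0" using u by simp
      moreover have "(1/2)^2 = (1/4 :: real)" by (simp add: power2_eq_square)
      ultimately show ?thesis by linarith
    next
      case False
      then have "u ^ 3 \<ge> (1/2)^3" by (intro power_mono) auto
      moreover have "(1 - u)^2 \<ge> 0" by simp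
      moreover have "(1/2)^3 = (1/8 :: real)" by (simp add: power3_eq_cube)
      ultimately show ?thesis by linarith
    qed
    ultimately show ?thesis by simp
  qed
  ultimately have "nu t ^ 12 * (cos t ^ 6 + sin t ^ 4) \<ge> 2 ^ 12 * (1/8)"
    by (intro mult_mono) auto
  then show False using nu_power[of t] by simp
qed

text \<open>With \<open>q = r / r' < 1\<close> the unit vector at angle \<open>t'\<close> would have
  squared length \<open>q^4 cos^2 + q^6 sin^2\<close>, which is below 1.\<close>

lemma pol_inject_less:
  assumes "0 \<le> r" "r < r'" shows "pol t r \<noteq> pol t' r'"
proof
  assume "pol t r = pol t' r'"
  then have x: "r'^2 * cos t' = r^2 * cos t" and y: "r'^3 * sin t' = r^3 * sin t" by (auto simp: pol_def)
  define q where "q = r / r'"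
  have q: "0 \<le> q" "q < 1" using assms by (auto simp: q_def)
  have "cos t' = q^2 * cos t" "sin t' = q^3 * sin t"
    using x y assms by (simp_all add: q_def field_simps power_divide)
  then have "1 = q^4 * (cos t)^2 + q^6 * (sin t)^2"
    using sin_cos_squared_add2[of t'] by (simp add: power_mult_distrib power_mult[symmetric])
  also have "\<dots> \<le> q^4 * (cos t)^2 + q^4 * (sin t)^2"
    using q by (intro add_left_mono mult_right_mono power_decreasing) auto
  also have "\<dots> = q^4" by (simp add: distrib_left[symmetric])
  also have "\<dots> < 1" using q by (simp add: power_less_one_iff)
  finally show False by simp
qed

lemma pol_inject:
  assumes "pol t r = pol t' r'" "0 < r" "0 \<le> r'"
  shows "r = r'" "cos t = cos t'" "sin t = sin t'"
proof -
  show r: "r = r'"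
    using pol_inject_less[of r r' t t'] pol_inject_less[of r' r t' t] assms by (cases r r' rule: linorder_cases) auto
  then show "cos t = cos t'" "sin t = sin t'" using assms by (auto simp: pol_def)
qed

lemma angle_eq:
  assumes "cos t = cos t'" "sin t = sin t'" "t \<in> {0..2*pi}" "t' \<in> {0..2*pi}"
  shows "t = t' \<or> (t = 0 \<and> t' = 2*pi) \<or> (t = 2*pi \<and> t' = 0)"
proof -
  obtain n :: int where n: "t = t' + 2 * pi * n" using assms sin_cos_eq_iff[of t t'] by auto
  have "\<bar>2 * pi * real_of_int n\<bar> \<le> 2 * pi * 1" using n assms by auto
  then have "\<bar>real_of_int n\<bar> \<le> 1" by (simp add: abs_mult)
  then have "n = -1 \<or> n = 0 \<or> n = 1" by linarith
  then show ?thesis using n assms by auto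
qed

text \<open>By the intermediate value theorem some scaling \<open>(x q^2, y q^3)\<close> lies on the
  unit circle; then \<open>r = 1 / q\<close>.\<close>

lemma pol_surj:
  assumes "p \<noteq> (0, 0)"
  shows "\<exists>t\<in>{0..2*pi}. \<exists>r>0. p = pol t r"
proof -
  obtain x y where p: "p = (x, y)" by (cases p)
  define f where "f q = x^2 * q^4 + y^2 * q^6" for q :: real
  have xy: "x^2 + y^2 > 0" using assms p by (simp add: sum_power2_gt_zero_iff)
  define b where "b = max 1 (1 / (x^2 + y^2))"
  have "1 / (x^2 + y^2) \<le> b" by (simp add: b_def)
  then have b: "b \<ge> 1" "(x^2 + y^2) * b \<ge> 1" using xy by (simp add: b_def, simp add: divide_le_eq mult.commute)
  have "x^2 * b \<le> x^2 * b^4" "y^2 * b \<le> y^2 * b^6"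
    using b power_increasing[of 1 4 b] power_increasing[of 1 6 b] by (auto intro!: mult_left_mono)
  then have "f b \<ge> 1" using b by (simp add: f_def distrib_right)
  moreover have "f 0 \<le> 1" by (simp add: f_def)
  moreover have "continuous_on {0..b} f" unfolding f_def by (intro continuous_intros)
  ultimately obtain q where q: "0 \<le> q" "f q = 1" using IVT'[of f 0 1 b] b by auto
  then have q0: "q > 0" by (cases "q = 0") (auto simp: f_def)
  have "(x * q^2)^2 + (y * q^3)^2 = 1" using q(2) by (simp add: f_def power_mult_distrib power_mult[symmetric])
  then obtain t where t: "0 \<le> t" "t \<le> 2*pi" "x * q^2 = cos t" "y * q^3 = sin t"
    using sincos_total_2pi_le by metis
  have "p = pol t (1 / q)" using q0 t(3,4)[symmetric] by (simp add: p pol_def power_divide)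
  then show ?thesis using t q0 by (intro bexI[of _ t] exI[of _ "1/q"]) auto
qed

lemma norm_pol_ge: "norm (pol t r) \<ge> 1" if "r \<ge> 1"
proof -
  have "1 = (cos t)^2 + (sin t)^2" by simp
  also have "\<dots> \<le> r^4 * (cos t)^2 + r^6 * (sin t)^2"
  proof (rule add_mono)
    show "(cos t)^2 \<le> r^4 * (cos t)^2" "(sin t)^2 \<le> r^6 * (sin t)^2"
      using mult_right_mono[OF one_le_power[OF that, of 4], of "(cos t)^2"]
        mult_right_mono[OF one_le_power[OF that, of 6], of "(sin t)^2"] by simp_all
  qed
  also have "\<dots> = (r^2 * cos t)^2 + (r^3 * sin t)^2" by (simp add: power_mult_distrib power_mult[symmetric])
  finally show ?thesis by (simp add: pol_def norm_Pair)
qed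

lemma norm_pol_le:
  assumes "0 \<le> r" "r \<le> 1" shows "norm (pol t r) \<le> r"
proof -
  have "(r^2 * cos t)^2 + (r^3 * sin t)^2 \<le> r^2 * (cos t)^2 + r^2 * (sin t)^2"
    unfolding power_mult_distrib power_mult[symmetric]
    using assms by (intro add_mono mult_right_mono power_decreasing) auto
  also have "\<dots> = r^2" by (simp add: distrib_left[symmetric])
  finally show ?thesis using assms by (simp add: pol_def norm_Pair real_le_lsqrt)
qed


section \<open>The return map of the planar system\<close>

locale planar_flow = flow_data "drift a22 a50 b13 b41" "twist a22 a50 b13 b41" M "2*pi"
  for a22 a50 b13 b41 M :: real
begin

abbreviation "F \<equiv> vfield a22 a50 b13 b41"
definition "ret x = rflow (drift a22 a50 b13 b41) (twist a22 a50 b13 b41) (2*pi) x (2*pi)"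
definition "rr x t = nu t * rflow (drift a22 a50 b13 b41) (twist a22 a50 b13 b41) (2*pi) x t"
definition "slow x t = slowness a22 a50 b13 b41 t (rr x t)"

lemma two_pi_mem: "(0::real) \<in> {0..2*pi}" "2*pi \<in> {0..2*pi}" by simp_all

lemma rr_init: "\<bar>x\<bar> < R \<Longrightarrow> rr x 0 = x" and rr_end: "rr x (2*pi) = ret x"
  by (simp_all add: rr_def ret_def rflow_init basic_values)

lemma rr_pos: "0 < x \<Longrightarrow> x < R \<Longrightarrow> t \<in> {0..2*pi} \<Longrightarrow> rr x t > 0"
  using rflow_pos nu_pos by (simp add: rr_def)

lemma rr_mono: "\<bar>x\<bar> < R \<Longrightarrow> \<bar>y\<bar> < R \<Longrightarrow> t \<in> {0..2*pi} \<Longrightarrow> x < y \<Longrightarrow> rr x t < rr y t"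
  unfolding rr_def using nu_pos by (intro mult_strict_left_mono rflow_mono)

lemma rr_le: "0 \<le> x \<Longrightarrow> x < R \<Longrightarrow> t \<in> {0..2*pi} \<Longrightarrow> rr x t \<le> 4 * x"
proof -
  assume x: "0 \<le> x" "x < R" "t \<in> {0..2*pi}"
  have "rr x t \<le> 2 * (2 * x)"
    unfolding rr_def using rflow_bound(1)[of x t] nu_less_2[of t] nu_pos[of t] x
    by (intro order_trans[OF mult_left_mono mult_right_mono]) (auto simp: abs_le_iff)
  then show "rr x t \<le> 4 * x" by simp
qed

lemma R_less: "R \<le> 1/80"
proof -
  have "1 * 1 \<le> (M + 1) * (2*pi + 1)" using M0 by (intro mult_mono) auto
  then have "1 / (40 * ((M + 1) * (2*pi + 1))) \<le> 1 / 40" by (intro divide_left_mono) auto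
  then show ?thesis unfolding R_def small_radius_def mult.assoc by simp
qed

lemma rr_denominator_pos:
  assumes "\<bar>x\<bar> < R" "t \<in> {0..2*pi}"
  shows "Q0 t + Q1 a22 a50 b13 b41 t * rr x t > 0"
  unfolding rr_def Q_twist
  using rflow_denominator[OF assms] Q0_base_pos[of t] by (intro mult_pos_pos) (auto simp: Q0_def abs_le_iff)

lemma rr_deriv:
  assumes "\<bar>x\<bar> < R" "t \<in> {0..2*pi}"
  shows "(rr x has_real_derivative rr x t * ((R0 t + R1 a22 a50 b13 b41 t * rr x t) / (Q0 t + Q1 a22 a50 b13 b41 t * rr x t)))
    (at t within {0..2*pi})"
  unfolding rr_def[abs_def]
  by (rule polar_derivative(2)[OF _ rflow_deriv[OF assms]]) (use rflow_denominator[OF assms] in \<open>auto simp: abs_le_iff\<close>)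

lemma curve_deriv:
  assumes "0 < x" "x < R" "t \<in> {0..2*pi}"
  shows "((\<lambda>t. pol t (rr x t)) has_vector_derivative slow x t *\<^sub>R F (pol t (rr x t))) (at t within {0..2*pi})"
  unfolding slow_def using assms by (intro pol_deriv rr_deriv rr_pos rr_denominator_pos) auto

lemma continuous_on_rr: "\<bar>x\<bar> < R \<Longrightarrow> continuous_on {0..2*pi} (rr x)"
  by (rule DERIV_continuous_on[OF rr_deriv])

lemma slow_pos: "0 < x \<Longrightarrow> x < R \<Longrightarrow> t \<in> {0..2*pi} \<Longrightarrow> slow x t > 0"
proof -
  assume x: "0 < x" "x < R" "t \<in> {0..2*pi}"
  have "2 * cos t ^ 2 + 3 * sin t ^ 2 > 0" by (simp add: cos_squared_eq add_nonneg_pos)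
  then show "slow x t > 0"
    unfolding slow_def slowness_def using rr_pos[OF x] rr_denominator_pos[of x t] x
    by (intro divide_pos_pos mult_pos_pos) auto
qed

lemma continuous_on_slow: 
  assumes x: "0 < x" "x < R"
  shows "continuous_on {0..2*pi} (slow x)"
proof -
  have "rr x t ^ 7 * (Q0 t + Q1 a22 a50 b13 b41 t * rr x t) \<noteq> 0" if "t \<in> {0..2*pi}" for t
    using rr_pos[OF x that] rr_denominator_pos[of x t] x that by simp
  then show ?thesis unfolding slow_def[abs_def] slowness_def Q0_def Q1_def
    by (intro continuous_intros continuous_on_rr) (use x in auto)
qed

text \<open>The periodic solution run through the time \<open>\<tau>\<close>, whose slope is
  \<open>slow x\<close>, satisfies the same equation in the angle as the curve and agrees with it at
  \<open>t0\<close>.\<close>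

lemma orbit_contains_curve:
  assumes orb: "periodic_orbit F C" and x: "0 < x" "x < R"
    and t0: "t0 \<in> {0..2*pi}" "pol t0 (rr x t0) \<in> C" and t: "t \<in> {0..2*pi}"
  shows "pol t (rr x t) \<in> C"
proof -
  obtain \<phi> T where \<phi>: "\<And>t. (\<phi> has_vector_derivative F (\<phi> t)) (at t)" "T > 0" "\<And>t. \<phi> (t + T) = \<phi> t" "C = range \<phi>"
    using orb unfolding periodic_orbit_def by blast
  obtain u where u: "\<phi> u = pol t0 (rr x t0)" using t0 \<phi> by force
  define \<tau> where "\<tau> t = integral {0..t} (slow x) + (u - integral {0..t0} (slow x))" for t
  have d\<tau>: "(\<tau> has_vector_derivative slow x s) (at s within {0..2*pi})" if s: "s \<in> {0..2*pi}" for s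
  proof -
    have "(\<tau> has_real_derivative slow x s) (at s within {0..2*pi})"
      unfolding \<tau>_def using integral_has_real_derivative[OF continuous_on_slow[OF x] s]
      by (auto intro!: derivative_eq_intros)
    then show ?thesis by (simp add: has_real_derivative_iff_has_vector_derivative)
  qed
  have "bounded (range \<phi>)" using periodic_orbit_compact[OF \<phi>(1-3)] by (rule compact_imp_bounded)
  moreover have "bounded ((\<lambda>t. pol t (rr x t)) ` {0..2*pi})"
    by (intro compact_imp_bounded compact_continuous_image compact_Icc
        continuous_on_vector_derivative[OF curve_deriv[OF x]])
  ultimately have "bounded (range \<phi> \<union> (\<lambda>t. pol t (rr x t)) ` {0..2*pi})" by simp
  then obtain \<rho> where "\<forall>p\<in>range \<phi> \<union> (\<lambda>t. pol t (rr x t)) ` {0..2*pi}. norm p \<le> \<rho>"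
    unfolding bounded_iff by blast
  then have \<rho>: "norm (\<phi> s) \<le> \<rho>" "s' \<in> {0..2*pi} \<Longrightarrow> norm (pol s' (rr x s')) \<le> \<rho>" for s s' by auto
  obtain \<Lambda> where \<Lambda>: "\<And>p q. norm p \<le> \<rho> \<Longrightarrow> norm q \<le> \<rho> \<Longrightarrow> norm (F p - F q) \<le> \<Lambda> * norm (p - q)"
    using vfield_lipschitz by blast
  have "bounded (slow x ` {0..2*pi})"
    by (intro compact_imp_bounded compact_continuous_image compact_Icc continuous_on_slow x)
  then obtain K where K: "\<And>s. s \<in> {0..2*pi} \<Longrightarrow> \<bar>slow x s\<bar> \<le> K"
    unfolding bounded_iff by (metis imageI real_norm_def)
  have "(\<lambda>s. \<phi> (\<tau> s)) t = (\<lambda>s. pol s (rr x s)) t"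
  proof (rule ode_unique[where F = F and c = "slow x" and f = "\<lambda>s. \<phi> (\<tau> s)" and g = "\<lambda>s. pol s (rr x s)" and t = t])
    fix s assume s: "s \<in> {0..2*pi}"
    have "((\<phi> \<circ> \<tau>) has_vector_derivative slow x s *\<^sub>R F (\<phi> (\<tau> s))) (at s within {0..2*pi})"
      by (rule vector_diff_chain_within[OF d\<tau>[OF s] has_vector_derivative_at_within[OF \<phi>(1)]])
    then show "((\<lambda>s. \<phi> (\<tau> s)) has_vector_derivative slow x s *\<^sub>R F (\<phi> (\<tau> s))) (at s within {0..2*pi})"
      by (simp add: o_def)
    show "((\<lambda>s. pol s (rr x s)) has_vector_derivative slow x s *\<^sub>R F (pol s (rr x s))) (at s within {0..2*pi})"
      by (rule curve_deriv[OF x s])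
    show "\<bar>slow x s\<bar> \<le> K" by (rule K[OF s])
  next
    show "t0 \<in> {0..2*pi}" "\<phi> (\<tau> t0) = pol t0 (rr x t0)" using t0 u by (simp_all add: \<tau>_def)
  qed (use \<Lambda> K \<rho> t0 t u in \<open>auto simp: \<tau>_def\<close>)
  then have "pol t (rr x t) = \<phi> (\<tau> t)" by simp
  then show ?thesis using \<phi>(4) by simp
qed

lemma fixed_point_periodic_orbit:
  assumes x: "0 < x" "x < R" and fp: "ret x = x"
  shows "periodic_orbit F ((\<lambda>t. pol t (rr x t)) ` {0..2*pi})"
proof -
  define P :: real where "P = 2*pi"
  have P: "P > 0" by (simp add: P_def)
  \<comment> \<open>The angle modulo one turn. The fixed point equation makes the curve and its
    speed agree at 0 and \<open>P\<close>, so both extend periodically.\<close>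
  define e where "e t = t - P * of_int \<lfloor>t / P\<rfloor>" for t
  have e: "e t \<in> {0..P}" "e (t + P) = e t" for t
    using periodic_residue[OF P, of t] by (simp_all only: e_def)
  have e0: "e t = t" if "0 \<le> t" "t < P" for t
  proof -
    have "\<lfloor>t / P\<rfloor> = 0" using that P by (simp add: floor_eq_iff)
    then show ?thesis by (simp add: e_def)
  qed
  have eP: "e P = 0" using P by (simp add: e_def)
  have ends: "rr x 0 = x" "rr x P = x" using rr_init[of x] rr_end[of x] x fp by (simp_all add: P_def)
  define f where "f t = pol (e t) (rr x (e t))" for t
  define s where "s t = slow x (e t)" for t
  have slP: "slow x P = slow x 0" unfolding slow_def ends by (simp add: slowness_def Q0_def Q1_def P_def)
  have polP: "pol P (rr x P) = pol 0 (rr x 0)" unfolding ends by (simp add: pol_def P_def)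
  have ext: "f t = pol t (rr x t)" "s t = slow x t" if "t \<in> {0..P}" for t
    using that e0[of t] eP slP polP by (cases "t = P"; auto simp: f_def s_def)+
  have sp: "s t > 0" for t unfolding s_def using slow_pos[OF x] e(1)[of t] by (simp add: P_def)
  have cs: "continuous_on {0..P} s"
    by (rule continuous_on_eq[OF continuous_on_slow[OF x, folded P_def]]) (simp add: ext(2))
  have df: "(f has_vector_derivative s t *\<^sub>R F (f t)) (at t)" for t
  proof (rule periodic_extension_deriv[OF P])
    fix t assume t: "t \<in> {0..P}"
    have "((\<lambda>t. pol t (rr x t)) has_vector_derivative s t *\<^sub>R F (f t)) (at t within {0..P})"
      using curve_deriv[OF x, of t] t by (simp add: ext[OF t] P_def)
    then show "(f has_vector_derivative s t *\<^sub>R F (f t)) (at t within {0..P})"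
      by (rule has_vector_derivative_transform[OF t, rotated]) (use ext in auto)
  qed (simp_all add: f_def s_def e)
  obtain \<phi> T where \<phi>: "T > 0" "\<And>t. (\<phi> has_vector_derivative F (\<phi> t)) (at t)" "\<And>t. \<phi> (t + T) = \<phi> t" "range \<phi> = range f"
    using periodic_reparametrization[of P f s F, OF P _ _ sp cs df] by (auto simp: f_def s_def e)
  have rf: "range f = (\<lambda>t. pol t (rr x t)) ` {0..2*pi}"
  proof
    show "range f \<subseteq> (\<lambda>t. pol t (rr x t)) ` {0..2*pi}" using e(1) by (auto simp: f_def P_def)
    show "(\<lambda>t. pol t (rr x t)) ` {0..2*pi} \<subseteq> range f" using ext(1) by (auto simp: P_def) (metis rangeI)
  qed
  have "\<exists>t. \<phi> t \<noteq> \<phi> 0"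
  proof (rule ccontr)
    assume "\<not> (\<exists>t. \<phi> t \<noteq> \<phi> 0)"
    then have "f 0 = f pi" using \<phi>(4) by (metis rangeE rangeI)
    then have "pol 0 (rr x 0) = pol pi (rr x pi)" using ext(1)[of 0] ext(1)[of pi] by (simp add: P_def)
    then have "cos 0 = cos pi" using pol_inject(2)[of 0 "rr x 0" pi "rr x pi"] rr_pos[OF x, of 0] rr_pos[OF x, of pi] by simp
    then show False by simp
  qed
  then show ?thesis unfolding periodic_orbit_def rf[symmetric] \<phi>(4)[symmetric] using \<phi>(1-3) by blast
qed

lemma curve_mem_iff:
  assumes "periodic_orbit F C" "0 < x" "x < R"
  shows "pol 0 (ret x) \<in> C \<longleftrightarrow> pol 0 x \<in> C" "t \<in> {0..2*pi} \<Longrightarrow> pol t (rr x t) \<in> C \<Longrightarrow> pol 0 x \<in> C"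
proof -
  have e: "pol 0 (rr x 0) = pol 0 x" "pol (2*pi) (rr x (2*pi)) = pol 0 (ret x)"
    using rr_init[of x] assms by (simp_all add: rr_end pol_def)
  show "pol 0 (ret x) \<in> C \<longleftrightarrow> pol 0 x \<in> C"
    using orbit_contains_curve[OF assms two_pi_mem(1) _ two_pi_mem(2)] orbit_contains_curve[OF assms two_pi_mem(2) _ two_pi_mem(1)]
    unfolding e by blast
  show "pol 0 x \<in> C" if "t \<in> {0..2*pi}" "pol t (rr x t) \<in> C"
    using orbit_contains_curve[OF assms that two_pi_mem(1)] unfolding e .
qed

lemma continuous_on_ret: "continuous_on {-R<..<R} ret"
  unfolding ret_def[abs_def] by (rule continuous_on_rflow_initial) simp

lemma ret_mono: "\<bar>x\<bar> < R \<Longrightarrow> \<bar>y\<bar> < R \<Longrightarrow> x < y \<Longrightarrow> ret x < ret y"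
  unfolding ret_def by (rule rflow_mono) auto

text \<open>The fixed point may attract or repel on either side, so both directions of
  \<open>ret\<close> are needed. At a nearest point \<open>m\<close> different from
  \<open>x\<close>, monotonicity keeps \<open>ret m\<close> and the preimage of \<open>m\<close> on
  the same side of \<open>x\<close>, and one of them is strictly closer, since \<open>iso\<close>
  excludes \<open>ret m = m\<close>.\<close>

lemma orbit_reaches_fixed_point:
  assumes orb: "periodic_orbit F C" and x: "0 < x" and lohi: "0 < lo" "lo \<le> x" "x \<le> hi" "hi < R"
    and fp: "ret x = x" and iso: "\<And>w. lo \<le> w \<Longrightarrow> w \<le> hi \<Longrightarrow> w \<noteq> x \<Longrightarrow> ret w \<noteq> w"
    and y: "lo \<le> y" "y \<le> hi" "pol 0 y \<in> C"
  shows "pol 0 x \<in> C"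
proof -
  obtain \<phi> T where \<phi>: "\<And>t. (\<phi> has_vector_derivative F (\<phi> t)) (at t)" "T > 0" "\<And>t. \<phi> (t + T) = \<phi> t" "C = range \<phi>"
    using orb unfolding periodic_orbit_def by blast
  have clC: "closed C" using periodic_orbit_compact[OF \<phi>(1-3)] \<phi>(4) by (simp add: compact_imp_closed)
  have cp: "continuous_on A (pol 0)" for A unfolding pol_def[abs_def] by (intro continuous_intros)
  have compact_sec: "compact {w \<in> {a..b}. pol 0 w \<in> C}" for a b :: real
  proof -
    have "closed ({a..b} \<inter> pol 0 -` C)" by (rule continuous_closed_preimage[OF cp closed_atLeastAtMost clC])
    moreover have "{a..b} \<inter> pol 0 -` C = {w \<in> {a..b}. pol 0 w \<in> C}" by auto
    ultimately show ?thesis using compact_Int_closed[OF compact_Icc[of a b], of "{w \<in> {a..b}. pol 0 w \<in> C}"]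
      by (simp add: Int_absorb1 Collect_mono_iff subset_iff inf.absorb2)
  qed
  have cr: "continuous_on {a..b} ret" if "0 < a" "b < R" for a b
    by (rule continuous_on_subset[OF continuous_on_ret]) (use that in auto)
  have sec: "pol 0 (ret w) \<in> C \<longleftrightarrow> pol 0 w \<in> C" if "lo \<le> w" "w \<le> hi" for w
    using curve_mem_iff(1)[OF orb, of w] that lohi by auto
  show ?thesis
  proof (cases "y \<ge> x")
    case True
    have "{w \<in> {x..hi}. pol 0 w \<in> C} \<noteq> {}" using True y by auto
    then obtain m where m: "x \<le> m" "m \<le> hi" "pol 0 m \<in> C" and min: "\<And>w. x \<le> w \<Longrightarrow> w \<le> hi \<Longrightarrow> pol 0 w \<in> C \<Longrightarrow> m \<le> w"
      using compact_attains_inf[OF compact_sec[of x hi]] by auto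
    have "m = x"
    proof (rule ccontr)
      assume "m \<noteq> x"
      then have mx: "x < m" using m by simp
      have gt: "x < ret m" using ret_mono[of x m] mx m lohi fp x by simp
      show False
      proof (cases "ret m < m")
        case True
        then show False using min[of "ret m"] gt m sec[of m] lohi by auto
      next
        case False
        then have "ret x \<le> m" "m \<le> ret m" using fp mx by auto
        then obtain g where g: "x \<le> g" "g \<le> m" "ret g = m"
          using IVT'[of ret x m m] cr[of x m] mx m lohi x by auto
        then have "pol 0 g \<in> C" using sec[of g] m lohi by auto
        then have "g = m" using min[of g] g m by auto
        then show False using iso[of m] g m mx lohi by auto
      qed
    qed
    then show ?thesis using m by simp
  next
    case False
    have "y \<in> {w \<in> {lo..x}. pol 0 w \<in> C}" using False y by simp
    then have "{w \<in> {lo..x}. pol 0 w \<in> C} \<noteq> {}" by blast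
    then obtain m where m: "lo \<le> m" "m \<le> x" "pol 0 m \<in> C" and max: "\<And>w. lo \<le> w \<Longrightarrow> w \<le> x \<Longrightarrow> pol 0 w \<in> C \<Longrightarrow> w \<le> m"
      using compact_attains_sup[OF compact_sec[of lo x]] by auto
    have "m = x"
    proof (rule ccontr)
      assume "m \<noteq> x"
      then have mx: "m < x" using m by simp
      have lt: "ret m < x" using ret_mono[of m x] mx m lohi fp x by simp
      show False
      proof (cases "m < ret m")
        case True
        then show False using max[of "ret m"] lt m sec[of m] lohi by auto
      next
        case False
        then have "ret m \<le> m" "m \<le> ret x" using fp mx by auto
        then obtain g where g: "m \<le> g" "g \<le> x" "ret g = m"
          using IVT'[of ret m m x] cr[of m x] mx m lohi x by auto
        then have "pol 0 g \<in> C" using sec[of g] m lohi by auto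
        then have "g = m" using max[of g] g m by auto
        then show False using iso[of m] g m mx lohi by auto
      qed
    qed
    then show ?thesis using m by simp
  qed
qed

lemma continuous_on_pol:
  fixes a b :: "'a::t2_space \<Rightarrow> real"
  shows "continuous_on A a \<Longrightarrow> continuous_on A b \<Longrightarrow> continuous_on A (\<lambda>z. pol (a z) (b z))"
  unfolding pol_def by (intro continuous_intros)

lemma fixed_point_limit_cycle:
  assumes x: "0 < x" "x < R" and fp: "ret x = x" and y: "0 < y" "y < R" "ret y \<noteq> y"
  shows "limit_cycle F ((\<lambda>t. pol t (rr x t)) ` {0..2*pi})"
proof -
  let ?C = "(\<lambda>t. pol t (rr x t)) ` {0..2*pi}"
  have orbC: "periodic_orbit F ?C" by (rule fixed_point_periodic_orbit[OF x fp])
  obtain \<eta> where \<eta>: "\<eta> > 0" "\<And>w. \<bar>w - x\<bar> < \<eta> \<Longrightarrow> w \<noteq> x \<Longrightarrow> \<bar>w\<bar> < R \<and> ret w \<noteq> w"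
    using isolated_fixed_point[of x y] x fp y unfolding ret_def by blast
  define d where "d = min (\<eta> / 2) (min (x / 2) ((R - x) / 2))"
  define lo hi where "lo = x - d" and "hi = x + d"
  have d: "d > 0" using \<eta> x by (simp add: d_def)
  have lohi: "0 < lo" "lo < x" "x < hi" "hi < R"
    using d x by (auto simp: lo_def hi_def d_def min_def field_simps split: if_splits)
  have iso: "ret w \<noteq> w" if "lo \<le> w" "w \<le> hi" "w \<noteq> x" for w
  proof -
    have "d < \<eta>" using \<eta> by (simp add: d_def min_def)
    then have "\<bar>w - x\<bar> < \<eta>" using that by (auto simp: lo_def hi_def abs_if)
    then show ?thesis using \<eta>(2) that by blast
  qed
  \<comment> \<open>\<open>S1\<close> fills the inside of the curve through \<open>lo\<close>,
    origin included, and \<open>S2\<close> is a shell of radial width 1 outside the curve through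
    \<open>hi\<close>. Both are compact, so removing them from the unit ball leaves an open set.
    Width 1 suffices because points of the open unit ball have \<open>r < 1\<close>.\<close>
  define S1 where "S1 = (\<lambda>z. pol (fst z) (snd z * rr lo (fst z))) ` ({0..2*pi} \<times> {0..1})"
  define S2 where "S2 = (\<lambda>z. pol (fst z) (rr hi (fst z) + snd z)) ` ({0..2*pi} \<times> {0..1})"
  have cfst: "continuous_on ({0..2*pi} \<times> {0..1::real}) (\<lambda>z. rr w (fst z))" if "0 < w" "w < R" for w
    by (rule continuous_on_compose2[OF continuous_on_rr[of w]]) (use that in \<open>auto intro!: continuous_intros\<close>)
  have S: "compact S1" "compact S2"
    unfolding S1_def S2_def using lohi
    by (intro compact_continuous_image compact_Times compact_Icc continuous_on_pol continuous_intros cfst; simp)+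
  define W where "W = ball 0 1 - (S1 \<union> S2)"
  have oW: "open W" unfolding W_def using S by (intro open_Diff closed_Un compact_imp_closed) auto
  have CW: "?C \<subseteq> W"
  proof (rule image_subsetI)
    fix t assume t: "t \<in> {0..2*pi}"
    have r: "rr x t > 0" by (rule rr_pos[OF x t])
    have "rr x t \<le> 4 * x" using rr_le[of x t] x t by simp
    then have r1: "rr x t \<le> 1/20" using x R_less by simp
    then have n: "norm (pol t (rr x t)) < 1" using norm_pol_le[of "rr x t" t] r by simp
    have other: False
      if eq: "pol t (rr x t) = pol t' r'" and t': "t' \<in> {0..2*pi}" and r': "r' \<ge> 0"
        and cond: "r' \<le> rr lo t' \<or> r' \<ge> rr hi t'" for t' r'
    proof -
      have *: "rr x t = r'" "cos t = cos t'" "sin t = sin t'" using pol_inject[OF eq r r'] by auto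
      have "rr x t = rr x t'"
        using angle_eq[OF *(2,3) t t'] rr_init[of x] rr_end[of x] x fp by auto
      moreover have "rr lo t' < rr x t'" "rr x t' < rr hi t'"
        using rr_mono[of lo x t'] rr_mono[of x hi t'] lohi x t' by auto
      ultimately show False using * cond by auto
    qed
    have "pol t (rr x t) \<notin> S1"
    proof
      assume "pol t (rr x t) \<in> S1"
      then obtain t' s where s: "t' \<in> {0..2*pi}" "s \<in> {0..1}" "pol t (rr x t) = pol t' (s * rr lo t')"
        unfolding S1_def by auto
      have "rr lo t' > 0" using rr_pos[of lo t'] lohi s by auto
      then show False using other[OF s(3) s(1)] s(2) mult_right_mono[of s 1 "rr lo t'"] by auto
    qed
    moreover have "pol t (rr x t) \<notin> S2"
    proof
      assume "pol t (rr x t) \<in> S2"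
      then obtain t' s where s: "t' \<in> {0..2*pi}" "s \<in> {0..1}" "pol t (rr x t) = pol t' (rr hi t' + s)"
        unfolding S2_def by auto
      have "rr hi t' > 0" using rr_pos[of hi t'] lohi s by auto
      then show False using other[OF s(3) s(1)] s(2) by auto
    qed
    ultimately show "pol t (rr x t) \<in> W" using n by (simp add: W_def)
  qed
  have "C' = ?C" if C': "periodic_orbit F C'" "C' \<inter> W \<noteq> {}" for C'
  proof -
    obtain p where p: "p \<in> C'" "p \<in> W" using C' by blast
    have "pol 0 (0 * rr lo 0) \<in> S1" unfolding S1_def by (rule image_eqI[of _ _ "(0,0)"]) auto
    then have "p \<noteq> (0, 0)" using p by (auto simp: W_def pol_def)
    then obtain t r where t: "t \<in> {0..2*pi}" "r > 0" "p = pol t r" using pol_surj by blast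
    have r1: "r < 1" using norm_pol_ge[of r t] p t by (auto simp: W_def not_le[symmetric])
    have lor: "rr lo t > 0" "rr hi t > 0" using rr_pos[of lo t] rr_pos[of hi t] lohi t by auto
    have "rr lo t \<le> r"
    proof (rule ccontr)
      assume "\<not> rr lo t \<le> r"
      then have "p \<in> S1" unfolding S1_def t(3) using t lor
        by (intro image_eqI[of _ _ "(t, r / rr lo t)"]) auto
      then show False using p by (simp add: W_def)
    qed
    moreover have "r \<le> rr hi t"
    proof (rule ccontr)
      assume "\<not> r \<le> rr hi t"
      then have "p \<in> S2" unfolding S2_def t(3) using t lor r1
        by (intro image_eqI[of _ _ "(t, r - rr hi t)"]) auto
      then show False using p by (simp add: W_def)
    qed
    moreover have "continuous_on {lo..hi} (\<lambda>w. rr w t)"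
      unfolding rr_def
      by (intro continuous_intros continuous_on_subset[OF continuous_on_rflow_initial[OF t(1)]]) (use lohi in auto)
    ultimately obtain w where w: "lo \<le> w" "w \<le> hi" "rr w t = r"
      using IVT'[of "\<lambda>w. rr w t" lo r hi] lohi by auto
    have "pol 0 w \<in> C'"
      by (rule curve_mem_iff(2)[OF C'(1) _ _ t(1)]) (use w t p lohi in auto)
    then have "pol 0 x \<in> C'"
      by (intro orbit_reaches_fixed_point[OF C'(1) x(1) lohi(1) _ _ lohi(4) fp iso w(1,2)]) (use lohi in auto)
    moreover have "pol 0 x \<in> ?C"
      by (rule image_eqI[of _ _ 0]) (use rr_init[of x] x in auto)
    ultimately show "C' = ?C" using periodic_orbit_meet_eq[OF C'(1) orbC] by blast
  qed
  then show ?thesis unfolding limit_cycle_def using orbC oW CW by blast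
qed

lemma distinct_fixed_point_curves:
  assumes x: "0 < x" "x < R" "ret x = x" and y: "0 < y" "y < R" and xy: "x \<noteq> y"
  shows "(\<lambda>t. pol t (rr x t)) ` {0..2*pi} \<noteq> (\<lambda>t. pol t (rr y t)) ` {0..2*pi}"
proof
  assume eq: "(\<lambda>t. pol t (rr x t)) ` {0..2*pi} = (\<lambda>t. pol t (rr y t)) ` {0..2*pi}"
  have "pol 0 (rr y 0) \<in> (\<lambda>t. pol t (rr x t)) ` {0..2*pi}"
    unfolding eq by (rule image_eqI[of _ _ 0]) auto
  then obtain t where t: "t \<in> {0..2*pi}" "pol 0 (rr y 0) = pol t (rr x t)" unfolding image_iff by blast
  have y0: "rr y 0 = y" using rr_init[of y] y by simp
  have *: "y = rr x t" "cos 0 = cos t" "sin 0 = sin t"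
    using pol_inject[OF t(2)] rr_pos[OF x(1,2) t(1)] y unfolding y0 by auto
  have "t = 0 \<or> t = 2*pi" using angle_eq[OF *(2,3) two_pi_mem(1) t(1)] by auto
  then have "rr x t = x" using rr_init[of x] rr_end[of x] x by auto
  then show False using * xy by simp
qed

end

section \<open>The weak focus and the two limit cycles\<close>

context planar_flow
begin

definition "nu_coeff k t = nu t * taylor_coeff k t"

lemma polar_solution_rr: "\<bar>x\<bar> < R \<Longrightarrow> polar_solution a22 a50 b13 b41 x (rr x)"
  unfolding polar_solution_def using rr_init rr_denominator_pos rr_deriv by (auto simp: less_imp_neq[symmetric])

lemma solution_coeffs_nu: "solution_coeffs a22 a50 b13 b41 nu_coeff"
proof -
  have "(\<lambda>k. nu_coeff (Suc k) t * x ^ Suc k) sums rr x t" if x: "\<bar>x\<bar> < R" and t: "t \<in> {0..2*pi}" for x t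
  proof -
    \<comment> \<open>The solution starting at 0 is zero, so the constant coefficient vanishes and
      the series may start at index 1.\<close>
    have "(\<lambda>k. taylor_coeff k t * 0 ^ k) sums rflow (drift a22 a50 b13 b41) (twist a22 a50 b13 b41) (2*pi) 0 t"
      using rflow_sums[of 0 t] R_pos t by simp
    moreover have "(\<lambda>k. taylor_coeff k t * 0 ^ k) sums taylor_coeff 0 t" by (rule powser_sums_zero)
    ultimately have "taylor_coeff 0 t = 0" using rflow_zero[OF t] sums_unique2 by metis
    then have "nu_coeff 0 t = 0" by (simp add: nu_coeff_def)
    moreover have "(\<lambda>k. nu_coeff k t * x ^ k) sums rr x t"
      unfolding rr_def nu_coeff_def mult.assoc by (rule sums_mult[OF rflow_sums[OF x t]])
    ultimately show ?thesis by (subst sums_Suc_iff) simp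
  qed
  then show ?thesis unfolding solution_coeffs_def using R_pos polar_solution_rr by blast
qed

text \<open>The shift by 2 is the one between focal index and exponent. As
  \<open>nu (2 * pi) = 1\<close>, the coefficients for \<open>r\<close> and for \<open>z\<close>
  agree after one turn.\<close>

lemma unstable_weak_focus:
  assumes van: "\<And>j. j < 2 * m - 2 \<Longrightarrow> integral {0..2*pi} (focal (drift a22 a50 b13 b41) (twist a22 a50 b13 b41) j) = 0"
    and J: "integral {0..2*pi} (focal (drift a22 a50 b13 b41) (twist a22 a50 b13 b41) (2 * m - 2)) > 0" and m: "m \<ge> 1"
  shows "unstable_weak_focus_of_order a22 a50 b13 b41 m"
proof -
  have e: "2 * m - 2 + 2 = 2 * m" using m by simp
  have c: "nu_coeff k (2*pi) = (if k = 1 then 1 else if k = 2 * m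
      then integral {0..2*pi} (focal (drift a22 a50 b13 b41) (twist a22 a50 b13 b41) (2 * m - 2)) else 0)" if "k \<le> 2 * m" for k
  proof -
    have "taylor_coeff k (2*pi) = (if k = 1 then 1 else if k = 2 * m - 2 + 2
      then integral {0..2*pi} (focal (drift a22 a50 b13 b41) (twist a22 a50 b13 b41) (2 * m - 2)) else 0)"
      by (rule taylor_coeff_return) (use van that e in auto)
    then show ?thesis unfolding e by (simp add: nu_coeff_def basic_values)
  qed
  have "nu_coeff 1 (2*pi) = 1" using c[of 1] m by simp
  moreover have pos: "nu_coeff (2 * m) (2*pi) > 0" using c[of "2 * m"] J m by auto
  moreover have "first_nonzero_coeff nu_coeff (2 * m)"
    unfolding first_nonzero_coeff_def using c pos m by auto
  ultimately show ?thesis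
    unfolding unstable_weak_focus_of_order_def weak_focus_of_order_def using solution_coeffs_nu by blast
qed

text \<open>The displacement changes sign twice. The point \<open>h0\<close>, which is not fixed,
  serves as the witness that makes both zeros isolated; the radius \<open>4 * h0\<close> comes from
  \<open>rr_le\<close>.\<close>

lemma two_limit_cycles:
  assumes h: "0 < h2" "h2 < h1" "h1 < h0" "h0 < R"
    and s: "ret h2 > h2" "ret h1 < h1" "ret h0 > h0" and U: "\<And>p. norm p \<le> 4 * h0 \<Longrightarrow> p \<in> U"
  shows "\<exists>C1 C2. C1 \<noteq> C2 \<and> C1 \<subseteq> U \<and> C2 \<subseteq> U \<and> limit_cycle F C1 \<and> limit_cycle F C2"
proof -
  have c: "continuous_on {a..b} (\<lambda>x. ret x - x)" if "0 < a" "b < R" for a b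
    by (intro continuous_intros continuous_on_subset[OF continuous_on_ret]) (use that in auto)
  obtain x where x: "h2 \<le> x" "x \<le> h1" "ret x - x = 0"
    using IVT2'[of "\<lambda>x. ret x - x" h1 0 h2] c[of h2 h1] h s by auto
  obtain y where y: "h1 \<le> y" "y \<le> h0" "ret y - y = 0"
    using IVT'[of "\<lambda>x. ret x - x" h1 0 h0] c[of h1 h0] h s by auto
  have ne: "x \<noteq> y" using x y s by auto
  have sub: "(\<lambda>t. pol t (rr w t)) ` {0..2*pi} \<subseteq> U" if w: "0 < w" "w \<le> h0" for w
  proof (rule image_subsetI)
    fix t assume t: "t \<in> {0..2*pi}"
    have b: "0 < rr w t" "rr w t \<le> 4 * w" using rr_pos[of w t] rr_le[of w t] w h t by auto
    moreover have "4 * w \<le> 1" using w h R_less by linarith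
    ultimately have "norm (pol t (rr w t)) \<le> rr w t" by (intro norm_pol_le) auto
    then show "pol t (rr w t) \<in> U" using b w by (intro U) linarith
  qed
  have "limit_cycle F ((\<lambda>t. pol t (rr x t)) ` {0..2*pi})" "limit_cycle F ((\<lambda>t. pol t (rr y t)) ` {0..2*pi})"
    by (rule fixed_point_limit_cycle[of _ h0]; use h x y s in linarith)+
  moreover have "(\<lambda>t. pol t (rr x t)) ` {0..2*pi} \<noteq> (\<lambda>t. pol t (rr y t)) ` {0..2*pi}"
    by (rule distinct_fixed_point_curves) (use h x y ne in auto)
  moreover have "(\<lambda>t. pol t (rr x t)) ` {0..2*pi} \<subseteq> U" "(\<lambda>t. pol t (rr y t)) ` {0..2*pi} \<subseteq> U"
    using sub[of x] sub[of y] h x y by auto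
  ultimately show ?thesis by (intro exI conjI)
qed

end

theorem theorem4p3:
  fixes a22 a50 :: "real \<Rightarrow> real" and b13 b41 :: real
  assumes "b41 = 1"
    and "\<And>\<epsilon>\<^sub>1. a50 \<epsilon>\<^sub>1 = - (1/5) * (1 - \<epsilon>\<^sub>1)"
    and "\<And>\<epsilon>\<^sub>2. a22 \<epsilon>\<^sub>2 = 1/35 * (5 + 7 * \<epsilon>\<^sub>2)"
    and "b13 = 5/21"
  shows "unstable_weak_focus_of_order (a22 0) (a50 0) b13 b41 3 \<and>
    (\<forall>U. open U \<and> (0, 0) \<in> U \<longrightarrow>
      (\<exists>\<delta>\<^sub>2>0. \<forall>\<epsilon>\<^sub>2. 0 < \<epsilon>\<^sub>2 \<and> \<epsilon>\<^sub>2 < \<delta>\<^sub>2 \<longrightarrow>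
        (\<exists>\<delta>\<^sub>1>0. \<forall>\<epsilon>\<^sub>1. 0 < \<epsilon>\<^sub>1 \<and> \<epsilon>\<^sub>1 < \<delta>\<^sub>1 \<longrightarrow>
          (\<exists>C\<^sub>1 C\<^sub>2. C\<^sub>1 \<noteq> C\<^sub>2 \<and> C\<^sub>1 \<subseteq> U \<and> C\<^sub>2 \<subseteq> U \<and>
             limit_cycle (vfield (a22 \<epsilon>\<^sub>2) (a50 \<epsilon>\<^sub>1) b13 b41) C\<^sub>1 \<and>
             limit_cycle (vfield (a22 \<epsilon>\<^sub>2) (a50 \<epsilon>\<^sub>1) b13 b41) C\<^sub>2))))"
proof -
  obtain M where M: "M \<ge> 2"
    and fd: "\<And>a22 a50 b13 b41. \<bar>a22\<bar> \<le> 1 \<and> \<bar>a50\<bar> \<le> 1 \<and> \<bar>b13\<bar> \<le> 1 \<and> \<bar>b41\<bar> \<le> 1 \<Longrightarrow>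
      flow_data (drift a22 a50 b13 b41) (twist a22 a50 b13 b41) M (2*pi)"
    and diff: "\<And>a22 a50 a22' a50' b13 b41 e t. \<bar>a22 - a22'\<bar> \<le> e \<and> \<bar>a50 - a50'\<bar> \<le> e \<and> t \<in> {0..2*pi} \<Longrightarrow>
      \<bar>drift a22 a50 b13 b41 t - drift a22' a50' b13 b41 t\<bar> \<le> M * e \<and>
      \<bar>twist a22 a50 b13 b41 t - twist a22' a50' b13 b41 t\<bar> \<le> M * e"
    using system_flow_data by auto
  have p: "a22 0 = 1/7" "a50 0 = -1/5" "b13 = 5/21" "b41 = 1" using assms(1,4) assms(2)[of 0] assms(3)[of 0] by simp_all
  have p2: "a22 e = 1/7 + e/5" for e using assms(3)[of e] by (simp add: field_simps)
  have fd': "flow_data (drift (a22 e2) (a50 e1) b13 b41) (twist (a22 e2) (a50 e1) b13 b41) M (2*pi)"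
    if "0 \<le> e1" "e1 \<le> 1" "0 \<le> e2" "e2 \<le> 1" for e1 e2
    by (rule fd) (use that assms(2)[of e1] p2[of e2] p in \<open>auto simp: abs_le_iff\<close>)
  have pf: "planar_flow (a22 e2) (a50 e1) b13 b41 M"
    if "0 \<le> e1" "e1 \<le> 1" "0 \<le> e2" "e2 \<le> 1" for e1 e2
    unfolding planar_flow_def by (rule fd'[OF that])
  define Rad where "Rad = small_radius M (2*pi) / 2"
  define rt where "rt e1 e2 x = rflow (drift (a22 e2) (a50 e1) b13 b41) (twist (a22 e2) (a50 e1) b13 b41) (2*pi) x (2*pi)" for e1 e2 x
  define J where "J e1 e2 k = integral {0..2*pi} (focal (drift (a22 e2) (a50 e1) b13 b41) (twist (a22 e2) (a50 e1) b13 b41) k)" for e1 e2 k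
  \<comment> \<open>The constant \<open>4 * L * M\<close> of
    \<open>rflow_parameter_lipschitz\<close> for \<open>L = 2 * pi\<close>.\<close>
  define K where "K = 8 * pi * M"
  have K: "K > 0" using M by (simp add: K_def)
  have Rad: "Rad > 0" using M by (simp add: Rad_def small_radius_pos)
  have RadR: "flow_data.R M (2*pi) = Rad" if "flow_data G B M (2*pi)" for G B
    using flow_data.R_def[OF that] by (simp add: Rad_def)
  have sign: "\<exists>\<eta>>0. \<eta> \<le> Rad \<and> (\<forall>x. 0 < x \<and> x < \<eta> \<longrightarrow> (rt e1 e2 x - x) * J e1 e2 m > 0)"
    if e: "0 \<le> e1" "e1 \<le> 1" "0 \<le> e2" "e2 \<le> 1" and "\<And>j. j < m \<Longrightarrow> J e1 e2 j = 0" "J e1 e2 m \<noteq> 0" for e1 e2 m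
    using flow_data.displacement_sign[OF fd'[OF e], of m] that(5,6)
    unfolding RadR[OF fd'[OF e]] J_def rt_def by blast
  have cont: "\<bar>rt e1 e2 x - rt e1' e2' x\<bar> \<le> K * e"
    if "0 \<le> e1" "e1 \<le> 1" "0 \<le> e2" "e2 \<le> 1" "0 \<le> e1'" "e1' \<le> 1" "0 \<le> e2'" "e2' \<le> 1"
      and e: "\<bar>e1 - e1'\<bar> \<le> e" "\<bar>e2 - e2'\<bar> \<le> e" and x: "0 < x" "x < Rad" for e1 e2 e1' e2' e x
  proof -
    have "a22 e2 - a22 e2' = 1/5 * (e2 - e2')" "a50 e1 - a50 e1' = 1/5 * (e1 - e1')"
      using p2[of e2] p2[of e2'] assms(2)[of e1] assms(2)[of e1'] by (simp_all add: field_simps)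
    then have "\<bar>a22 e2 - a22 e2'\<bar> \<le> e" "\<bar>a50 e1 - a50 e1'\<bar> \<le> e" using e by (simp_all add: abs_mult)
    then have "\<bar>rt e1 e2 x - rt e1' e2' x\<bar> \<le> 4 * (2 * pi) * (M * e)"
      unfolding rt_def using diff x
      by (intro rflow_parameter_lipschitz[OF fd'[OF that(1-4)] fd'[OF that(5-8)]]) (auto simp: Rad_def)
    then show ?thesis by (simp add: K_def mult_ac)
  qed
  have J0: "J 0 0 0 = 0" "J 0 0 1 = 0" "J 0 0 2 = 0" "J 0 0 3 = 0" "J 0 0 4 > 0"
    using focal_four_value by (simp_all add: J_def p)
  have J00: "J 0 0 j = 0" if "j < 4" for j
  proof -
    have "j = 0 \<or> j = 1 \<or> j = 2 \<or> j = 3" using that by auto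
    then show ?thesis using J0 by blast
  qed
  have Je2: "J 0 e 0 = 0" "J 0 e 1 = 0" "J 0 e 2 < 0" if "e > 0" for e
  proof -
    show "J 0 e 0 = 0" "J 0 e 1 = 0" using focal_two_value(1,2)[of "e/5"] by (simp_all add: J_def p p2)
    have "(1 + 2 * (e/5)) * (e/5) / 84 * mono_integral 8 2 > 0"
      using that mono_integral_pos[of 8 2] by (intro mult_pos_pos divide_pos_pos) auto
    moreover have "J 0 e 2 = - ((1 + 2 * (e/5)) * (e/5) / 84 * mono_integral 8 2)"
      using focal_two_value(3)[of "e/5"] unfolding J_def p p2 by (simp only: minus_mult_left minus_divide_left)
    ultimately show "J 0 e 2 < 0" by linarith
  qed
  have Je1: "J e1 e2 0 > 0" if "e1 > 0" for e1 e2
  proof -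
    have "J e1 e2 0 = e1 / 10 * mono_integral 10 0"
      unfolding J_def p(4) focal_zero_value assms(2) by (simp add: field_simps)
    moreover have "e1 / 10 * mono_integral 10 0 > 0"
      using that mono_integral_pos[of 10 0] by (intro mult_pos_pos) auto
    ultimately show ?thesis by simp
  qed
  have focus: "unstable_weak_focus_of_order (a22 0) (a50 0) b13 b41 3"
    using planar_flow.unstable_weak_focus[OF pf[of 0 0], of 3] J00 J0(5) by (simp add: J_def)
  have "\<exists>\<delta>2>0. \<forall>e2. 0 < e2 \<and> e2 < \<delta>2 \<longrightarrow> (\<exists>\<delta>1>0. \<forall>e1. 0 < e1 \<and> e1 < \<delta>1 \<longrightarrow>
          (\<exists>C1 C2. C1 \<noteq> C2 \<and> C1 \<subseteq> U \<and> C2 \<subseteq> U \<and>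
             limit_cycle (vfield (a22 e2) (a50 e1) b13 b41) C1 \<and> limit_cycle (vfield (a22 e2) (a50 e1) b13 b41) C2))"
    if U: "open U" "(0, 0) \<in> U" for U
  proof -
    obtain \<rho> where \<rho>: "\<rho> > 0" "ball (0, 0) \<rho> \<subseteq> U" using U by (auto simp: open_contains_ball)
    obtain \<eta>0 where \<eta>0: "\<eta>0 > 0" "\<eta>0 \<le> Rad" "\<And>x. 0 < x \<Longrightarrow> x < \<eta>0 \<Longrightarrow> (rt 0 0 x - x) * J 0 0 4 > 0"
      using sign[of 0 0 4] J00 J0(5) by force
    \<comment> \<open>Chosen before any parameter: the displacement at \<open>h0\<close> is positive
      when both parameters vanish, and for \<open>e2 < \<delta>2\<close> the change
      \<open>K * e2\<close> is too small to alter this sign.\<close>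
    define h0 where "h0 = min \<eta>0 (\<rho> / 4) / 2"
    have h0: "0 < h0" "h0 < \<eta>0" "4 * h0 < \<rho>" using \<eta>0 \<rho> by (auto simp: h0_def min_def)
    have hR: "h0 < Rad" using h0 \<eta>0 by simp
    define d0 where "d0 = rt 0 0 h0 - h0"
    have d0: "d0 > 0" using \<eta>0(3)[OF h0(1,2)] J0(5) by (simp add: d0_def zero_less_mult_iff)
    define \<delta>2 where "\<delta>2 = min 1 (d0 / K)"
    show ?thesis
    proof (rule exI[of _ \<delta>2], intro conjI allI impI)
      show "\<delta>2 > 0" using d0 K by (simp add: \<delta>2_def)
      fix e2 assume e2: "0 < e2 \<and> e2 < \<delta>2"
      then have e21: "0 \<le> e2" "e2 \<le> 1" "K * e2 < d0" using K by (auto simp: \<delta>2_def field_simps)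
      have "\<bar>rt 0 0 h0 - rt 0 e2 h0\<bar> \<le> K * e2" using cont[of 0 0 0 e2 e2 h0] e21 h0 hR by simp
      then have d1: "rt 0 e2 h0 - h0 > 0" using e21 unfolding d0_def by linarith
      have "J 0 e2 j = 0" if "j < 2" for j using Je2[of e2] e2 that by (cases j) auto
      then obtain \<eta>1 where \<eta>1: "\<eta>1 > 0" "\<eta>1 \<le> Rad" "\<And>x. 0 < x \<Longrightarrow> x < \<eta>1 \<Longrightarrow> (rt 0 e2 x - x) * J 0 e2 2 > 0"
        using sign[of 0 e2 2] Je2(3)[of e2] e2 e21 by force
      \<comment> \<open>For \<open>e1 = 0\<close> and \<open>e2 > 0\<close> the leading focal value
        is that of index 2, which is negative, so the displacement is negative close to the
        origin.\<close>
      define h1 where "h1 = min \<eta>1 h0 / 2"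
      have h1: "0 < h1" "h1 < \<eta>1" "h1 < h0" using \<eta>1 h0 by (auto simp: h1_def min_def)
      have d2: "rt 0 e2 h1 - h1 < 0" using \<eta>1(3)[OF h1(1,2)] Je2(3)[of e2] e2 by (auto simp: zero_less_mult_iff)
      \<comment> \<open>Preserves the signs at \<open>h0\<close> and at \<open>h1\<close>
        simultaneously when \<open>e1\<close> is switched on.\<close>
      define \<delta>1 where "\<delta>1 = min 1 (min ((rt 0 e2 h0 - h0) / K) ((h1 - rt 0 e2 h1) / K))"
      show "\<exists>\<delta>1>0. \<forall>e1. 0 < e1 \<and> e1 < \<delta>1 \<longrightarrow>
          (\<exists>C1 C2. C1 \<noteq> C2 \<and> C1 \<subseteq> U \<and> C2 \<subseteq> U \<and>
             limit_cycle (vfield (a22 e2) (a50 e1) b13 b41) C1 \<and> limit_cycle (vfield (a22 e2) (a50 e1) b13 b41) C2)"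
      proof (rule exI[of _ \<delta>1], intro conjI allI impI)
        show "\<delta>1 > 0" using d1 d2 K by (simp add: \<delta>1_def)
        fix e1 assume e1: "0 < e1 \<and> e1 < \<delta>1"
        then have e11: "0 \<le> e1" "e1 \<le> 1" "K * e1 < rt 0 e2 h0 - h0" "K * e1 < h1 - rt 0 e2 h1"
          using K by (auto simp: \<delta>1_def pos_less_divide_eq mult.commute)
        have "\<bar>rt 0 e2 h0 - rt e1 e2 h0\<bar> \<le> K * e1" "\<bar>rt 0 e2 h1 - rt e1 e2 h1\<bar> \<le> K * e1"
          using cont[of 0 e2 e1 e2 e1] e11 e21 h0 h1 hR by simp_all
        then have r01: "rt e1 e2 h0 > h0" "rt e1 e2 h1 < h1" using e11 by linarith+
        obtain \<eta>2 where \<eta>2: "\<eta>2 > 0" "\<eta>2 \<le> Rad" "\<And>x. 0 < x \<Longrightarrow> x < \<eta>2 \<Longrightarrow> (rt e1 e2 x - x) * J e1 e2 0 > 0"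
          using sign[of e1 e2 0] Je1[of e1 e2] e1 e11 e21 by force
        \<comment> \<open>For \<open>e1 > 0\<close> the focal value of index 0 is positive and
          provides the third sign, at a point that may depend on both parameters.\<close>
        define h2 where "h2 = min \<eta>2 h1 / 2"
        have h2: "0 < h2" "h2 < \<eta>2" "h2 < h1" using \<eta>2 h1 by (auto simp: h2_def min_def)
        have r2: "rt e1 e2 h2 > h2" using \<eta>2(3)[OF h2(1,2)] Je1[of e1 e2] e1 by (auto simp: zero_less_mult_iff)
        interpret planar_flow "a22 e2" "a50 e1" b13 b41 M by (rule pf) (use e11 e21 in auto)
        show "\<exists>C1 C2. C1 \<noteq> C2 \<and> C1 \<subseteq> U \<and> C2 \<subseteq> U \<and>
             limit_cycle (vfield (a22 e2) (a50 e1) b13 b41) C1 \<and> limit_cycle (vfield (a22 e2) (a50 e1) b13 b41) C2"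
        proof (rule two_limit_cycles[OF h2(1,3) h1(3)])
          show "h0 < R" using hR RadR[OF flow_data_axioms] by simp
          show "p \<in> U" if "norm p \<le> 4 * h0" for p
          proof (rule subsetD[OF \<rho>(2)])
            have "dist (0, 0) p = norm p" by (metis dist_0_norm zero_prod_def)
            then show "p \<in> ball (0, 0) \<rho>" using that h0(3) by simp
          qed
        qed (use r01 r2 in \<open>simp_all add: rt_def planar_flow.ret_def[OF planar_flow_axioms]\<close>)
      qed
    qed
  qed
  then show ?thesis using focus by blast
qed

end
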